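(* Let $\Sigma$ be a complete $n$-dimensional properly immersed self-expander in $\mathbb{R}^m$, $n<m$. Assume that its mean curvature vector $\mathbf{H}$ satisfies $|\mathbf{H}|(x)\le a|x|+b$ for all $x\in\Sigma$, for some constants $0\le a<\frac12$ and $b>0$. Then for any $\alpha>\frac{4a^2}{1-4a^2}$: (i) $\displaystyle\int_\Sigma e^{-\frac{\alpha}{4}|x|^2}\,d\sigma<\infty$. (ii) There is a constant $C(\alpha)$ (independent of $r$) such that for all $r>0$ the volume of $B_r(0)\cap\Sigma$ satisfies $$\mathrm{Vol}(B_r(0)\cap\Sigma)\le C(\alpha)e^{\frac{\alpha}{4}r^2}.$$ In particular, if $0\le a<\frac{1}{2\sqrt2}$, then $\displaystyle\int_\Sigma e^{-\frac{|x|^2}{4}}\,d\sigma<\infty$.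
   Context: For an $n$-dimensional smooth immersed submanifold $\Sigma$ of $\mathbb{R}^m$ (with induced metric and volume form $d\sigma$), $x$ denotes the position vector, the second fundamental form is $A(X,Y)=(\overline\nabla_XY)^\perp$ ($\overline\nabla$ the Euclidean connection, $\perp$ the normal projection), and the mean curvature vector $\mathbf{H}$ is the trace of $A$. $\Sigma$ is a self-expander if $\mathbf{H}=\frac12x^\perp$. $\Sigma$ is properly immersed if the preimage under the immersion of every compact subset of $\mathbb{R}^m$ is compact. $B_r(0)$ is the round ball in $\mathbb{R}^m$ of radius $r$ centered at the origin; $B_r(0)\cap\Sigma$ is the set of points of $\Sigma$ mapped into it. *)

theory Defs
  imports "HOL-Analysis.Analysis"
begin

section \<open>Smooth maps between Euclidean spaces\<close>

text \<open>
  All uses below are on open sets \<open>S\<close>, where the Frechet derivative at a point of \<open>S\<close> only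
  depends on the restriction of \<open>f\<close> to \<open>S\<close>.
\<close>

primrec Ck_on :: "nat \<Rightarrow> 'a::euclidean_space set \<Rightarrow> ('a \<Rightarrow> 'b::real_normed_vector) \<Rightarrow> bool"
  where
    "Ck_on 0 S f \<longleftrightarrow> continuous_on S f"
  | "Ck_on (Suc k) S f \<longleftrightarrow>
       (\<forall>x\<in>S. f differentiable (at x)) \<and>
       (\<forall>v. Ck_on k S (\<lambda>x. frechet_derivative f (at x) v))"

definition smooth_on :: "'a::euclidean_space set \<Rightarrow> ('a \<Rightarrow> 'b::real_normed_vector) \<Rightarrow> bool"
  where "smooth_on S f \<longleftrightarrow> (\<forall>k. Ck_on k S f)"


section \<open>Smooth manifolds and immersions\<close>

text \<open>
  The underlying space of the manifold is a type \<open>'p\<close> of sort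
  \<open>{t2_space, second_countable_topology}\<close>. A chart is a pair \<open>(U, \<phi>)\<close> of an open set and a
  function whose restriction to \<open>U\<close> is a homeomorphism onto an open subset of Euclidean space;
  the values of \<open>\<phi>\<close> outside \<open>U\<close> are irrelevant.
\<close>

type_synonym ('p, 'n) chart = "'p set \<times> ('p \<Rightarrow> real ^ 'n)"

abbreviation chart_dom :: "('p, 'n) chart \<Rightarrow> 'p set"
  where "chart_dom c \<equiv> fst c"

abbreviation chart_map :: "('p, 'n) chart \<Rightarrow> 'p \<Rightarrow> real ^ 'n"
  where "chart_map c \<equiv> snd c"

definition chart_inv :: "('p, 'n) chart \<Rightarrow> real ^ 'n \<Rightarrow> 'p"
  where "chart_inv c = inv_into (chart_dom c) (chart_map c)"

definition is_chart :: "('p::topological_space, 'n::finite) chart \<Rightarrow> bool"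
  where "is_chart c \<longleftrightarrow>
    open (chart_dom c) \<and> open (chart_map c ` chart_dom c) \<and>
    homeomorphism (chart_dom c) (chart_map c ` chart_dom c) (chart_map c) (chart_inv c)"

definition smooth_atlas ::
    "('p::{t2_space, second_countable_topology}, 'n::finite) chart set \<Rightarrow> bool"
  where "smooth_atlas \<A> \<longleftrightarrow>
    (\<forall>c\<in>\<A>. is_chart c) \<and>
    (\<Union>c\<in>\<A>. chart_dom c) = UNIV \<and>
    (\<forall>c\<in>\<A>. \<forall>d\<in>\<A>.
       smooth_on (chart_map c ` (chart_dom c \<inter> chart_dom d)) (chart_map d \<circ> chart_inv c))"

definition smooth_immersion ::
    "('p::{t2_space, second_countable_topology}, 'n::finite) chart set \<Rightarrow>
     ('p \<Rightarrow> real ^ 'm::finite) \<Rightarrow> bool"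
  where "smooth_immersion \<A> F \<longleftrightarrow>
    (\<forall>c\<in>\<A>.
       smooth_on (chart_map c ` chart_dom c) (F \<circ> chart_inv c) \<and>
       (\<forall>x \<in> chart_map c ` chart_dom c.
          inj (frechet_derivative (F \<circ> chart_inv c) (at x))))"

definition proper_immersion :: "('p::topological_space \<Rightarrow> real ^ 'm::finite) \<Rightarrow> bool"
  where "proper_immersion F \<longleftrightarrow> (\<forall>K. compact K \<longrightarrow> compact (F -` K))"


section \<open>Geometry of a local parametrization\<close>

text \<open>Here \<open>X\<close> is an immersion of an open subset of \<open>real ^ 'n\<close> and \<open>x\<close> is a point of this set.\<close>

definition induced_metric :: "(real ^ 'n \<Rightarrow> real ^ 'm::finite) \<Rightarrow> real ^ 'n::finite \<Rightarrow> real ^ 'n ^ 'n"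
  where "induced_metric X x =
    (\<chi> i j. frechet_derivative X (at x) (axis i 1) \<bullet> frechet_derivative X (at x) (axis j 1))"

definition param_tangent :: "(real ^ 'n \<Rightarrow> real ^ 'm::finite) \<Rightarrow> real ^ 'n::finite \<Rightarrow> (real ^ 'm) set"
  where "param_tangent X x = range (frechet_derivative X (at x))"

definition normal_part :: "(real ^ 'm) set \<Rightarrow> real ^ 'm \<Rightarrow> real ^ 'm::finite"
  where "normal_part T w = (THE z. z \<in> T\<^sup>\<bottom> \<and> w - z \<in> T)"

text \<open>
  Vector fields \<open>u\<close>, \<open>v\<close> on the coordinate domain represent the tangent vector fields
  \<open>dX(u)\<close>, \<open>dX(v)\<close>; the Euclidean derivative of the second in the direction of the first is
  \<open>D\<^sub>u(dX(v))\<close>.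
\<close>

definition second_fundamental_form ::
    "(real ^ 'n \<Rightarrow> real ^ 'm::finite) \<Rightarrow>
     (real ^ 'n \<Rightarrow> real ^ 'n) \<Rightarrow> (real ^ 'n \<Rightarrow> real ^ 'n) \<Rightarrow> real ^ 'n::finite \<Rightarrow> real ^ 'm"
  where "second_fundamental_form X u v x =
    normal_part (param_tangent X x)
      (frechet_derivative (\<lambda>y. frechet_derivative X (at y) (v y)) (at x) (u x))"

text \<open>Trace with respect to the induced metric: \<open>H = \<Sum>\<^sub>i\<^sub>j g\<^sup>i\<^sup>j A(\<partial>\<^sub>i, \<partial>\<^sub>j)\<close>.\<close>

definition param_mean_curvature ::
    "(real ^ 'n \<Rightarrow> real ^ 'm::finite) \<Rightarrow> real ^ 'n::finite \<Rightarrow> real ^ 'm"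
  where "param_mean_curvature X x =
    (\<Sum>i\<in>UNIV. \<Sum>j\<in>UNIV. (matrix_inv (induced_metric X x) $ i $ j) *\<^sub>R
       second_fundamental_form X (\<lambda>_. axis i 1) (\<lambda>_. axis j 1) x)"


section \<open>Geometry of an immersed submanifold\<close>

text \<open>
  Tangent space and mean curvature vector at a point do not depend on the chart, so they are
  computed in an arbitrary chart around the point.
\<close>

definition chart_at :: "('p, 'n::finite) chart set \<Rightarrow> 'p \<Rightarrow> ('p, 'n) chart"
  where "chart_at \<A> p = (SOME c. c \<in> \<A> \<and> p \<in> chart_dom c)"

definition tangent_space ::
    "('p, 'n::finite) chart set \<Rightarrow> ('p \<Rightarrow> real ^ 'm::finite) \<Rightarrow> 'p \<Rightarrow> (real ^ 'm) set"
  where "tangent_space \<A> F p =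
    param_tangent (F \<circ> chart_inv (chart_at \<A> p)) (chart_map (chart_at \<A> p) p)"

definition mean_curvature ::
    "('p, 'n::finite) chart set \<Rightarrow> ('p \<Rightarrow> real ^ 'm::finite) \<Rightarrow> 'p \<Rightarrow> real ^ 'm"
  where "mean_curvature \<A> F p =
    param_mean_curvature (F \<circ> chart_inv (chart_at \<A> p)) (chart_map (chart_at \<A> p) p)"

definition self_expander ::
    "('p, 'n::finite) chart set \<Rightarrow> ('p \<Rightarrow> real ^ 'm::finite) \<Rightarrow> bool"
  where "self_expander \<A> F \<longleftrightarrow>
    (\<forall>p. mean_curvature \<A> F p = (1/2) *\<^sub>R normal_part (tangent_space \<A> F p) (F p))"

text \<open>
  The Riemannian volume: the unique Borel measure that has density \<open>sqrt (det g)\<close> with respect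
  to Lebesgue measure in every chart.
\<close>

definition volume_measure ::
    "('p::{t2_space, second_countable_topology}, 'n::finite) chart set \<Rightarrow>
     ('p \<Rightarrow> real ^ 'm::finite) \<Rightarrow> 'p measure"
  where "volume_measure \<A> F = (THE \<sigma>. sets \<sigma> = sets borel \<and>
    (\<forall>c\<in>\<A>. \<forall>E\<in>sets borel. E \<subseteq> chart_dom c \<longrightarrow>
       emeasure \<sigma> E =
         (\<integral>\<^sup>+x \<in> chart_map c ` E.
            ennreal (sqrt (det (induced_metric (F \<circ> chart_inv c) x))) \<partial>lborel)))"

text \<open>
  The length of a curve \<open>\<gamma>\<close> in the induced metric is the Euclidean length of \<open>F \<circ> \<gamma>\<close>. As an
  immersion is locally an embedding, a continuous curve \<open>\<gamma>\<close> is piecewise \<open>C\<^sup>1\<close> if and only if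
  \<open>F \<circ> \<gamma>\<close> is. The distance between points in different components is \<open>\<infinity>\<close>.
\<close>

definition curve_length :: "('p \<Rightarrow> real ^ 'm::finite) \<Rightarrow> (real \<Rightarrow> 'p) \<Rightarrow> ennreal"
  where "curve_length F \<gamma> =
    (\<integral>\<^sup>+t \<in> {0..1}. ennreal (norm (vector_derivative (F \<circ> \<gamma>) (at t))) \<partial>lborel)"

definition intrinsic_dist ::
    "('p::topological_space \<Rightarrow> real ^ 'm::finite) \<Rightarrow> 'p \<Rightarrow> 'p \<Rightarrow> ennreal"
  where "intrinsic_dist F p q =
    (INF \<gamma> \<in> {\<gamma>. path \<gamma> \<and> pathstart \<gamma> = p \<and> pathfinish \<gamma> = q \<and>
                  (F \<circ> \<gamma>) piecewise_C1_differentiable_on {0..1}}. curve_length F \<gamma>)"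

definition complete_immersed :: "('p::topological_space \<Rightarrow> real ^ 'm::finite) \<Rightarrow> bool"
  where "complete_immersed F \<longleftrightarrow>
    (\<forall>s::nat \<Rightarrow> 'p.
       (\<forall>e>0. \<exists>N. \<forall>i\<ge>N. \<forall>j\<ge>N. intrinsic_dist F (s i) (s j) < e) \<longrightarrow>
       (\<exists>l. (\<lambda>i. intrinsic_dist F (s i) l) \<longlonglongrightarrow> 0))"

end

theory Submission
  imports Defs
begin

text \<open>
  Let \<open>x\<^sup>T\<close> and \<open>x\<^sup>\<bottom>\<close> be the tangential and the normal part of the position vector. The ambient position
  field has derivative the identity, so the divergence of \<open>x\<^sup>T\<close> along the submanifold is
  \<open>n + \<langle>H, x\<rangle>\<close>. On a self-expander \<open>x\<^sup>\<bottom> = 2 H\<close>, hence \<open>\<langle>H, x\<rangle> = 2 |H|\<^sup>2\<close> and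
  \<open>|x\<^sup>T|\<^sup>2 = |x|\<^sup>2 - 4 |H|\<^sup>2\<close>, and for every function \<open>f\<close>

    \<open>div (f(|x|\<^sup>2) x\<^sup>T) = f(|x|\<^sup>2) (n + 2 |H|\<^sup>2) + 2 f'(|x|\<^sup>2) (|x|\<^sup>2 - 4 |H|\<^sup>2)\<close>.

  Take \<open>f(s) = e\<^bsup>-\<alpha>s/4\<^esup> \<chi>(s)\<close> with a decreasing cut-off \<open>\<chi>\<close>. Then \<open>f' \<le> -(\<alpha>/4) f\<close>, because the
  derivative of the cut-off has the favourable sign, so the divergence is at most
  \<open>f (n + 2 (1 + \<alpha>) |H|\<^sup>2 - (\<alpha>/2) |x|\<^sup>2)\<close>. Inserting \<open>|H| \<le> a |x| + b\<close> gives a quadratic in \<open>|x|\<close> with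
  leading coefficient \<open>2 (1 + \<alpha>) a\<^sup>2 - \<alpha>/2\<close>, and this is negative exactly if
  \<open>\<alpha> > 4 a\<^sup>2 / (1 - 4 a\<^sup>2)\<close>. The bracket is therefore at most \<open>-1\<close> outside some ball \<open>B\<close> and bounded by some
  \<open>K - 1\<close> in it (\<open>quadratic_drift_bound\<close>). As the immersion is proper, the vector field has compact
  support and its divergence integrates to zero; this bounds the integral of \<open>f(|x|\<^sup>2)\<close> by \<open>K\<close> times the
  volume of the preimage of \<open>B\<close>, which is compact. The bound does not depend on the cut-off, and exhausting
  the submanifold gives the first claim (\<open>weighted_volume_finite\<close>). The second follows because the weight
  is at least \<open>e\<^bsup>-\<alpha>r\<^sup>2/4\<^esup>\<close> on the ball of radius \<open>r\<close>, and the last is the case \<open>\<alpha> = 1\<close>.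

  Three ingredients have to be provided for an immersed manifold given by an atlas. In one chart the
  divergence identity is a computation with the induced metric, using the derivative of the determinant and
  the symmetry of second derivatives (\<open>divergence_tangential_position\<close>). Both sides of the identity and the
  volume density transform correctly under a change of chart (\<open>vol_density_eq\<close>, \<open>tangent_coords_eq\<close>,
  \<open>mean_curvature_eq\<close>), and by the change of variables theorem the densities define one measure
  (\<open>is_volume_exists\<close>, \<open>is_volume_unique\<close>). Finally the divergence theorem for compactly supported functions
  (\<open>integral_divergence_eq_0\<close>) follows from its version in one chart with the help of cut-off functions.
\<close>


section \<open>Continuously differentiable functions\<close>

lemma C1_onI:
  assumes "\<And>x. x \<in> S \<Longrightarrow> (f has_derivative f' x) (at x)"
    and "\<And>v. continuous_on S (\<lambda>x. f' x v)"
  shows "Ck_on 1 S f"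
proof -
  have "f differentiable at x" if "x \<in> S" for x
    using assms(1)[OF that] by (auto simp: differentiable_def)
  moreover have "frechet_derivative f (at x) = f' x" if "x \<in> S" for x
    using frechet_derivative_at[OF assms(1)[OF that]] by simp
  then have "continuous_on S (\<lambda>x. frechet_derivative f (at x) v)" for v
    using assms(2)[of v] by (simp cong: continuous_on_cong)
  ultimately show ?thesis by (simp add: One_nat_def)
qed

lemma C1_on_has_derivative:
  "Ck_on 1 S f \<Longrightarrow> x \<in> S \<Longrightarrow> (f has_derivative frechet_derivative f (at x)) (at x)"
  by (simp add: One_nat_def frechet_derivative_works)

lemma C1_on_continuous_derivative:
  "Ck_on 1 S f \<Longrightarrow> continuous_on S (\<lambda>x. frechet_derivative f (at x) v)"
  by (simp add: One_nat_def)

lemma C1_on_continuous_on: "Ck_on 1 S f \<Longrightarrow> continuous_on S f"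
  by (meson C1_on_has_derivative continuous_at_imp_continuous_on has_derivative_continuous)

lemma Ck_on_Suc_Suc_0_imp_C1: "Ck_on (Suc (Suc 0)) S f \<Longrightarrow> Ck_on 1 S f"
  by (auto simp: One_nat_def intro!: continuous_at_imp_continuous_on differentiable_imp_continuous_within)

lemma Ck_on_subset: "Ck_on k S f \<Longrightarrow> T \<subseteq> S \<Longrightarrow> Ck_on k T f"
  by (induction k arbitrary: f) (auto intro: continuous_on_subset)

lemma frechet_derivative_expand:
  assumes "f differentiable at x"
  shows "frechet_derivative f (at x) v = (\<Sum>b\<in>Basis. (v \<bullet> b) *\<^sub>R frechet_derivative f (at x) b)"
proof -
  have lin: "linear (frechet_derivative f (at x))"
    using assms by (rule linear_frechet_derivative)
  have "frechet_derivative f (at x) v = frechet_derivative f (at x) (\<Sum>b\<in>Basis. (v \<bullet> b) *\<^sub>R b)"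
    by (simp add: euclidean_representation)
  also have "\<dots> = (\<Sum>b\<in>Basis. (v \<bullet> b) *\<^sub>R frechet_derivative f (at x) b)"
    by (simp add: linear_sum[OF lin] linear_cmul[OF lin])
  finally show ?thesis .
qed

lemma C1_on_cong:
  assumes "open S" "\<And>x. x \<in> S \<Longrightarrow> f x = g x" "Ck_on 1 S f"
  shows "Ck_on 1 S g"
  using C1_on_has_derivative[OF assms(3)] C1_on_continuous_derivative[OF assms(3)]
  by (intro C1_onI) (auto intro: has_derivative_transform_within_open[OF _ assms(1)] assms(2))

lemma C1_on_Un:
  assumes "open S" "open T" "Ck_on 1 S f" "Ck_on 1 T f"
  shows "Ck_on 1 (S \<union> T) f"
  using C1_on_has_derivative[OF assms(3)] C1_on_has_derivative[OF assms(4)]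
    C1_on_continuous_derivative[OF assms(3)] C1_on_continuous_derivative[OF assms(4)]
  by (intro C1_onI) (auto intro: continuous_on_open_Un assms)

lemma C1_on_const: "Ck_on 1 S (\<lambda>_. c)"
  by (rule C1_onI[where f' = "\<lambda>_ _. 0"]) auto

lemma C1_on_ident: "Ck_on 1 S (\<lambda>x. x)"
  by (rule C1_onI[where f' = "\<lambda>_ v. v"]) auto

lemma C1_on_add:
  assumes "Ck_on 1 S f" "Ck_on 1 S g"
  shows "Ck_on 1 S (\<lambda>x. f x + g x)"
  using C1_on_has_derivative[OF assms(1)] C1_on_has_derivative[OF assms(2)]
    C1_on_continuous_derivative[OF assms(1)] C1_on_continuous_derivative[OF assms(2)]
  by (intro C1_onI[where f' = "\<lambda>x v. frechet_derivative f (at x) v + frechet_derivative g (at x) v"])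
    (auto intro!: has_derivative_add continuous_intros)

lemma C1_on_sum:
  assumes "\<And>i. i \<in> I \<Longrightarrow> Ck_on 1 S (f i)"
  shows "Ck_on 1 S (\<lambda>x. \<Sum>i\<in>I. f i x)"
  using assms
proof (induction I rule: infinite_finite_induct)
  case (insert i I)
  then show ?case using C1_on_add[of S "f i" "\<lambda>x. \<Sum>i\<in>I. f i x"] by simp
qed (simp_all add: C1_on_const)

lemma C1_on_bilinear:
  assumes "bounded_bilinear h" and f: "Ck_on 1 S f" and g: "Ck_on 1 S g"
  shows "Ck_on 1 S (\<lambda>x. h (f x) (g x))"
proof -
  interpret bounded_bilinear h by fact
  show ?thesis
  proof (rule C1_onI[OF FDERIV[OF C1_on_has_derivative[OF f] C1_on_has_derivative[OF g]]])
    show "continuous_on S (\<lambda>x. h (f x) (frechet_derivative g (at x) v) + h (frechet_derivative f (at x) v) (g x))" for v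
      by (intro continuous_on_add continuous_on C1_on_continuous_derivative[OF f]
          C1_on_continuous_derivative[OF g] C1_on_continuous_on[OF f] C1_on_continuous_on[OF g])
  qed
qed

lemmas C1_on_mult = C1_on_bilinear[OF bounded_bilinear_mult]
  and C1_on_inner = C1_on_bilinear[OF bounded_bilinear_inner]

lemma C1_on_prod:
  fixes f :: "'i \<Rightarrow> 'a::euclidean_space \<Rightarrow> real"
  assumes "\<And>i. i \<in> I \<Longrightarrow> Ck_on 1 S (f i)"
  shows "Ck_on 1 S (\<lambda>x. \<Prod>i\<in>I. f i x)"
  using assms
proof (induction I rule: infinite_finite_induct)
  case (insert i I)
  then show ?case using C1_on_mult[of S "f i" "\<lambda>x. \<Prod>i\<in>I. f i x"] by simp
qed (simp_all add: C1_on_const)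

lemma C1_on_compose:
  assumes g: "Ck_on 1 T g" and f: "Ck_on 1 S f" and sub: "f ` S \<subseteq> T"
  shows "Ck_on 1 S (\<lambda>x. g (f x))"
proof (rule C1_onI)
  fix x assume x: "x \<in> S"
  show "((\<lambda>x. g (f x)) has_derivative (\<lambda>v. frechet_derivative g (at (f x)) (frechet_derivative f (at x) v))) (at x)"
    using has_derivative_compose[OF C1_on_has_derivative[OF f x] C1_on_has_derivative[OF g, of "f x"]] x sub
    by auto
next
  fix v
  have "continuous_on S (\<lambda>x. \<Sum>b\<in>Basis. (frechet_derivative f (at x) v \<bullet> b) *\<^sub>R frechet_derivative g (at (f x)) b)"
    using continuous_on_compose2[OF C1_on_continuous_derivative[OF g] C1_on_continuous_on[OF f] sub]
    by (intro continuous_intros C1_on_continuous_derivative[OF f])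
  then show "continuous_on S (\<lambda>x. frechet_derivative g (at (f x)) (frechet_derivative f (at x) v))"
    using g sub
    by (simp add: frechet_derivative_expand[of g _ "frechet_derivative f _ _"] image_subset_iff One_nat_def
        cong: continuous_on_cong)
qed

lemma C1_on_real:
  assumes "\<And>t. t \<in> T \<Longrightarrow> (g has_real_derivative g' t) (at t)" "continuous_on T g'"
  shows "Ck_on 1 T g"
  using assms
  by (intro C1_onI[where f' = "\<lambda>t s. g' t * s"]) (auto simp: has_field_derivative_def intro!: continuous_intros)

lemma C1_on_inverse: "Ck_on 1 S f \<Longrightarrow> (\<And>x. x \<in> S \<Longrightarrow> f x \<noteq> (0::real)) \<Longrightarrow> Ck_on 1 S (\<lambda>x. inverse (f x))"
  by (rule C1_on_compose[OF C1_on_real[of "- {0}" inverse "\<lambda>t. - (inverse t ^ Suc (Suc 0))"]])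
    (use DERIV_inverse in \<open>auto intro!: continuous_intros\<close>)

lemma C1_on_sqrt: "Ck_on 1 S f \<Longrightarrow> (\<And>x. x \<in> S \<Longrightarrow> 0 < f x) \<Longrightarrow> Ck_on 1 S (\<lambda>x. sqrt (f x))"
  by (rule C1_on_compose[OF C1_on_real[of "{0<..}" sqrt "\<lambda>t. inverse (sqrt t) / 2"]])
    (auto intro!: DERIV_real_sqrt continuous_intros)

lemma C1_on_det:
  fixes A :: "'a::euclidean_space \<Rightarrow> real^'k^'k"
  assumes "\<And>i j. Ck_on 1 S (\<lambda>x. A x $ i $ j)"
  shows "Ck_on 1 S (\<lambda>x. det (A x))"
  unfolding det_def by (intro C1_on_sum C1_on_mult C1_on_const C1_on_prod assms)

text \<open>The square of the positive part is the simplest once, but not twice, differentiable function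
  that vanishes on a half-line; the cut-off functions below are built from it.\<close>

lemma pos_part_square_derivative: "((\<lambda>t::real. (max 0 t)\<^sup>2) has_real_derivative 2 * max 0 t) (at t)"
proof (cases "t = 0")
  case True
  have "norm ((max 0 h)\<^sup>2 / h) \<le> \<bar>h\<bar>" for h :: real
    by (cases "0 < h") (simp_all add: power2_eq_square)
  then have "((\<lambda>h::real. (max 0 h)\<^sup>2 / h) \<longlongrightarrow> 0) (at 0)"
    by (intro Lim_null_comparison[OF always_eventually tendsto_rabs_zero[OF tendsto_ident_at]]) simp
  then show ?thesis
    using True by (simp add: DERIV_def)
next
  case False
  have "((\<lambda>t::real. (if t < 0 then 0 else t\<^sup>2)) has_real_derivative 2 * max 0 t) (at t)"
  proof (cases "t < 0")
    case True
    have "((\<lambda>t::real. 0) has_real_derivative 2 * max 0 t) (at t)"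
      using True by simp
    then show ?thesis
      by (rule has_field_derivative_transform_within_open[where S = "{..<0}"]) (use True in auto)
  next
    case F: False
    have "((\<lambda>t::real. t\<^sup>2) has_real_derivative 2 * t) (at t)"
      by (auto intro!: derivative_eq_intros)
    then have "((\<lambda>t::real. t\<^sup>2) has_real_derivative 2 * max 0 t) (at t)"
      using F by simp
    then show ?thesis
      by (rule has_field_derivative_transform_within_open[where S = "{0<..}"]) (use F \<open>t \<noteq> 0\<close> in auto)
  qed
  then show ?thesis
    by (rule has_field_derivative_transform_within_open[where S = UNIV]) auto
qed

lemma C1_on_pos_part_square: "Ck_on 1 UNIV (\<lambda>t::real. (max 0 t)\<^sup>2)"
  by (rule C1_on_real[OF pos_part_square_derivative]) (intro continuous_intros)


section \<open>Integration of derivatives of compactly supported functions\<close>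

lemma frechet_derivative_eq_0_outside:
  assumes "closed K" "\<And>x. x \<notin> K \<Longrightarrow> f x = 0" "x \<notin> K"
  shows "frechet_derivative f (at x) v = 0"
proof -
  have "(f has_derivative (\<lambda>_. 0)) (at x)"
    by (rule has_derivative_transform_within_open[where f = "\<lambda>_. 0" and s = "- K"]) (use assms in auto)
  then show ?thesis by (simp add: frechet_derivative_at[symmetric])
qed

lemma integrable_continuous_compact_support:
  fixes f :: "'a::euclidean_space \<Rightarrow> real"
  assumes "continuous_on UNIV f" "compact K" "\<And>x. x \<notin> K \<Longrightarrow> f x = 0"
  shows "integrable lborel f"
proof -
  have "(\<lambda>x. indicator K x *\<^sub>R f x) = f"
    using assms(3) by (auto simp: fun_eq_iff indicator_def)
  then show ?thesis
    using borel_integrable_compact[OF assms(2) continuous_on_subset[OF assms(1), of K]] by simp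
qed

lemma lborel_integral_translation:
  fixes f :: "'a::euclidean_space \<Rightarrow> real"
  assumes "f \<in> borel_measurable borel"
  shows "(\<integral>x. f (x + c) \<partial>lborel) = (\<integral>x. f x \<partial>lborel)"
proof -
  have "(\<integral>x. f x \<partial>lborel) = (\<integral>x. f x \<partial>distr lborel borel ((+) c))"
    by (simp add: lborel_distr_plus)
  also have "\<dots> = (\<integral>x. f (c + x) \<partial>lborel)"
    by (rule integral_distr) (use assms in auto)
  finally show ?thesis by (simp add: add.commute)
qed

text \<open>The difference quotients of \<open>f\<close> have integral zero because Lebesgue measure is translation
  invariant, and they converge boundedly, on a fixed compact set, to the derivative.\<close>

lemma integral_frechet_derivative_eq_0:
  fixes f :: "'a::euclidean_space \<Rightarrow> real"
  assumes f: "Ck_on 1 UNIV f" and K: "compact K" and f0: "\<And>x. x \<notin> K \<Longrightarrow> f x = 0"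
  shows "integrable lborel (\<lambda>x. frechet_derivative f (at x) v)"
    and "(\<integral>x. frechet_derivative f (at x) v \<partial>lborel) = 0"
proof -
  let ?D = "\<lambda>x. frechet_derivative f (at x) v"
  have contD: "continuous_on UNIV ?D" by (rule C1_on_continuous_derivative[OF f])
  have contf: "continuous_on UNIV f" by (rule C1_on_continuous_on[OF f])
  have D0: "?D x = 0" if "x \<notin> K" for x
    using frechet_derivative_eq_0_outside[OF compact_imp_closed[OF K] f0 that] by simp
  show "integrable lborel ?D"
    by (rule integrable_continuous_compact_support[OF contD K D0])
  have "compact (?D ` K)"
    by (rule compact_continuous_image[OF continuous_on_subset[OF contD] K]) simp
  then have "bounded (?D ` K)" by (rule compact_imp_bounded)
  then obtain B0 where "\<forall>y\<in>?D ` K. norm y \<le> B0"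
    unfolding bounded_iff by blast
  then have B0: "\<bar>?D x\<bar> \<le> B0" if "x \<in> K" for x
    using that by simp
  define B where "B = max 0 B0"
  have B: "\<bar>?D x\<bar> \<le> B" for x
    using B0[of x] D0[of x] by (cases "x \<in> K") (auto simp: B_def)
  define K' where "K' = (\<lambda>(k, t). k - t *\<^sub>R v) ` (K \<times> {0..1::real})"
  have K': "compact K'"
    unfolding K'_def
    by (intro compact_continuous_image compact_Times K) (auto simp: case_prod_beta intro!: continuous_intros)
  have KK': "K \<subseteq> K'"
    unfolding K'_def by force
  define t where "t n = 1 / real (Suc n)" for n
  have t: "0 < t n" "t n \<le> 1" for n by (auto simp: t_def)
  have tlim: "filterlim t (at 0) sequentially"
    unfolding filterlim_at using t(1) LIMSEQ_inverse_real_of_nat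
    by (auto simp: t_def[abs_def] inverse_eq_divide)
  let ?q = "\<lambda>n x. (f (x + t n *\<^sub>R v) - f x) / t n"
  have along: "((\<lambda>s. f (x + s *\<^sub>R v)) has_real_derivative frechet_derivative f (at (x + s *\<^sub>R v)) v) (at s)" for x s
  proof -
    have "((\<lambda>s. f (x + s *\<^sub>R v)) has_derivative (\<lambda>h. frechet_derivative f (at (x + s *\<^sub>R v)) (h *\<^sub>R v))) (at s)"
      by (rule has_derivative_compose[OF _ C1_on_has_derivative[OF f]]) (auto intro!: derivative_eq_intros)
    moreover have "linear (frechet_derivative f (at (x + s *\<^sub>R v)))"
      using C1_on_has_derivative[OF f] has_derivative_linear by blast
    ultimately show ?thesis
      by (simp add: has_field_derivative_def linear_cmul mult_commute_abs)
  qed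
  have qlim: "(\<lambda>n. ?q n x) \<longlonglongrightarrow> ?D x" for x
    using filterlim_compose[OF along[of x 0, unfolded DERIV_def] tlim] by simp
  have qbound: "\<bar>?q n x\<bar> \<le> B * indicator K' x" for n x
  proof (cases "x \<in> K'")
    case True
    have "\<exists>z. z > 0 \<and> z < t n \<and>
        f (x + t n *\<^sub>R v) - f (x + 0 *\<^sub>R v) = (t n - 0) * frechet_derivative f (at (x + z *\<^sub>R v)) v"
      by (rule MVT2[OF t(1)]) (rule along)
    then obtain z where "f (x + t n *\<^sub>R v) - f x = t n * frechet_derivative f (at (x + z *\<^sub>R v)) v"
      by auto
    then have "?q n x = frechet_derivative f (at (x + z *\<^sub>R v)) v"
      using t(1)[of n] by simp
    then show ?thesis using B True by simp
  next
    case False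
    have "x + t n *\<^sub>R v \<notin> K"
    proof
      assume "x + t n *\<^sub>R v \<in> K"
      then have "x \<in> K'"
        unfolding K'_def using t(1,2)[of n]
        by (intro image_eqI[where x = "(x + t n *\<^sub>R v, t n)"]) auto
      with False show False ..
    qed
    then show ?thesis using False KK' f0 by auto
  qed
  have fm: "f \<in> borel_measurable borel"
    using contf by (rule borel_measurable_continuous_onI)
  have qint: "(\<integral>x. ?q n x \<partial>lborel) = 0" for n
  proof -
    have i1: "integrable lborel f"
      by (rule integrable_continuous_compact_support[OF contf K f0])
    have i2: "integrable lborel (\<lambda>x. f (x + t n *\<^sub>R v))"
    proof (rule integrable_continuous_compact_support)
      show "continuous_on UNIV (\<lambda>x. f (x + t n *\<^sub>R v))"
        by (rule continuous_on_compose2[OF contf]) (auto intro!: continuous_intros)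
      show "compact ((\<lambda>k. k - t n *\<^sub>R v) ` K)"
        by (intro compact_continuous_image K continuous_intros)
      show "f (x + t n *\<^sub>R v) = 0" if "x \<notin> (\<lambda>k. k - t n *\<^sub>R v) ` K" for x
        using that by (intro f0) force
    qed
    show ?thesis
      using i1 i2 by (simp add: lborel_integral_translation[OF fm])
  qed
  have "(\<lambda>n. \<integral>x. ?q n x \<partial>lborel) \<longlonglongrightarrow> (\<integral>x. ?D x \<partial>lborel)"
  proof (rule integral_dominated_convergence[where w = "\<lambda>x. B * indicator K' x"])
    show "?D \<in> borel_measurable lborel" 
      using borel_measurable_continuous_onI[OF contD] by simp
    show "?q n \<in> borel_measurable lborel" for n
      using fm by measurable
    show "integrable lborel (\<lambda>x. B * indicator K' x)"
      using K' by (auto intro!: emeasure_compact_finite borel_compact)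
  qed (use qlim qbound in auto)
  then show "(\<integral>x. ?D x \<partial>lborel) = 0"
    unfolding qint by (simp add: LIMSEQ_const_iff)
qed


section \<open>Symmetry of second derivatives\<close>

text \<open>The mean value theorem in both variables expresses the mixed second difference over a small
  parallelogram as a value of the second derivative nearby.\<close>

lemma second_difference_mean_value:
  fixes f :: "'a::euclidean_space \<Rightarrow> real"
  assumes f: "Ck_on (Suc (Suc 0)) S f" and "0 < s"
    and S: "\<And>p q. 0 \<le> p \<Longrightarrow> p \<le> s \<Longrightarrow> 0 \<le> q \<Longrightarrow> q \<le> s \<Longrightarrow> x + p *\<^sub>R u + q *\<^sub>R v \<in> S"
  shows "\<exists>p q. 0 < p \<and> p < s \<and> 0 < q \<and> q < s \<and>
    f (x + s *\<^sub>R u + s *\<^sub>R v) - f (x + s *\<^sub>R u) - f (x + s *\<^sub>R v) + f x =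
      s\<^sup>2 * frechet_derivative (\<lambda>y. frechet_derivative f (at y) u) (at (x + p *\<^sub>R u + q *\<^sub>R v)) v"
proof -
  have line: "((\<lambda>t. g (a + t *\<^sub>R w)) has_real_derivative frechet_derivative g (at (a + t *\<^sub>R w)) w) (at t)"
    if "g differentiable at (a + t *\<^sub>R w)" for g :: "'a \<Rightarrow> real" and a w t
  proof -
    have "((\<lambda>t. g (a + t *\<^sub>R w)) has_derivative (\<lambda>h. frechet_derivative g (at (a + t *\<^sub>R w)) (h *\<^sub>R w))) (at t)"
      by (rule has_derivative_compose[where f = "\<lambda>t. a + t *\<^sub>R w" and g = g])
        (use that in \<open>auto intro!: derivative_eq_intros simp: frechet_derivative_works\<close>)
    then show ?thesis
      using linear_frechet_derivative[OF that]
      by (simp add: has_field_derivative_def linear_cmul mult_commute_abs)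
  qed
  have d1: "f differentiable at y" and d2: "(\<lambda>y. frechet_derivative f (at y) u) differentiable at y"
    if "y \<in> S" for y
    using f that by auto
  let ?Du = "\<lambda>y. frechet_derivative f (at y) u"
  have "\<exists>p>0. p < s \<and> (f (x + s *\<^sub>R v + s *\<^sub>R u) - f (x + s *\<^sub>R u)) - (f (x + s *\<^sub>R v + 0 *\<^sub>R u) - f (x + 0 *\<^sub>R u))
      = (s - 0) * (?Du (x + s *\<^sub>R v + p *\<^sub>R u) - ?Du (x + p *\<^sub>R u))"
  proof (rule MVT2[OF \<open>0 < s\<close>])
    fix t assume t: "0 \<le> t" "t \<le> s"
    show "((\<lambda>t. f (x + s *\<^sub>R v + t *\<^sub>R u) - f (x + t *\<^sub>R u)) has_real_derivative
        ?Du (x + s *\<^sub>R v + t *\<^sub>R u) - ?Du (x + t *\<^sub>R u)) (at t)"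
      using S[of t s] S[of t 0] t \<open>0 < s\<close>
      by (intro DERIV_diff line d1) (simp_all add: add.commute add.left_commute)
  qed
  then obtain p where p: "0 < p" "p < s" and
    e1: "f (x + s *\<^sub>R v + s *\<^sub>R u) - f (x + s *\<^sub>R u) - (f (x + s *\<^sub>R v) - f x)
      = s * (?Du (x + s *\<^sub>R v + p *\<^sub>R u) - ?Du (x + p *\<^sub>R u))"
    by auto
  have "\<exists>q>0. q < s \<and> ?Du (x + p *\<^sub>R u + s *\<^sub>R v) - ?Du (x + p *\<^sub>R u + 0 *\<^sub>R v)
      = (s - 0) * frechet_derivative ?Du (at (x + p *\<^sub>R u + q *\<^sub>R v)) v"
    by (rule MVT2[OF \<open>0 < s\<close>], rule line, rule d2, rule S) (use p in auto)
  then obtain q where q: "0 < q" "q < s" and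
    e2: "?Du (x + p *\<^sub>R u + s *\<^sub>R v) - ?Du (x + p *\<^sub>R u)
      = s * frechet_derivative ?Du (at (x + p *\<^sub>R u + q *\<^sub>R v)) v"
    by auto
  have "f (x + s *\<^sub>R u + s *\<^sub>R v) - f (x + s *\<^sub>R u) - f (x + s *\<^sub>R v) + f x =
      s\<^sup>2 * frechet_derivative ?Du (at (x + p *\<^sub>R u + q *\<^sub>R v)) v"
    using e1 e2 by (simp add: algebra_simps power2_eq_square)
  with p q show ?thesis by blast
qed

lemma second_derivative_symmetric_real:
  fixes f :: "'a::euclidean_space \<Rightarrow> real"
  assumes f: "Ck_on (Suc (Suc 0)) S f" and "open S" "x \<in> S"
  shows "frechet_derivative (\<lambda>y. frechet_derivative f (at y) u) (at x) v =
    frechet_derivative (\<lambda>y. frechet_derivative f (at y) v) (at x) u"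
    (is "?A x = ?B x")
proof (rule ccontr)
  assume ne: "?A x \<noteq> ?B x"
  \<comment> \<open>otherwise continuity separates the two second derivatives near \<open>x\<close>, while both express the same difference\<close>
  define e where "e = \<bar>?A x - ?B x\<bar> / 2"
  have "e > 0" using ne by (simp add: e_def)
  have cA: "isCont ?A x" and cB: "isCont ?B x"
    using f \<open>open S\<close> \<open>x \<in> S\<close> by (auto simp: continuous_on_eq_continuous_at)
  obtain d1 where d1: "d1 > 0" "\<And>y. dist y x < d1 \<Longrightarrow> dist (?A y) (?A x) < e"
    using cA \<open>e > 0\<close> unfolding continuous_at_eps_delta by blast
  obtain d2 where d2: "d2 > 0" "\<And>y. dist y x < d2 \<Longrightarrow> dist (?B y) (?B x) < e"
    using cB \<open>e > 0\<close> unfolding continuous_at_eps_delta by blast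
  obtain d3 where d3: "d3 > 0" "\<And>y. dist y x < d3 \<Longrightarrow> y \<in> S"
    using \<open>open S\<close> \<open>x \<in> S\<close> unfolding open_dist by blast
  define d where "d = min d1 (min d2 d3)"
  have "d > 0" using d1 d2 d3 by (simp add: d_def)
  \<comment> \<open>so small that the parallelogram spanned by \<open>s u\<close> and \<open>s v\<close> at \<open>x\<close> lies in the ball of radius \<open>d\<close>\<close>
  define s where "s = d / (2 * (norm u + norm v + 1))"
  have np: "norm u + norm v + 1 > 0"
    using norm_ge_zero[of u] norm_ge_zero[of v] by linarith
  have "s > 0" using \<open>d > 0\<close> np by (simp add: s_def)
  have near: "dist (x + p *\<^sub>R u + q *\<^sub>R v) x < d" if "0 \<le> p" "p \<le> s" "0 \<le> q" "q \<le> s" for p q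
  proof -
    have "dist (x + p *\<^sub>R u + q *\<^sub>R v) x = norm (p *\<^sub>R u + q *\<^sub>R v)"
      by (simp add: dist_norm algebra_simps)
    also have "\<dots> \<le> p * norm u + q * norm v"
      using norm_triangle_ineq[of "p *\<^sub>R u" "q *\<^sub>R v"] that by simp
    also have "\<dots> \<le> s * norm u + s * norm v"
      using that by (intro add_mono mult_right_mono) auto
    also have "\<dots> \<le> s * (norm u + norm v + 1)"
      using \<open>s > 0\<close> by (simp add: algebra_simps)
    also have "\<dots> = d / 2" using np by (simp add: s_def field_simps)
    also have "\<dots> < d" using \<open>d > 0\<close> by simp
    finally show ?thesis .
  qed
  let ?\<Delta> = "f (x + s *\<^sub>R u + s *\<^sub>R v) - f (x + s *\<^sub>R u) - f (x + s *\<^sub>R v) + f x"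
  have inS: "x + p *\<^sub>R u + q *\<^sub>R v \<in> S" if "0 \<le> p" "p \<le> s" "0 \<le> q" "q \<le> s" for p q
    using near[OF that] by (intro d3(2)) (simp add: d_def)
  have inS': "x + p *\<^sub>R v + q *\<^sub>R u \<in> S" if "0 \<le> p" "p \<le> s" "0 \<le> q" "q \<le> s" for p q
    using inS[OF that(3,4,1,2)] by (simp add: algebra_simps)
  obtain p q where pq: "0 < p" "p < s" "0 < q" "q < s" "?\<Delta> = s\<^sup>2 * ?A (x + p *\<^sub>R u + q *\<^sub>R v)"
    using second_difference_mean_value[OF f \<open>s > 0\<close> inS] by blast
  obtain p' q' where pq': "0 < p'" "p' < s" "0 < q'" "q' < s"
    "f (x + s *\<^sub>R v + s *\<^sub>R u) - f (x + s *\<^sub>R v) - f (x + s *\<^sub>R u) + f x = s\<^sup>2 * ?B (x + p' *\<^sub>R v + q' *\<^sub>R u)"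
    using second_difference_mean_value[OF f \<open>s > 0\<close> inS'] by blast
  have "s\<^sup>2 * ?A (x + p *\<^sub>R u + q *\<^sub>R v) = s\<^sup>2 * ?B (x + q' *\<^sub>R u + p' *\<^sub>R v)"
    using pq(5) pq'(5) by (simp add: algebra_simps)
  then have "?A (x + p *\<^sub>R u + q *\<^sub>R v) = ?B (x + q' *\<^sub>R u + p' *\<^sub>R v)"
    using \<open>s > 0\<close> by simp
  moreover have "dist (?A (x + p *\<^sub>R u + q *\<^sub>R v)) (?A x) < e"
    using near[of p q] pq by (intro d1(2)) (simp add: d_def)
  moreover have "dist (?B (x + q' *\<^sub>R u + p' *\<^sub>R v)) (?B x) < e"
    using near[of q' p'] pq' by (intro d2(2)) (simp add: d_def)
  ultimately show False
    unfolding dist_real_def e_def by argo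
qed

lemma frechet_derivative_inner_left:
  assumes "f differentiable at x"
  shows "frechet_derivative (\<lambda>y. f y \<bullet> b) (at x) v = frechet_derivative f (at x) v \<bullet> b"
  using has_derivative_inner_left[OF assms[unfolded frechet_derivative_works], of b]
  by (simp add: frechet_derivative_at[symmetric])

lemma second_derivative_symmetric:
  fixes f :: "'a::euclidean_space \<Rightarrow> 'b::euclidean_space"
  assumes f: "Ck_on (Suc (Suc 0)) S f" and "open S" "x \<in> S"
  shows "frechet_derivative (\<lambda>y. frechet_derivative f (at y) u) (at x) v =
    frechet_derivative (\<lambda>y. frechet_derivative f (at y) v) (at x) u"
proof (rule euclidean_eqI)
  fix b :: 'b assume "b \<in> Basis"
  let ?fb = "\<lambda>y. f y \<bullet> b"
  have d1: "f differentiable at y" and d2: "(\<lambda>y. frechet_derivative f (at y) w) differentiable at y"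
    if "y \<in> S" for y w
    using f that by auto
  have first: "frechet_derivative ?fb (at y) w = frechet_derivative f (at y) w \<bullet> b" if "y \<in> S" for y w
    by (rule frechet_derivative_inner_left[OF d1[OF that]])
  have D: "((\<lambda>y. frechet_derivative ?fb (at y) w) has_derivative
      (\<lambda>z. frechet_derivative (\<lambda>y. frechet_derivative f (at y) w) (at y) z \<bullet> b)) (at y)" if "y \<in> S" for y w
    by (rule has_derivative_transform_within_open[OF
          has_derivative_inner_left[OF d2[OF that, unfolded frechet_derivative_works]] \<open>open S\<close> that])
      (simp add: first)
  have second: "frechet_derivative (\<lambda>y. frechet_derivative ?fb (at y) w) (at y) z =
      frechet_derivative (\<lambda>y. frechet_derivative f (at y) w) (at y) z \<bullet> b" if "y \<in> S" for y w z
    using fun_cong[OF frechet_derivative_at[OF D[OF that]]] by metis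
  have "Ck_on (Suc (Suc 0)) S ?fb"
  proof -
    have "?fb differentiable at y" if "y \<in> S" for y
      using d1[OF that] by (simp add: differentiable_inner)
    moreover have "(\<lambda>y. frechet_derivative ?fb (at y) w) differentiable at y" if "y \<in> S" for y w
      using D[OF that] by (auto simp: differentiable_def)
    moreover have "continuous_on S (\<lambda>y. frechet_derivative (\<lambda>y. frechet_derivative ?fb (at y) w) (at y) z)" for w z
    proof -
      have "continuous_on S (\<lambda>y. frechet_derivative (\<lambda>y. frechet_derivative f (at y) w) (at y) z \<bullet> b)"
        using f by (intro continuous_intros) auto
      then show ?thesis by (simp add: second cong: continuous_on_cong)
    qed
    ultimately show ?thesis by simp
  qed
  from second_derivative_symmetric_real[OF this assms(2,3), of u v]
  show "frechet_derivative (\<lambda>y. frechet_derivative f (at y) u) (at x) v \<bullet> b =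
      frechet_derivative (\<lambda>y. frechet_derivative f (at y) v) (at x) u \<bullet> b"
    by (simp add: second[OF \<open>x \<in> S\<close>])
qed


section \<open>The derivative of the determinant\<close>

lemma matrix_inv_of_det_nonzero:
  fixes A :: "real^'k^'k"
  assumes "det A \<noteq> 0"
  shows "matrix_inv A ** A = mat 1" "A ** matrix_inv A = mat 1"
proof -
  have "\<exists>B. A ** B = mat 1 \<and> B ** A = mat 1"
    using assms by (simp add: invertible_det_nz[symmetric] invertible_def)
  then have "A ** matrix_inv A = mat 1 \<and> matrix_inv A ** A = mat 1"
    unfolding matrix_inv_def by (rule someI_ex)
  then show "matrix_inv A ** A = mat 1" "A ** matrix_inv A = mat 1" by auto
qed

text \<open>Jacobi's formula. By multilinearity the derivative is the sum over \<open>k\<close> of determinants with row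
  \<open>k\<close> replaced by its derivative, which Cramer's rule evaluates.\<close>

lemma has_derivative_det:
  fixes A :: "'a::real_normed_vector \<Rightarrow> real^'k^'k"
  assumes A: "\<And>i j. ((\<lambda>x. A x $ i $ j) has_derivative A' i j) (at x)" and det: "det (A x) \<noteq> 0"
  shows "((\<lambda>x. det (A x)) has_derivative
    (\<lambda>v. det (A x) * (\<Sum>i\<in>UNIV. \<Sum>j\<in>UNIV. A' i j v * matrix_inv (A x) $ j $ i))) (at x)"
proof -
  let ?P = "{p. p permutes (UNIV::'k set)}"
  have inv: "matrix_inv (A x) ** A x = mat 1"
    using det by (rule matrix_inv_of_det_nonzero)
  have row: "(\<Sum>p\<in>?P. of_int (sign p) * (A' k (p k) v * (\<Prod>i\<in>UNIV - {k}. A x $ i $ p i))) =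
      (\<Sum>j\<in>UNIV. A' k j v * matrix_inv (A x) $ j $ k) * det (A x)" for k v
  proof -
    define c :: "real^'k" where "c = (\<chi> j. \<Sum>l\<in>UNIV. A' k l v * matrix_inv (A x) $ l $ j)"
    have "(\<Sum>i\<in>UNIV. c $ i *s row i (A x)) $ m = A' k m v" for m
    proof -
      have "(\<Sum>i\<in>UNIV. c $ i *s row i (A x)) $ m
          = (\<Sum>i\<in>UNIV. \<Sum>l\<in>UNIV. A' k l v * (matrix_inv (A x) $ l $ i * A x $ i $ m))"
        by (simp add: c_def row_def sum_distrib_right mult.assoc)
      also have "\<dots> = (\<Sum>l\<in>UNIV. A' k l v * (matrix_inv (A x) ** A x) $ l $ m)"
        by (subst sum.swap) (simp add: matrix_matrix_mult_def sum_distrib_left)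
      also have "\<dots> = A' k m v"
        by (simp add: inv mat_def if_distrib cong: if_cong)
      finally show ?thesis .
    qed
    then have c: "(\<Sum>i\<in>UNIV. c $ i *s row i (A x)) = (\<chi> j. A' k j v)"
      by (simp add: vec_eq_iff)
    have "(\<Sum>p\<in>?P. of_int (sign p) * (A' k (p k) v * (\<Prod>i\<in>UNIV - {k}. A x $ i $ p i))) =
        det (\<chi> i. if i = k then (\<chi> j. A' k j v) else row i (A x))"
      unfolding det_def
    proof (rule sum.cong[OF refl])
      fix p
      show "of_int (sign p) * (A' k (p k) v * (\<Prod>i\<in>UNIV - {k}. A x $ i $ p i)) =
        of_int (sign p) * (\<Prod>i\<in>UNIV. (\<chi> i. if i = k then (\<chi> j. A' k j v) else row i (A x)) $ i $ p i)"
        by (subst prod.remove[of UNIV k]) (auto simp: row_def intro!: prod.cong)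
    qed
    also have "\<dots> = c $ k * det (A x)"
      using cramer_lemma_transpose[of k c "A x", unfolded c] .
    finally show ?thesis by (simp add: c_def)
  qed
  have "((\<lambda>x. det (A x)) has_derivative
      (\<lambda>v. \<Sum>p\<in>?P. of_int (sign p) * (\<Sum>k\<in>UNIV. A' k (p k) v * (\<Prod>i\<in>UNIV - {k}. A x $ i $ p i)))) (at x)"
    unfolding det_def
    by (intro has_derivative_sum has_derivative_mult_right has_derivative_prod A)
  also have "(\<lambda>v. \<Sum>p\<in>?P. of_int (sign p) * (\<Sum>k\<in>UNIV. A' k (p k) v * (\<Prod>i\<in>UNIV - {k}. A x $ i $ p i))) =
      (\<lambda>v. \<Sum>k\<in>UNIV. \<Sum>p\<in>?P. of_int (sign p) * (A' k (p k) v * (\<Prod>i\<in>UNIV - {k}. A x $ i $ p i)))"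
    by (subst sum.swap) (simp add: sum_distrib_left)
  also have "\<dots> = (\<lambda>v. det (A x) * (\<Sum>i\<in>UNIV. \<Sum>j\<in>UNIV. A' i j v * matrix_inv (A x) $ j $ i))"
    unfolding row by (simp add: sum_distrib_left mult.commute)
  finally show ?thesis .
qed


section \<open>Gram matrices and normal parts\<close>

definition gram :: "(real^'n \<Rightarrow> real^'m::finite) \<Rightarrow> real^'n::finite^'n"
  where "gram L = (\<chi> i j. L (axis i 1) \<bullet> L (axis j 1))"

lemma induced_metric_eq_gram: "induced_metric X x = gram (frechet_derivative X (at x))"
  by (simp add: induced_metric_def gram_def)

lemma linear_axis_expansion:
  fixes L :: "real^'n::finite \<Rightarrow> 'b::real_vector"
  assumes "linear L"
  shows "L w = (\<Sum>k\<in>UNIV. (w $ k) *\<^sub>R L (axis k 1))"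
proof -
  have "w = (\<Sum>k\<in>UNIV. (w $ k) *\<^sub>R axis k 1)"
    using basis_expansion[of w] by (simp add: scalar_mult_eq_scaleR)
  then show ?thesis
    using linear_sum[OF assms] linear_cmul[OF assms] by (metis (no_types, lifting) sum.cong)
qed

lemma gram_mult_vector: "linear L \<Longrightarrow> (gram L *v w) $ i = L (axis i 1) \<bullet> L w"
  using linear_axis_expansion[of L w]
  by (simp add: gram_def matrix_vector_mult_def inner_sum_right mult.commute)

lemma inner_gram: "linear L \<Longrightarrow> u \<bullet> (gram L *v w) = L u \<bullet> L w"
  using linear_axis_expansion[of L u]
  by (simp add: inner_vec_def[of u] gram_mult_vector inner_sum_left)

lemma gram_commute: "gram L $ i $ j = gram L $ j $ i"
  by (simp add: gram_def inner_commute)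

text \<open>The determinant does not vanish on the segment from the identity matrix to a positive definite
  matrix, hence keeps its sign there.\<close>

lemma det_gram_pos:
  assumes "linear L" "inj L"
  shows "0 < det (gram L)"
proof (rule ccontr)
  assume neg: "\<not> 0 < det (gram L)"
  let ?M = "\<lambda>t::real. (\<chi> i j. (1 - t) * mat 1 $ i $ j + t * gram L $ i $ j)"
  have M1: "?M 1 = gram L" and M0: "?M 0 = mat 1"
    by (simp_all add: vec_eq_iff)
  have "continuous_on {0..1} (\<lambda>t. det (?M t))"
    unfolding det_def vec_lambda_beta by (intro continuous_intros)
  with neg obtain t where t: "0 \<le> t" "t \<le> 1" "det (?M t) = 0"
    using IVT2'[of "\<lambda>t. det (?M t)" 1 0 0] by (auto simp: M1 M0)
  then have "\<not> invertible (?M t)"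
    by (simp only: invertible_det_nz not_not)
  then obtain w where w: "w \<noteq> 0" "?M t *v w = 0"
    unfolding invertible_left_inverse matrix_left_invertible_ker by blast
  have "?M t *v w = (1 - t) *\<^sub>R w + t *\<^sub>R (gram L *v w)"
  proof -
    have "?M t = (1 - t) *\<^sub>R mat 1 + t *\<^sub>R gram L" by (simp add: vec_eq_iff)
    then show ?thesis
      by (simp add: matrix_vector_mult_add_rdistrib scaleR_matrix_vector_assoc[symmetric])
  qed
  then have "(1 - t) *\<^sub>R w + t *\<^sub>R (gram L *v w) = 0"
    using w(2) by simp
  then have "w \<bullet> ((1 - t) *\<^sub>R w + t *\<^sub>R (gram L *v w)) = 0"
    by (simp only: inner_zero_right)
  then have "(1 - t) * (w \<bullet> w) + t * (L w \<bullet> L w) = 0"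
    by (simp add: inner_add_right inner_gram[OF assms(1)])
  moreover have "w \<bullet> w > 0" using w by simp
  moreover have "L w \<bullet> L w > 0"
    using w linear_injective_0[OF assms(1)] assms(2) by auto
  moreover have "0 < (1 - t) * (w \<bullet> w) + t * (L w \<bullet> L w)" 
  proof (cases "t = 1")
    case False
    then show ?thesis using t calculation(2,3) by (intro add_pos_nonneg mult_pos_pos mult_nonneg_nonneg) auto
  qed (use calculation in auto)
  ultimately show False by linarith
qed

lemma matrix_inv_gram:
  assumes "linear L" "inj L"
  shows "matrix_inv (gram L) ** gram L = mat 1" "gram L ** matrix_inv (gram L) = mat 1"
  using det_gram_pos[OF assms] matrix_inv_of_det_nonzero[of "gram L"] by auto

lemma matrix_inv_gram_commute:
  assumes "linear L" "inj L"
  shows "matrix_inv (gram L) $ i $ j = matrix_inv (gram L) $ j $ i"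
proof -
  let ?g = "gram L" and ?h = "matrix_inv (gram L)"
  have sym: "transpose ?g = ?g"
    by (simp add: vec_eq_iff transpose_def gram_commute)
  have "transpose ?h ** ?g = mat 1"
    using arg_cong[OF matrix_inv_gram(2)[OF assms], of transpose]
    by (simp add: matrix_transpose_mul sym transpose_mat)
  then have "transpose ?h = ?h"
    using matrix_inv_gram(2)[OF assms] by (metis matrix_mul_assoc matrix_mul_lid matrix_mul_rid)
  then have "transpose ?h $ j $ i = ?h $ j $ i" by simp
  then show ?thesis by (simp add: transpose_def)
qed

lemma gram_compose:
  assumes "linear L" "linear M"
  shows "gram (\<lambda>v. L (M v)) = transpose (matrix M) ** (gram L ** matrix M)"
proof -
  have "gram (\<lambda>v. L (M v)) $ i $ j = (transpose (matrix M) ** (gram L ** matrix M)) $ i $ j" for i j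
  proof -
    have "gram (\<lambda>v. L (M v)) $ i $ j = M (axis i 1) \<bullet> (gram L *v M (axis j 1))"
      by (subst inner_gram[OF assms(1)]) (simp add: gram_def)
    also have "\<dots> = (transpose (matrix M) ** (gram L ** matrix M)) $ i $ j"
      by (simp add: inner_vec_def matrix_vector_mult_def matrix_matrix_mult_def transpose_def matrix_def)
    finally show ?thesis .
  qed
  then show ?thesis by (simp add: vec_eq_iff)
qed

lemma orthogonal_comp_inner: "z \<in> T\<^sup>\<bottom> \<Longrightarrow> t \<in> T \<Longrightarrow> z \<bullet> t = 0"
  by (auto simp: orthogonal_comp_def orthogonal_def inner_commute)

lemma normal_part_unique:
  assumes "subspace T" "z \<in> T\<^sup>\<bottom>" "w - z \<in> T"
  shows "normal_part T w = z"
  unfolding normal_part_def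
proof (rule the_equality)
  show "z \<in> T\<^sup>\<bottom> \<and> w - z \<in> T" using assms by simp
  fix y assume y: "y \<in> T\<^sup>\<bottom> \<and> w - y \<in> T"
  have "z - y \<in> T\<^sup>\<bottom>"
    using subspace_diff[OF subspace_orthogonal_comp] assms(2) y by blast
  moreover have "z - y \<in> T"
    using subspace_diff[OF assms(1), of "w - y" "w - z"] assms(3) y by simp
  ultimately show "y = z"
    using orthogonal_comp_inner[of "z - y" T "z - y"] by simp
qed

lemma normal_part:
  assumes "subspace T"
  shows "normal_part T w \<in> T\<^sup>\<bottom>" "w - normal_part T w \<in> T"
proof -
  have "w \<in> T + T\<^sup>\<bottom>" using subspace_sum_orthogonal_comp[OF assms] by simp
  then obtain t z where "t \<in> T" "z \<in> T\<^sup>\<bottom>" "w = t + z" by (auto elim: set_plus_elim)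
  moreover from this have "normal_part T w = z"
    by (intro normal_part_unique[OF assms]) auto
  ultimately show "normal_part T w \<in> T\<^sup>\<bottom>" "w - normal_part T w \<in> T" by auto
qed

lemma linear_normal_part:
  assumes "subspace T"
  shows "linear (normal_part T)"
proof (rule linearI)
  note np = normal_part[OF assms]
  fix v w and c :: real
  show "normal_part T (v + w) = normal_part T v + normal_part T w"
    by (rule normal_part_unique[OF assms])
      (use subspace_add[OF subspace_orthogonal_comp np(1) np(1), of v w] subspace_add[OF assms np(2) np(2), of v w]
        in \<open>simp_all add: algebra_simps\<close>)
  show "normal_part T (c *\<^sub>R v) = c *\<^sub>R normal_part T v"
    by (rule normal_part_unique[OF assms])
      (use subspace_scale[OF subspace_orthogonal_comp np(1), of c v] subspace_scale[OF assms np(2), of c v]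
        in \<open>simp_all add: algebra_simps\<close>)
qed

lemma normal_part_tangent:
  assumes "subspace T" "w \<in> T"
  shows "normal_part T w = 0"
  by (rule normal_part_unique[OF assms(1)]) (use assms in \<open>auto simp: subspace_orthogonal_comp subspace_0\<close>)


section \<open>The divergence of the tangential position field in a chart\<close>

definition vol_density :: "(real^'n \<Rightarrow> real^'m::finite) \<Rightarrow> real^'n::finite \<Rightarrow> real"
  where "vol_density X x = sqrt (det (induced_metric X x))"

text \<open>The coordinate vector of the tangential part of the position vector.\<close>

definition tangent_coords :: "(real^'n \<Rightarrow> real^'m::finite) \<Rightarrow> real^'n::finite \<Rightarrow> real^'n"
  where "tangent_coords X x =
    matrix_inv (induced_metric X x) *v (\<chi> l. frechet_derivative X (at x) (axis l 1) \<bullet> X x)"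

locale local_immersion =
  fixes X :: "real^'n::finite \<Rightarrow> real^'m::finite" and S :: "(real^'n) set"
  assumes open_domain: "open S"
    and C2: "Ck_on (Suc (Suc 0)) S X"
    and inj_derivative: "\<And>x. x \<in> S \<Longrightarrow> inj (frechet_derivative X (at x))"
begin

abbreviation pd :: "'n \<Rightarrow> real^'n \<Rightarrow> real^'m"
  where "pd i x \<equiv> frechet_derivative X (at x) (axis i 1)"

abbreviation pd2 :: "'n \<Rightarrow> 'n \<Rightarrow> real^'n \<Rightarrow> real^'m"
  where "pd2 i j x \<equiv> frechet_derivative (\<lambda>y. frechet_derivative X (at y) (axis j 1)) (at x) (axis i 1)"

lemma C1: "Ck_on 1 S X"
  by (rule Ck_on_Suc_Suc_0_imp_C1[OF C2])

lemma C1_pd: "Ck_on 1 S (pd i)"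
  using C2 by (simp add: One_nat_def)

lemma linear_derivative: "x \<in> S \<Longrightarrow> linear (frechet_derivative X (at x))"
  using C2 by (simp add: linear_frechet_derivative)

lemma pd2_commute: "x \<in> S \<Longrightarrow> pd2 i j x = pd2 j i x"
  by (rule second_derivative_symmetric[OF C2 open_domain])

lemma metric_entry: "induced_metric X x $ i $ j = pd i x \<bullet> pd j x"
  by (simp add: induced_metric_def)

lemma det_metric_pos: "x \<in> S \<Longrightarrow> 0 < det (induced_metric X x)"
  unfolding induced_metric_eq_gram by (intro det_gram_pos linear_derivative inj_derivative)

lemma vol_density_pos: "x \<in> S \<Longrightarrow> 0 < vol_density X x"
  by (simp add: vol_density_def det_metric_pos)

lemma C1_metric_entry: "Ck_on 1 S (\<lambda>x. induced_metric X x $ i $ j)"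
  unfolding metric_entry by (intro C1_on_inner C1_pd)

lemma C1_det_metric: "Ck_on 1 S (\<lambda>x. det (induced_metric X x))"
  by (intro C1_on_det C1_metric_entry)

lemma C1_vol_density: "Ck_on 1 S (vol_density X)"
  unfolding vol_density_def[abs_def] by (intro C1_on_sqrt C1_det_metric det_metric_pos)

lemma metric_tangent_coords:
  assumes "x \<in> S"
  shows "induced_metric X x *v tangent_coords X x = (\<chi> l. pd l x \<bullet> X x)"
  unfolding tangent_coords_def induced_metric_eq_gram
  by (simp add: matrix_vector_mul_assoc matrix_inv_gram(2)[OF linear_derivative[OF assms] inj_derivative[OF assms]])

text \<open>Cramer's rule shows that the coordinates inherit the regularity of the metric.\<close>

lemma C1_tangent_coords: "Ck_on 1 S (\<lambda>x. tangent_coords X x $ k)"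
proof (rule C1_on_cong[OF open_domain])
  let ?A = "\<lambda>x. \<chi> i j. if j = k then pd i x \<bullet> X x else induced_metric X x $ i $ j"
  show "Ck_on 1 S (\<lambda>x. det (?A x) * inverse (det (induced_metric X x)))"
  proof (intro C1_on_mult C1_on_det C1_on_inverse C1_metric_entry)
    show "Ck_on 1 S (\<lambda>x. ?A x $ i $ j)" for i j
      using C1_on_inner[OF C1_pd[of i] C1] C1_metric_entry[of i j]
      by (cases "j = k") (simp_all only: vec_lambda_beta if_True if_False simp_thms)
  qed (use det_metric_pos in fastforce)
  show "det (?A x) * inverse (det (induced_metric X x)) = tangent_coords X x $ k" if "x \<in> S" for x
    using metric_tangent_coords[OF that] det_metric_pos[OF that]
    by (subst (asm) cramer) (auto simp: divide_inverse cong: if_cong)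
qed

lemma inner_residual:
  assumes "x \<in> S"
  shows "(X x - frechet_derivative X (at x) (tangent_coords X x)) \<bullet> frechet_derivative X (at x) w = 0"
proof -
  have "w \<bullet> (induced_metric X x *v tangent_coords X x)
      = frechet_derivative X (at x) w \<bullet> frechet_derivative X (at x) (tangent_coords X x)"
    unfolding induced_metric_eq_gram by (rule inner_gram[OF linear_derivative[OF assms]])
  moreover have "w \<bullet> (induced_metric X x *v tangent_coords X x) = frechet_derivative X (at x) w \<bullet> X x"
    unfolding metric_tangent_coords[OF assms]
    by (subst linear_axis_expansion[OF linear_derivative[OF assms]])
      (simp add: inner_vec_def[of w] inner_sum_left)
  ultimately show ?thesis
    by (simp add: inner_diff_right inner_commute[of _ "frechet_derivative X (at x) w"])
qed

lemma subspace_tangent: "x \<in> S \<Longrightarrow> subspace (param_tangent X x)"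
  unfolding param_tangent_def using linear_subspace_image[OF linear_derivative subspace_UNIV] by blast

lemma normal_part_position:
  assumes "x \<in> S"
  shows "normal_part (param_tangent X x) (X x) = X x - frechet_derivative X (at x) (tangent_coords X x)"
proof (rule normal_part_unique[OF subspace_tangent[OF assms]])
  show "X x - frechet_derivative X (at x) (tangent_coords X x) \<in> (param_tangent X x)\<^sup>\<bottom>"
    using inner_residual[OF assms]
    by (auto simp: orthogonal_comp_def orthogonal_def param_tangent_def inner_commute)
qed (simp add: param_tangent_def)

lemma mean_curvature_normal:
  assumes "x \<in> S"
  shows "param_mean_curvature X x \<in> (param_tangent X x)\<^sup>\<bottom>"
  unfolding param_mean_curvature_def second_fundamental_form_def
  by (intro subspace_sum subspace_scale subspace_orthogonal_comp normal_part(1) subspace_tangent assms)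

text \<open>Both the mean curvature vector and \<open>N\<close> are normal, so in their inner product the normal projections of
  the second derivatives may be dropped.\<close>

lemma mean_curvature_inner_position:
  assumes "x \<in> S"
  defines "N \<equiv> X x - frechet_derivative X (at x) (tangent_coords X x)"
  shows "param_mean_curvature X x \<bullet> X x =
    (\<Sum>i\<in>UNIV. \<Sum>j\<in>UNIV. matrix_inv (induced_metric X x) $ i $ j * (N \<bullet> pd2 i j x))"
proof -
  let ?T = "param_tangent X x"
  have N: "N \<in> ?T\<^sup>\<bottom>"
    using normal_part(1)[OF subspace_tangent[OF assms(1)], of "X x"] normal_part_position[OF assms(1)]
    by (simp add: N_def)
  have np: "N \<bullet> normal_part ?T w = N \<bullet> w" for w
    using orthogonal_comp_inner[OF N normal_part(2)[OF subspace_tangent[OF assms(1)], of w]]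
    by (simp add: inner_diff_right)
  have "param_mean_curvature X x \<bullet> (X x - N) = 0"
    by (rule orthogonal_comp_inner[OF mean_curvature_normal[OF assms(1)]]) (simp add: N_def param_tangent_def)
  then have "param_mean_curvature X x \<bullet> X x = N \<bullet> param_mean_curvature X x"
    by (simp add: inner_diff_right inner_commute)
  also have "\<dots> = (\<Sum>i\<in>UNIV. \<Sum>j\<in>UNIV. matrix_inv (induced_metric X x) $ i $ j * (N \<bullet> pd2 i j x))"
    unfolding param_mean_curvature_def second_fundamental_form_def
    by (simp add: inner_sum_right np)
  finally show ?thesis .
qed

text \<open>Differentiate the orthogonality of the normal part of \<open>X\<close> to the \<open>j\<close>-th partial derivative in
  direction \<open>i\<close> and take the trace with the inverse metric. The second sum on the left is what
  differentiating the volume density contributes to the divergence.\<close>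

lemma trace_derivative_tangent_coords:
  assumes x: "x \<in> S"
  shows "(\<Sum>k\<in>UNIV. frechet_derivative (\<lambda>y. tangent_coords X y $ k) (at x) (axis k 1)) +
      (\<Sum>k\<in>UNIV. tangent_coords X x $ k *
        (\<Sum>i\<in>UNIV. \<Sum>j\<in>UNIV. matrix_inv (induced_metric X x) $ i $ j * (pd2 k i x \<bullet> pd j x)))
    = real CARD('n) + param_mean_curvature X x \<bullet> X x"
proof -
  let ?v = "\<lambda>k y. tangent_coords X y $ k"
  let ?Dv = "\<lambda>k. frechet_derivative (?v k) (at x)"
  let ?h = "matrix_inv (induced_metric X x)"
  let ?N = "\<lambda>y. X y - frechet_derivative X (at y) (tangent_coords X y)"
  let ?N' = "\<lambda>y. X y - (\<Sum>k\<in>UNIV. ?v k y *\<^sub>R pd k y)"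
  have NN': "?N y = ?N' y" if "y \<in> S" for y
    using linear_axis_expansion[OF linear_derivative[OF that], of "tangent_coords X y"] by simp
  have inv: "?h ** induced_metric X x = mat 1"
    unfolding induced_metric_eq_gram by (rule matrix_inv_gram[OF linear_derivative[OF x] inj_derivative[OF x]])
  have key: "pd i x \<bullet> pd j x - (\<Sum>k\<in>UNIV. ?v k x * (pd2 k i x \<bullet> pd j x)) - (\<Sum>k\<in>UNIV. ?Dv k (axis i 1) * (pd k x \<bullet> pd j x))
      + ?N x \<bullet> pd2 i j x = 0" for i j
  proof -
    note D = C1_on_has_derivative[OF C1 x] C1_on_has_derivative[OF C1_pd x] C1_on_has_derivative[OF C1_tangent_coords x]
    have "((\<lambda>y. ?N' y \<bullet> pd j y) has_derivative (\<lambda>w. ?N' x \<bullet> frechet_derivative (pd j) (at x) w +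
        (frechet_derivative X (at x) w - (\<Sum>k\<in>UNIV. ?v k x *\<^sub>R frechet_derivative (pd k) (at x) w + ?Dv k w *\<^sub>R pd k x)) \<bullet> pd j x)) (at x)"
      by (intro has_derivative_inner has_derivative_diff has_derivative_sum has_derivative_scaleR D)
    moreover have zero: "?N' y \<bullet> pd j y = 0" if "y \<in> S" for y
      using inner_residual[OF that, of "axis j 1"] unfolding NN'[OF that] .
    have "((\<lambda>y. ?N' y \<bullet> pd j y) has_derivative (\<lambda>_. 0)) (at x)"
      by (rule has_derivative_transform_within_open[OF has_derivative_const[of 0] open_domain x])
        (simp only: zero)
    ultimately have "(\<lambda>w. ?N' x \<bullet> frechet_derivative (pd j) (at x) w +
        (frechet_derivative X (at x) w - (\<Sum>k\<in>UNIV. ?v k x *\<^sub>R frechet_derivative (pd k) (at x) w + ?Dv k w *\<^sub>R pd k x)) \<bullet> pd j x) = (\<lambda>_. 0)"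
      by (rule has_derivative_unique)
    from fun_cong[OF this, of "axis i 1"] show ?thesis
      by (simp add: NN'[OF x] inner_diff_left inner_sum_left inner_add_left sum.distrib pd2_commute[OF x, of i] algebra_simps)
  qed
  have tr: "(\<Sum>i\<in>UNIV. \<Sum>j\<in>UNIV. ?h $ i $ j * (pd i x \<bullet> pd j x)) = real CARD('n)"
  proof -
    have "(\<Sum>j\<in>UNIV. ?h $ i $ j * (pd i x \<bullet> pd j x)) = (?h ** induced_metric X x) $ i $ i" for i
      by (simp add: matrix_matrix_mult_def metric_entry inner_commute)
    then show ?thesis by (simp add: inv mat_def)
  qed
  have tr2: "(\<Sum>i\<in>UNIV. \<Sum>j\<in>UNIV. ?h $ i $ j * (\<Sum>k\<in>UNIV. ?Dv k (axis i 1) * (pd k x \<bullet> pd j x)))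
      = (\<Sum>k\<in>UNIV. ?Dv k (axis k 1))"
  proof -
    have "(\<Sum>j\<in>UNIV. ?h $ i $ j * (\<Sum>k\<in>UNIV. ?Dv k (axis i 1) * (pd k x \<bullet> pd j x))) = ?Dv i (axis i 1)" for i
    proof -
      have "(\<Sum>j\<in>UNIV. ?h $ i $ j * (\<Sum>k\<in>UNIV. ?Dv k (axis i 1) * (pd k x \<bullet> pd j x)))
          = (\<Sum>k\<in>UNIV. ?Dv k (axis i 1) * (?h ** induced_metric X x) $ i $ k)"
        unfolding sum_distrib_left
        by (subst sum.swap) (simp add: matrix_matrix_mult_def metric_entry sum_distrib_left inner_commute mult_ac)
      also have "\<dots> = ?Dv i (axis i 1)"
        by (simp add: inv mat_def if_distrib cong: if_cong)
      finally show ?thesis .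
    qed
    then show ?thesis by simp
  qed
  have tr3: "(\<Sum>i\<in>UNIV. \<Sum>j\<in>UNIV. ?h $ i $ j * (\<Sum>k\<in>UNIV. ?v k x * (pd2 k i x \<bullet> pd j x)))
      = (\<Sum>k\<in>UNIV. ?v k x * (\<Sum>i\<in>UNIV. \<Sum>j\<in>UNIV. ?h $ i $ j * (pd2 k i x \<bullet> pd j x)))"
  proof -
    have "(\<Sum>i\<in>UNIV. \<Sum>j\<in>UNIV. ?h $ i $ j * (\<Sum>k\<in>UNIV. ?v k x * (pd2 k i x \<bullet> pd j x)))
        = (\<Sum>i\<in>UNIV. \<Sum>k\<in>UNIV. \<Sum>j\<in>UNIV. ?h $ i $ j * (?v k x * (pd2 k i x \<bullet> pd j x)))"
      unfolding sum_distrib_left by (subst sum.swap) (rule refl)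
    also have "\<dots> = (\<Sum>k\<in>UNIV. \<Sum>i\<in>UNIV. \<Sum>j\<in>UNIV. ?h $ i $ j * (?v k x * (pd2 k i x \<bullet> pd j x)))"
      by (rule sum.swap)
    finally show ?thesis by (simp add: sum_distrib_left mult_ac)
  qed
  have "(\<Sum>i\<in>UNIV. \<Sum>j\<in>UNIV. ?h $ i $ j * (pd i x \<bullet> pd j x - (\<Sum>k\<in>UNIV. ?v k x * (pd2 k i x \<bullet> pd j x))
      - (\<Sum>k\<in>UNIV. ?Dv k (axis i 1) * (pd k x \<bullet> pd j x)) + ?N x \<bullet> pd2 i j x)) = 0"
    by (simp only: key mult_zero_right sum.neutral_const)
  then show ?thesis
    by (simp only: distrib_left right_diff_distrib sum.distrib sum_subtractf tr tr2 tr3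
        mean_curvature_inner_position[OF x])
qed

text \<open>Jacobi's formula; the two halves of the derivative of the metric have the same trace.\<close>

lemma derivative_vol_density:
  assumes x: "x \<in> S"
  shows "frechet_derivative (vol_density X) (at x) (axis k 1) = vol_density X x *
    (\<Sum>i\<in>UNIV. \<Sum>j\<in>UNIV. matrix_inv (induced_metric X x) $ i $ j * (pd2 k i x \<bullet> pd j x))"
proof -
  let ?g = "\<lambda>y. induced_metric X y" and ?h = "matrix_inv (induced_metric X x)"
  let ?\<Gamma> = "\<lambda>w. \<Sum>i\<in>UNIV. \<Sum>j\<in>UNIV. (pd i x \<bullet> frechet_derivative (pd j) (at x) w +
      frechet_derivative (pd i) (at x) w \<bullet> pd j x) * ?h $ j $ i"
  have sym: "?h $ j $ i = ?h $ i $ j" for i j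
    unfolding induced_metric_eq_gram by (rule matrix_inv_gram_commute[OF linear_derivative[OF x] inj_derivative[OF x]])
  have tm: "(pd i x \<bullet> pd2 k j x + pd2 k i x \<bullet> pd j x) * ?h $ j $ i =
      ?h $ i $ j * (pd2 k j x \<bullet> pd i x) + ?h $ i $ j * (pd2 k i x \<bullet> pd j x)" for i j
    by (simp only: sym[of i j]) (simp add: inner_commute algebra_simps)
  have "((\<lambda>y. ?g y $ i $ j) has_derivative
      (\<lambda>w. pd i x \<bullet> frechet_derivative (pd j) (at x) w + frechet_derivative (pd i) (at x) w \<bullet> pd j x)) (at x)" for i j
    unfolding metric_entry by (intro has_derivative_inner C1_on_has_derivative[OF C1_pd x])
  from has_derivative_det[OF this]
  have "((\<lambda>y. det (?g y)) has_derivative (\<lambda>w. det (?g x) * ?\<Gamma> w)) (at x)"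
    using det_metric_pos[OF x] by auto
  from has_derivative_real_sqrt[OF det_metric_pos[OF x] this]
  have "((\<lambda>y. sqrt (det (?g y))) has_derivative (\<lambda>w. det (?g x) * ?\<Gamma> w * (inverse (sqrt (det (?g x))) / 2))) (at x)"
    by (simp add: mult_ac)
  then have "frechet_derivative (vol_density X) (at x) (axis k 1)
      = det (?g x) * ?\<Gamma> (axis k 1) * (inverse (sqrt (det (?g x))) / 2)"
    unfolding vol_density_def[abs_def] by (simp add: frechet_derivative_at[symmetric])
  also have "\<dots> = sqrt (det (?g x)) * (?\<Gamma> (axis k 1) / 2)"
    using det_metric_pos[OF x] by (simp add: field_simps)
  also have "?\<Gamma> (axis k 1) = (\<Sum>i\<in>UNIV. \<Sum>j\<in>UNIV. ?h $ i $ j * (pd2 k j x \<bullet> pd i x)) +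
      (\<Sum>i\<in>UNIV. \<Sum>j\<in>UNIV. ?h $ i $ j * (pd2 k i x \<bullet> pd j x))"
    by (simp only: tm sum.distrib)
  also have "(\<Sum>i\<in>UNIV. \<Sum>j\<in>UNIV. ?h $ i $ j * (pd2 k j x \<bullet> pd i x)) =
      (\<Sum>i\<in>UNIV. \<Sum>j\<in>UNIV. ?h $ i $ j * (pd2 k i x \<bullet> pd j x))"
    by (subst sum.swap) (simp add: sym)
  finally show ?thesis by (simp add: vol_density_def[abs_def])
qed

text \<open>The left-hand side is the coordinate expression of the Riemannian divergence, multiplied by the volume
  density. The ambient position field has derivative the identity, whose trace over the tangent space is
  \<open>n\<close>, and its normal part contributes \<open>\<langle>H, x\<rangle>\<close>.\<close>

lemma divergence_tangential_position:
  assumes x: "x \<in> S" and \<eta>: "Ck_on 1 S \<eta>"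
  shows "(\<Sum>k\<in>UNIV. frechet_derivative (\<lambda>y. vol_density X y * (\<eta> y * tangent_coords X y $ k)) (at x) (axis k 1)) =
    vol_density X x * (\<eta> x * (real CARD('n) + param_mean_curvature X x \<bullet> X x) +
      frechet_derivative \<eta> (at x) (tangent_coords X x))"
proof -
  let ?v = "\<lambda>k y. tangent_coords X y $ k" and ?w = "vol_density X"
  let ?\<Gamma> = "\<lambda>k. \<Sum>i\<in>UNIV. \<Sum>j\<in>UNIV. matrix_inv (induced_metric X x) $ i $ j * (pd2 k i x \<bullet> pd j x)"
  have D: "((\<lambda>y. ?w y * (\<eta> y * ?v k y)) has_derivative (\<lambda>u. ?w x * (\<eta> x * frechet_derivative (?v k) (at x) u +
      frechet_derivative \<eta> (at x) u * ?v k x) + frechet_derivative ?w (at x) u * (\<eta> x * ?v k x))) (at x)" for k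
    by (intro has_derivative_mult C1_on_has_derivative[OF _ x] C1_vol_density \<eta> C1_tangent_coords)
  have "frechet_derivative (\<lambda>y. ?w y * (\<eta> y * ?v k y)) (at x) (axis k 1) =
      ?w x * (\<eta> x * (frechet_derivative (?v k) (at x) (axis k 1) + ?v k x * ?\<Gamma> k) +
        ?v k x * frechet_derivative \<eta> (at x) (axis k 1))" for k
    unfolding frechet_derivative_at[OF D, symmetric] derivative_vol_density[OF x]
    by (simp add: algebra_simps)
  then have "(\<Sum>k\<in>UNIV. frechet_derivative (\<lambda>y. ?w y * (\<eta> y * ?v k y)) (at x) (axis k 1)) =
      ?w x * (\<eta> x * ((\<Sum>k\<in>UNIV. frechet_derivative (?v k) (at x) (axis k 1)) + (\<Sum>k\<in>UNIV. ?v k x * ?\<Gamma> k)) +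
        (\<Sum>k\<in>UNIV. ?v k x * frechet_derivative \<eta> (at x) (axis k 1)))"
    by (simp only: sum.distrib sum_distrib_left[symmetric])
  also have "(\<Sum>k\<in>UNIV. ?v k x * frechet_derivative \<eta> (at x) (axis k 1)) = frechet_derivative \<eta> (at x) (tangent_coords X x)"
    using linear_axis_expansion[OF has_derivative_linear[OF C1_on_has_derivative[OF \<eta> x]], of "tangent_coords X x"]
    by simp
  finally show ?thesis
    by (simp only: trace_derivative_tangent_coords[OF x])
qed

end


section \<open>Change of variables for an arbitrary finite index type\<close>

text \<open>An enumeration orders a copy of the index type. Relabelling coordinates preserves Lebesgue measure and
  determinants, so the change of variables theorem for well-ordered index types carries over to all
  finite ones.\<close>

typedef 'n ordered = "UNIV :: 'n set" ..

instance ordered :: (finite) finite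
proof
  have "finite (Rep_ordered -` (UNIV :: 'a set))"
    by (intro finite_vimageI) (auto simp: inj_def Rep_ordered_inject)
  then show "finite (UNIV :: 'a ordered set)" by simp
qed

definition index_code :: "'n::finite ordered \<Rightarrow> nat"
  where "index_code i = (SOME f::'n \<Rightarrow> nat. inj f) (Rep_ordered i)"

lemma index_code_eq_iff:
  fixes i j :: "'n::finite ordered"
  shows "index_code i = index_code j \<longleftrightarrow> i = j"
proof -
  have "\<exists>f::'n \<Rightarrow> nat. inj f"
    using finite_imp_inj_to_nat_seg[OF finite, of "UNIV :: 'n set"] by blast
  then have "inj (SOME f::'n \<Rightarrow> nat. inj f)" by (rule someI_ex)
  then show ?thesis by (simp add: index_code_def inj_eq Rep_ordered_inject)
qed

instantiation ordered :: (finite) wellorder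
begin

definition less_eq_ordered :: "'a ordered \<Rightarrow> 'a ordered \<Rightarrow> bool"
  where "i \<le> j \<longleftrightarrow> index_code i \<le> index_code j"

definition less_ordered :: "'a ordered \<Rightarrow> 'a ordered \<Rightarrow> bool"
  where "i < j \<longleftrightarrow> index_code i < index_code j"

instance
proof
  fix P :: "'a ordered \<Rightarrow> bool" and i
  assume step: "\<And>i. (\<And>j. j < i \<Longrightarrow> P j) \<Longrightarrow> P i"
  show "P i"
    by (induction i rule: measure_induct_rule[where f = index_code]) (rule step, simp add: less_ordered_def)
qed (auto simp: less_eq_ordered_def less_ordered_def index_code_eq_iff)

end

lemma nonneg_absolutely_integrable_iff:
  fixes h :: "'a::euclidean_space \<Rightarrow> real"
  assumes m: "(\<lambda>x. indicator S x * h x) \<in> borel_measurable borel" and pos: "\<And>x. x \<in> S \<Longrightarrow> 0 \<le> h x"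
  shows "h absolutely_integrable_on S \<longleftrightarrow> (\<integral>\<^sup>+x. ennreal (indicator S x * h x) \<partial>lborel) < \<infinity>"
    and "h absolutely_integrable_on S \<Longrightarrow> (\<integral>\<^sup>+x. ennreal (indicator S x * h x) \<partial>lborel) = ennreal (integral S h)"
proof -
  let ?H = "\<lambda>x. indicator S x * h x"
  have H0: "0 \<le> ?H x" for x using pos by (auto simp: indicator_def)
  have eq: "h absolutely_integrable_on S \<longleftrightarrow> integrable lborel ?H"
    using integrable_completion[of ?H lborel] m by (simp add: set_integrable_def)
  show "h absolutely_integrable_on S \<longleftrightarrow> (\<integral>\<^sup>+x. ennreal (?H x) \<partial>lborel) < \<infinity>"
    unfolding eq integrable_iff_bounded using m H0 by simp
  assume a: "h absolutely_integrable_on S"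
  have "integral S h = (\<integral>x. ?H x \<partial>lebesgue)"
    using set_lebesgue_integral_eq_integral(2)[OF a] by (simp add: set_lebesgue_integral_def)
  also have "\<dots> = (\<integral>x. ?H x \<partial>lborel)"
    using m by (simp add: integral_completion)
  finally show "(\<integral>\<^sup>+x. ennreal (?H x) \<partial>lborel) = ennreal (integral S h)"
    using nn_integral_eq_integral[of lborel ?H] a eq H0 by simp
qed

text \<open>For nonnegative functions absolute integrability is finiteness of the integral. As it is equivalent for
  the two integrands, the integrals agree also when they are infinite.\<close>

lemma nn_integral_change_of_variables_wellorder:
  fixes g :: "real^'n::{finite,wellorder} \<Rightarrow> real^'n::_" and f :: "real^'n::{finite,wellorder} \<Rightarrow> real"
  assumes S: "S \<in> sets borel" and der: "\<And>x. x \<in> S \<Longrightarrow> (g has_derivative g' x) (at x)"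
    and inj: "inj_on g S" and pos: "\<And>y. y \<in> g ` S \<Longrightarrow> 0 \<le> f y"
    and m1: "(\<lambda>y. indicator (g ` S) y * f y) \<in> borel_measurable borel"
    and m2: "(\<lambda>x. indicator S x * (\<bar>det (matrix (g' x))\<bar> * f (g x))) \<in> borel_measurable borel"
  shows "(\<integral>\<^sup>+y. ennreal (indicator (g ` S) y * f y) \<partial>lborel) =
    (\<integral>\<^sup>+x. ennreal (indicator S x * (\<bar>det (matrix (g' x))\<bar> * f (g x))) \<partial>lborel)"
proof -
  let ?h = "\<lambda>x. \<bar>det (matrix (g' x))\<bar> * f (g x)"
  have cv: "?h absolutely_integrable_on S \<and> integral S ?h = b \<longleftrightarrow> f absolutely_integrable_on (g ` S) \<and> integral (g ` S) f = b" for b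
  proof -
    have "(\<lambda>x. \<bar>det (matrix (g' x))\<bar> *\<^sub>R (vec (f (g x)) :: real^1)) absolutely_integrable_on S \<and>
        integral S (\<lambda>x. \<bar>det (matrix (g' x))\<bar> *\<^sub>R (vec (f (g x)) :: real^1)) = vec b \<longleftrightarrow>
        (\<lambda>y. vec (f y) :: real^1) absolutely_integrable_on (g ` S) \<and> integral (g ` S) (\<lambda>y. vec (f y) :: real^1) = vec b"
      by (rule has_absolute_integral_change_of_variables)
        (use S der inj in \<open>auto intro: has_derivative_at_withinI\<close>)
    then show ?thesis
      by (simp add: absolutely_integrable_on_1_iff integral_on_1_eq vec_eq_iff)
  qed
  have posh: "0 \<le> ?h x" if "x \<in> S" for x using pos that by simp
  note I1 = nonneg_absolutely_integrable_iff[OF m1 pos] and I2 = nonneg_absolutely_integrable_iff[OF m2 posh]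
  show ?thesis
  proof (cases "f absolutely_integrable_on (g ` S)")
    case True
    then have "?h absolutely_integrable_on S \<and> integral S ?h = integral (g ` S) f"
      using cv[of "integral (g ` S) f"] by simp
    then show ?thesis using I1(2)[OF _ True] I2(2) by simp
  next
    case False
    then have "\<not> ?h absolutely_integrable_on S" using cv by blast
    then show ?thesis using False I1(1) I2(1) by (simp add: less_top[symmetric])
  qed
qed

lemma det_reindex:
  fixes A :: "real^'b^'b" and e :: "'a::finite \<Rightarrow> 'b::finite"
  assumes "bij e"
  shows "det (\<chi> i j. A $ e i $ e j) = det A"
proof -
  let ?E = "\<lambda>p y. if y \<in> UNIV then e (p (inv e y)) else y"
  have bij: "bij_betw ?E {p. p permutes (UNIV::'a set)} {q. q permutes (UNIV::'b set)}"
    using bij_betw_permutations[of e UNIV UNIV] assms by simp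
  have "det A = (\<Sum>p | p permutes UNIV. of_int (sign (?E p)) * (\<Prod>i\<in>UNIV. A $ i $ ?E p i))"
    unfolding det_def by (rule sum.reindex_bij_betw[OF bij, symmetric])
  also have "\<dots> = (\<Sum>p | p permutes (UNIV :: 'a set). of_int (sign p) * (\<Prod>i\<in>UNIV. A $ e i $ e (p i)))"
  proof (rule sum.cong[OF refl])
    fix p assume "p \<in> {p. p permutes (UNIV :: 'a set)}"
    then have p: "p permutes (UNIV :: 'a set)" by simp
    have "?E p = map_permutation UNIV e p"
      using assms by (auto simp: map_permutation_def restrict_id_def fun_eq_iff bij_is_surj)
    then have "sign (?E p) = sign p"
      using sign_map_permutation[of e UNIV p] p assms by (simp add: bij_is_inj)
    moreover have "(\<Prod>i\<in>UNIV. A $ i $ ?E p i) = (\<Prod>i\<in>UNIV. A $ e i $ ?E p (e i))"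
      by (rule prod.reindex_bij_betw[symmetric]) (use assms in simp)
    ultimately show "of_int (sign (?E p)) * (\<Prod>i\<in>UNIV. A $ i $ ?E p i) =
        of_int (sign p) * (\<Prod>i\<in>UNIV. A $ e i $ e (p i))"
      using assms by (simp add: bij_is_inj)
  qed
  finally show ?thesis by (simp add: det_def)
qed

definition to_ordered :: "real^'n \<Rightarrow> real^'n::finite ordered"
  where "to_ordered x = (\<chi> i. x $ Rep_ordered i)"

definition from_ordered :: "real^'n::finite ordered \<Rightarrow> real^'n"
  where "from_ordered y = (\<chi> i. y $ Abs_ordered i)"

lemma from_to_ordered [simp]: "from_ordered (to_ordered x) = x"
  and to_from_ordered [simp]: "to_ordered (from_ordered y) = y"
  by (simp_all add: to_ordered_def from_ordered_def vec_eq_iff Abs_ordered_inverse Rep_ordered_inverse)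

lemma linear_to_ordered: "linear to_ordered" and linear_from_ordered: "linear from_ordered"
  by (auto intro!: linearI simp: to_ordered_def from_ordered_def vec_eq_iff)

lemma bij_Rep_ordered: "bij (Rep_ordered :: 'n ordered \<Rightarrow> 'n)"
  by (rule bij_betw_byWitness[where f' = Abs_ordered]) (auto simp: Abs_ordered_inverse Rep_ordered_inverse)

lemma borel_measurable_to_ordered: "to_ordered \<in> borel \<rightarrow>\<^sub>M borel"
  and borel_measurable_from_ordered: "from_ordered \<in> borel \<rightarrow>\<^sub>M borel"
  by (intro borel_measurable_continuous_onI linear_continuous_on linear_conv_bounded_linear[THEN iffD1]
      linear_to_ordered linear_from_ordered)+

lemma lborel_distr_to_ordered: "distr lborel borel (to_ordered :: real^'n::finite \<Rightarrow> _) = lborel"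
proof (rule lborel_eqI[symmetric])
  fix l u :: "real^'n ordered"
  assume le: "\<And>b. b \<in> Basis \<Longrightarrow> l \<bullet> b \<le> u \<bullet> b"
  have lei: "l $ i \<le> u $ i" for i
    using le[of "axis i 1"] by (simp add: inner_axis)
  have vim: "to_ordered -` box l u = box (from_ordered l) (from_ordered u)"
  proof (intro set_eqI)
    fix x :: "real^'n"
    have "(\<forall>i. l $ i < x $ Rep_ordered i \<and> x $ Rep_ordered i < u $ i) \<longleftrightarrow>
        (\<forall>i. l $ Abs_ordered i < x $ i \<and> x $ i < u $ Abs_ordered i)"
      by (metis Abs_ordered_inverse Rep_ordered_inverse UNIV_I)
    then show "x \<in> to_ordered -` box l u \<longleftrightarrow> x \<in> box (from_ordered l) (from_ordered u)"
      by (simp add: mem_box_cart to_ordered_def from_ordered_def)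
  qed
  have prod_cart: "(\<Prod>b\<in>Basis. w \<bullet> b) = (\<Prod>i\<in>UNIV. w $ i)" for w :: "real^'k::finite"
  proof -
    have B: "Basis = range (\<lambda>i. axis i (1::real) :: real^'k)"
      by (auto simp: Basis_vec_def)
    have "inj (\<lambda>i. axis i (1::real) :: real^'k)"
      by (auto simp: inj_def axis_eq_axis)
    then show ?thesis
      unfolding B by (subst prod.reindex) (simp_all add: inner_axis)
  qed
  have "emeasure (distr lborel borel to_ordered) (box l u) = emeasure lborel (box (from_ordered l) (from_ordered u))"
    using borel_measurable_to_ordered by (subst emeasure_distr) (simp_all add: vim)
  also have "\<dots> = (\<Prod>b\<in>Basis. (from_ordered u - from_ordered l) \<bullet> b)"
  proof (rule emeasure_lborel_box)
    fix b :: "real^'n" assume "b \<in> Basis"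
    then show "from_ordered l \<bullet> b \<le> from_ordered u \<bullet> b"
      using lei by (auto simp: Basis_vec_def inner_axis from_ordered_def)
  qed
  also have "(\<Prod>b\<in>Basis. (from_ordered u - from_ordered l) \<bullet> b) = (\<Prod>i\<in>UNIV. (from_ordered u - from_ordered l) $ i)"
    by (rule prod_cart)
  also have "\<dots> = (\<Prod>i\<in>UNIV. (from_ordered u - from_ordered l) $ Rep_ordered i)"
    by (rule prod.reindex_bij_betw[OF bij_Rep_ordered, symmetric])
  also have "\<dots> = (\<Prod>b\<in>Basis. (u - l) \<bullet> b)"
    by (simp add: prod_cart from_ordered_def Rep_ordered_inverse)
  finally show "emeasure (distr lborel borel to_ordered) (box l u) = (\<Prod>b\<in>Basis. (u - l) \<bullet> b)" .
qed simp

lemma nn_integral_to_ordered: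
  fixes h :: "real^'n::finite \<Rightarrow> ennreal"
  assumes "h \<in> borel_measurable borel"
  shows "(\<integral>\<^sup>+x. h x \<partial>lborel) = (\<integral>\<^sup>+y. h (from_ordered y) \<partial>lborel)"
proof -
  have "(\<integral>\<^sup>+y. h (from_ordered y) \<partial>lborel) = (\<integral>\<^sup>+y. h (from_ordered y) \<partial>distr lborel borel (to_ordered :: real^'n \<Rightarrow> _))"
    by (simp add: lborel_distr_to_ordered)
  also have "\<dots> = (\<integral>\<^sup>+x. h (from_ordered (to_ordered x)) \<partial>lborel)"
    using borel_measurable_to_ordered measurable_compose[OF borel_measurable_from_ordered assms]
    by (intro nn_integral_distr) simp_all
  finally show ?thesis by simp
qed

theorem nn_integral_change_of_variables:
  fixes g :: "real^'n::finite \<Rightarrow> real^'n" and f :: "real^'n \<Rightarrow> real"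
  assumes S: "S \<in> sets borel" and der: "\<And>x. x \<in> S \<Longrightarrow> (g has_derivative g' x) (at x)"
    and inj: "inj_on g S" and pos: "\<And>y. y \<in> g ` S \<Longrightarrow> 0 \<le> f y"
    and m1: "(\<lambda>y. indicator (g ` S) y * f y) \<in> borel_measurable borel"
    and m2: "(\<lambda>x. indicator S x * (\<bar>det (matrix (g' x))\<bar> * f (g x))) \<in> borel_measurable borel"
  shows "(\<integral>\<^sup>+y. ennreal (indicator (g ` S) y * f y) \<partial>lborel) =
    (\<integral>\<^sup>+x. ennreal (indicator S x * (\<bar>det (matrix (g' x))\<bar> * f (g x))) \<partial>lborel)"
proof -
  let ?S = "from_ordered -` S" and ?g = "\<lambda>y. to_ordered (g (from_ordered y))"
  let ?g' = "\<lambda>y v. to_ordered (g' (from_ordered y) (from_ordered v))" and ?f = "\<lambda>y. f (from_ordered y)"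
  have dto: "(to_ordered has_derivative to_ordered) F" and dfrom: "(from_ordered has_derivative from_ordered) F'"
    for F :: "(real^'n) filter" and F' :: "(real^'n ordered) filter"
    using linear_to_ordered linear_from_ordered
    by (auto intro!: bounded_linear_imp_has_derivative simp: linear_conv_bounded_linear)
  have img: "from_ordered y \<in> g ` S \<longleftrightarrow> y \<in> ?g ` ?S" for y
  proof
    assume "from_ordered y \<in> g ` S"
    then obtain x where x: "x \<in> S" "from_ordered y = g x" by blast
    then have "y = ?g (to_ordered x)" by (metis from_to_ordered to_from_ordered)
    with x(1) show "y \<in> ?g ` ?S" by (intro image_eqI[of _ _ "to_ordered x"]) auto
  qed auto
  have det: "det (matrix (?g' y)) = det (matrix (g' (from_ordered y)))" for y
  proof -
    have ax: "from_ordered (axis j 1) = axis (Rep_ordered j) 1" for j :: "'n ordered"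
      by (auto simp: from_ordered_def vec_eq_iff axis_def Rep_ordered_inverse Abs_ordered_inverse)
    have "matrix (?g' y) = (\<chi> i j. matrix (g' (from_ordered y)) $ Rep_ordered i $ Rep_ordered j)"
      by (simp add: matrix_def to_ordered_def ax)
    then show ?thesis by (simp only: det_reindex[OF bij_Rep_ordered])
  qed
  have "(\<integral>\<^sup>+y. ennreal (indicator (g ` S) y * f y) \<partial>lborel) =
      (\<integral>\<^sup>+y. ennreal (indicator (?g ` ?S) y * ?f y) \<partial>lborel)"
    by (subst nn_integral_to_ordered) (use m1 img in \<open>auto simp: indicator_def cong: if_cong\<close>)
  also have "\<dots> = (\<integral>\<^sup>+y. ennreal (indicator ?S y * (\<bar>det (matrix (?g' y))\<bar> * ?f (?g y))) \<partial>lborel)"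
  proof (rule nn_integral_change_of_variables_wellorder)
    show "?S \<in> sets borel"
      using measurable_sets[OF borel_measurable_from_ordered S] by simp
    show "(?g has_derivative ?g' y) (at y)" if "y \<in> ?S" for y
      using has_derivative_compose[OF has_derivative_compose[OF dfrom der] dto] that by simp
    show "inj_on ?g ?S"
      using inj by (auto simp: inj_on_def) (metis from_to_ordered to_from_ordered)
    show "0 \<le> ?f y" if "y \<in> ?g ` ?S" for y
      using pos that img by blast
    show "(\<lambda>y. indicator (?g ` ?S) y * ?f y) \<in> borel_measurable borel"
      using measurable_compose[OF borel_measurable_from_ordered m1] img by (simp add: indicator_def cong: if_cong)
    show "(\<lambda>y. indicator ?S y * (\<bar>det (matrix (?g' y))\<bar> * ?f (?g y))) \<in> borel_measurable borel"
      using measurable_compose[OF borel_measurable_from_ordered m2] by (simp add: indicator_def det cong: if_cong)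
  qed
  also have "\<dots> = (\<integral>\<^sup>+x. ennreal (indicator S x * (\<bar>det (matrix (g' x))\<bar> * f (g x))) \<partial>lborel)"
    by (subst (2) nn_integral_to_ordered) (use m2 in \<open>auto simp: indicator_def det cong: if_cong\<close>)
  finally show ?thesis .
qed


section \<open>Change of chart\<close>

locale chart_change = X: local_immersion X S + Y: local_immersion Y T
  for X :: "real^'n::finite \<Rightarrow> real^'m::finite" and S and Y :: "real^'n \<Rightarrow> real^'m" and T +
  fixes \<tau> :: "real^'n \<Rightarrow> real^'n"
  assumes C2_\<tau>: "Ck_on (Suc (Suc 0)) S \<tau>"
    and maps_to: "\<And>x. x \<in> S \<Longrightarrow> \<tau> x \<in> T"
    and X_eq: "\<And>x. x \<in> S \<Longrightarrow> X x = Y (\<tau> x)"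
begin

abbreviation D\<tau> :: "real^'n \<Rightarrow> real^'n \<Rightarrow> real^'n"
  where "D\<tau> x \<equiv> frechet_derivative \<tau> (at x)"

lemma D\<tau>: "x \<in> S \<Longrightarrow> (\<tau> has_derivative D\<tau> x) (at x)"
  using C2_\<tau> by (simp add: frechet_derivative_works)

lemma linear_D\<tau>: "x \<in> S \<Longrightarrow> linear (D\<tau> x)"
  using D\<tau> has_derivative_linear by blast

lemma derivative_eq:
  assumes "x \<in> S"
  shows "frechet_derivative X (at x) v = frechet_derivative Y (at (\<tau> x)) (D\<tau> x v)"
proof -
  have "((\<lambda>y. Y (\<tau> y)) has_derivative (\<lambda>v. frechet_derivative Y (at (\<tau> x)) (D\<tau> x v))) (at x)"
    by (rule has_derivative_compose[OF D\<tau>[OF assms] C1_on_has_derivative[OF Y.C1 maps_to[OF assms]]])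
  then have "(X has_derivative (\<lambda>v. frechet_derivative Y (at (\<tau> x)) (D\<tau> x v))) (at x)"
    by (rule has_derivative_transform_within_open[OF _ X.open_domain assms]) (simp add: X_eq)
  then show ?thesis by (simp add: frechet_derivative_at[symmetric])
qed

lemma inj_D\<tau>:
  assumes "x \<in> S"
  shows "inj (D\<tau> x)"
  using X.inj_derivative[OF assms] derivative_eq[OF assms] by (metis injI injD)

lemma surj_D\<tau>: "x \<in> S \<Longrightarrow> surj (D\<tau> x)"
  by (rule linear_inj_imp_surj[OF linear_D\<tau> inj_D\<tau>])

lemma metric_eq:
  assumes "x \<in> S"
  shows "induced_metric X x = transpose (matrix (D\<tau> x)) ** (induced_metric Y (\<tau> x) ** matrix (D\<tau> x))"
proof -
  have "frechet_derivative X (at x) = (\<lambda>v. frechet_derivative Y (at (\<tau> x)) (D\<tau> x v))"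
    using derivative_eq[OF assms] by auto
  then show ?thesis
    unfolding induced_metric_eq_gram
    by (simp add: gram_compose[OF Y.linear_derivative[OF maps_to[OF assms]] linear_D\<tau>[OF assms]])
qed

lemma vol_density_eq:
  assumes "x \<in> S"
  shows "vol_density X x = \<bar>det (matrix (D\<tau> x))\<bar> * vol_density Y (\<tau> x)"
proof -
  have "det (induced_metric X x) = (det (matrix (D\<tau> x)))\<^sup>2 * det (induced_metric Y (\<tau> x))"
    by (simp add: metric_eq[OF assms] det_mul det_transpose power2_eq_square)
  then show ?thesis by (simp add: vol_density_def real_sqrt_mult)
qed

lemma param_tangent_eq:
  assumes "x \<in> S"
  shows "param_tangent X x = param_tangent Y (\<tau> x)"
proof -
  have "param_tangent X x = frechet_derivative Y (at (\<tau> x)) ` range (D\<tau> x)"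
    by (auto simp: param_tangent_def derivative_eq[OF assms])
  then show ?thesis by (simp add: surj_D\<tau>[OF assms] param_tangent_def)
qed

text \<open>Both vectors represent the tangential part of the same position vector, and the derivative of \<open>Y\<close> is
  injective.\<close>

lemma tangent_coords_eq:
  assumes "x \<in> S"
  shows "D\<tau> x (tangent_coords X x) = tangent_coords Y (\<tau> x)"
proof -
  have "frechet_derivative Y (at (\<tau> x)) (D\<tau> x (tangent_coords X x)) = frechet_derivative Y (at (\<tau> x)) (tangent_coords Y (\<tau> x))"
    using X.normal_part_position[OF assms] Y.normal_part_position[OF maps_to[OF assms]]
    by (simp add: param_tangent_eq[OF assms] X_eq[OF assms] derivative_eq[OF assms])
  then show ?thesis
    using Y.inj_derivative[OF maps_to[OF assms]] by (simp add: inj_eq)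
qed

lemma derivative_along_tangent_coords:
  assumes "x \<in> S" "(\<eta> has_derivative \<eta>') (at (\<tau> x))"
  shows "frechet_derivative (\<lambda>y. \<eta> (\<tau> y)) (at x) (tangent_coords X x) =
    frechet_derivative \<eta> (at (\<tau> x)) (tangent_coords Y (\<tau> x))"
  using has_derivative_compose[OF D\<tau>[OF assms(1)] assms(2)] assms(2)
  by (simp add: frechet_derivative_at[symmetric] tangent_coords_eq[OF assms(1)])

text \<open>The second derivatives of \<open>X\<close> and \<open>Y\<close> differ by a tangential term, which the normal projection
  removes.\<close>

lemma normal_second_derivative:
  assumes x: "x \<in> S"
  defines "P \<equiv> normal_part (param_tangent Y (\<tau> x))"
  shows "P (X.pd2 i j x) = (\<Sum>k\<in>UNIV. \<Sum>l\<in>UNIV.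
    (matrix (D\<tau> x) $ k $ i * matrix (D\<tau> x) $ l $ j) *\<^sub>R P (Y.pd2 k l (\<tau> x)))"
proof -
  have Tx: "\<tau> x \<in> T" by (rule maps_to[OF x])
  have sub: "subspace (param_tangent Y (\<tau> x))" by (rule Y.subspace_tangent[OF Tx])
  have lP: "linear P" unfolding P_def by (rule linear_normal_part[OF sub])
  let ?t = "\<lambda>l y. D\<tau> y (axis j 1) $ l"
  have Dt: "((\<lambda>y. D\<tau> y (axis j 1)) has_derivative frechet_derivative (\<lambda>y. D\<tau> y (axis j 1)) (at x)) (at x)"
    using C2_\<tau> x by (simp add: frechet_derivative_works)
  let ?Dt = "\<lambda>l w. frechet_derivative (\<lambda>y. D\<tau> y (axis j 1)) (at x) w $ l"
  have Dt: "(?t l has_derivative ?Dt l) (at x)" for l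
    by (rule bounded_linear.has_derivative[OF bounded_linear_vec_nth Dt])
  have DY: "((\<lambda>y. Y.pd l (\<tau> y)) has_derivative (\<lambda>w. frechet_derivative (Y.pd l) (at (\<tau> x)) (D\<tau> x w))) (at x)" for l
    by (rule has_derivative_compose[OF D\<tau>[OF x] C1_on_has_derivative[OF Y.C1_pd Tx]])
  have "((\<lambda>y. \<Sum>l\<in>UNIV. ?t l y *\<^sub>R Y.pd l (\<tau> y)) has_derivative
      (\<lambda>w. \<Sum>l\<in>UNIV. ?t l x *\<^sub>R frechet_derivative (Y.pd l) (at (\<tau> x)) (D\<tau> x w) + ?Dt l w *\<^sub>R Y.pd l (\<tau> x))) (at x)"
    by (intro has_derivative_sum has_derivative_scaleR Dt DY)
  then have "(X.pd j has_derivative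
      (\<lambda>w. \<Sum>l\<in>UNIV. ?t l x *\<^sub>R frechet_derivative (Y.pd l) (at (\<tau> x)) (D\<tau> x w) + ?Dt l w *\<^sub>R Y.pd l (\<tau> x))) (at x)"
    by (rule has_derivative_transform_within_open[OF _ X.open_domain x])
      (simp add: derivative_eq linear_axis_expansion[OF Y.linear_derivative[OF maps_to], of _ "D\<tau> _ _", symmetric])
  then have "X.pd2 i j x = (\<Sum>l\<in>UNIV. ?t l x *\<^sub>R frechet_derivative (Y.pd l) (at (\<tau> x)) (D\<tau> x (axis i 1)) +
      ?Dt l (axis i 1) *\<^sub>R Y.pd l (\<tau> x))"
    by (simp add: frechet_derivative_at[symmetric])
  then have "P (X.pd2 i j x) = (\<Sum>l\<in>UNIV. ?t l x *\<^sub>R P (frechet_derivative (Y.pd l) (at (\<tau> x)) (D\<tau> x (axis i 1))) +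
      ?Dt l (axis i 1) *\<^sub>R P (Y.pd l (\<tau> x)))"
    by (simp add: linear_sum[OF lP] linear_add[OF lP] linear_cmul[OF lP])
  moreover have "P (Y.pd l (\<tau> x)) = 0" for l
    unfolding P_def by (rule normal_part_tangent[OF sub]) (simp add: param_tangent_def)
  moreover have "frechet_derivative (Y.pd l) (at (\<tau> x)) (D\<tau> x (axis i 1)) =
      (\<Sum>k\<in>UNIV. D\<tau> x (axis i 1) $ k *\<^sub>R Y.pd2 k l (\<tau> x))" for l
    by (rule linear_axis_expansion[OF has_derivative_linear[OF C1_on_has_derivative[OF Y.C1_pd Tx]]])
  ultimately have "P (X.pd2 i j x) = (\<Sum>l\<in>UNIV. \<Sum>k\<in>UNIV. (matrix (D\<tau> x) $ k $ i * matrix (D\<tau> x) $ l $ j) *\<^sub>R P (Y.pd2 k l (\<tau> x)))"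
    by (simp add: linear_sum[OF lP] linear_cmul[OF lP] scaleR_right.sum matrix_def mult.commute)
  then show ?thesis by (subst sum.swap)
qed

text \<open>With \<open>M\<close> the Jacobian matrix of the transition map the inverse metrics satisfy \<open>M h\<^sub>X M\<^sup>T = h\<^sub>Y\<close>, which is
  how the trace absorbs the factors from the second derivatives.\<close>

lemma mean_curvature_eq:
  assumes x: "x \<in> S"
  shows "param_mean_curvature X x = param_mean_curvature Y (\<tau> x)"
proof -
  let ?M = "matrix (D\<tau> x)" and ?gX = "induced_metric X x" and ?gY = "induced_metric Y (\<tau> x)"
  let ?hX = "matrix_inv ?gX" and ?hY = "matrix_inv ?gY" and ?P = "normal_part (param_tangent Y (\<tau> x))"
  have Tx: "\<tau> x \<in> T" by (rule maps_to[OF x])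
  have invX: "?hX ** ?gX = mat 1"
    using matrix_inv_gram[OF X.linear_derivative[OF x] X.inj_derivative[OF x]] by (simp add: induced_metric_eq_gram)
  have invY: "?gY ** ?hY = mat 1"
    using matrix_inv_gram[OF Y.linear_derivative[OF Tx] Y.inj_derivative[OF Tx]] by (simp add: induced_metric_eq_gram)
  have "(*v) ?M = D\<tau> x"
    by (rule ext) (simp add: matrix_works linear_D\<tau>[OF x])
  then have "\<exists>B. ?M ** B = mat 1"
    unfolding matrix_right_invertible_surjective by (simp add: surj_D\<tau>[OF x])
  then obtain B where B: "?M ** B = mat 1" ..
  have "?M ** ?hX ** transpose ?M ** ?gY = ?M ** ?hX ** (transpose ?M ** (?gY ** ?M)) ** B"
    by (simp add: matrix_mul_assoc[symmetric] B)
  also have "\<dots> = mat 1"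
    by (simp add: metric_eq[OF x, symmetric] matrix_mul_assoc[symmetric]) (simp add: matrix_mul_assoc invX B)
  finally have "?M ** ?hX ** transpose ?M = ?hY"
    using invY by (metis matrix_mul_assoc matrix_mul_lid matrix_mul_rid)
  then have h: "(\<Sum>i\<in>UNIV. \<Sum>j\<in>UNIV. ?hX $ i $ j * (?M $ k $ i * ?M $ l $ j)) = ?hY $ k $ l" for k l
  proof -
    have "?hY $ k $ l = (\<Sum>j\<in>UNIV. \<Sum>i\<in>UNIV. ?M $ k $ i * ?hX $ i $ j * ?M $ l $ j)"
      using \<open>?M ** ?hX ** transpose ?M = ?hY\<close>
      by (simp add: matrix_matrix_mult_def transpose_def vec_eq_iff sum_distrib_right)
    then show ?thesis by (subst sum.swap) (simp add: mult_ac)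
  qed
  have "param_mean_curvature X x = (\<Sum>i\<in>UNIV. \<Sum>j\<in>UNIV. ?hX $ i $ j *\<^sub>R ?P (X.pd2 i j x))"
    by (simp add: param_mean_curvature_def second_fundamental_form_def param_tangent_eq[OF x])
  also have "\<dots> = (\<Sum>i\<in>UNIV. \<Sum>j\<in>UNIV. \<Sum>k\<in>UNIV. \<Sum>l\<in>UNIV. (?hX $ i $ j * (?M $ k $ i * ?M $ l $ j)) *\<^sub>R ?P (Y.pd2 k l (\<tau> x)))"
    by (simp add: normal_second_derivative[OF x] scaleR_right.sum)
  also have "\<dots> = (\<Sum>k\<in>UNIV. \<Sum>l\<in>UNIV. \<Sum>i\<in>UNIV. \<Sum>j\<in>UNIV. (?hX $ i $ j * (?M $ k $ i * ?M $ l $ j)) *\<^sub>R ?P (Y.pd2 k l (\<tau> x)))"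
  proof -
    have swap4: "(\<Sum>i\<in>UNIV. \<Sum>j\<in>UNIV. \<Sum>k\<in>UNIV. \<Sum>l\<in>UNIV. f i j k l) = (\<Sum>k\<in>UNIV. \<Sum>l\<in>UNIV. \<Sum>i\<in>UNIV. \<Sum>j\<in>UNIV. f i j k l)"
      for f :: "'n \<Rightarrow> 'n \<Rightarrow> 'n \<Rightarrow> 'n \<Rightarrow> real^'m"
    proof -
      have "(\<Sum>i\<in>UNIV. \<Sum>j\<in>UNIV. \<Sum>k\<in>UNIV. \<Sum>l\<in>UNIV. f i j k l) = (\<Sum>i\<in>UNIV. \<Sum>k\<in>UNIV. \<Sum>j\<in>UNIV. \<Sum>l\<in>UNIV. f i j k l)"
        by (rule sum.cong[OF refl], rule sum.swap)
      also have "\<dots> = (\<Sum>k\<in>UNIV. \<Sum>i\<in>UNIV. \<Sum>j\<in>UNIV. \<Sum>l\<in>UNIV. f i j k l)"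
        by (rule sum.swap)
      also have "\<dots> = (\<Sum>k\<in>UNIV. \<Sum>i\<in>UNIV. \<Sum>l\<in>UNIV. \<Sum>j\<in>UNIV. f i j k l)"
        by (rule sum.cong[OF refl], rule sum.cong[OF refl], rule sum.swap)
      also have "\<dots> = (\<Sum>k\<in>UNIV. \<Sum>l\<in>UNIV. \<Sum>i\<in>UNIV. \<Sum>j\<in>UNIV. f i j k l)"
        by (rule sum.cong[OF refl], rule sum.swap)
      finally show ?thesis .
    qed
    show ?thesis by (rule swap4)
  qed
  also have "\<dots> = param_mean_curvature Y (\<tau> x)"
    by (simp add: scaleR_left.sum[symmetric] h param_mean_curvature_def second_fundamental_form_def)
  finally show ?thesis .
qed

end


section \<open>The Riemannian volume measure\<close>

locale immersed_manifold =
  fixes \<A> :: "('p::{t2_space, second_countable_topology}, 'n::finite) chart set"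
    and F :: "'p \<Rightarrow> real^'m::finite"
  assumes atlas: "smooth_atlas \<A>" and immersion: "smooth_immersion \<A> F"
begin

abbreviation param :: "('p, 'n) chart \<Rightarrow> real^'n \<Rightarrow> real^'m"
  where "param c \<equiv> F \<circ> chart_inv c"

abbreviation chart_img :: "('p, 'n) chart \<Rightarrow> (real^'n) set"
  where "chart_img c \<equiv> chart_map c ` chart_dom c"

lemma is_chart: "c \<in> \<A> \<Longrightarrow> is_chart c"
  using atlas by (simp add: smooth_atlas_def)

lemma open_chart_dom: "c \<in> \<A> \<Longrightarrow> open (chart_dom c)"
  and open_chart_img: "c \<in> \<A> \<Longrightarrow> open (chart_img c)"
  using is_chart by (simp_all add: is_chart_def)

lemma continuous_chart_map: "c \<in> \<A> \<Longrightarrow> continuous_on (chart_dom c) (chart_map c)"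
  and continuous_chart_inv: "c \<in> \<A> \<Longrightarrow> continuous_on (chart_img c) (chart_inv c)"
  using is_chart by (simp_all add: is_chart_def homeomorphism_def)

lemma chart_inv_map: "c \<in> \<A> \<Longrightarrow> p \<in> chart_dom c \<Longrightarrow> chart_inv c (chart_map c p) = p"
  and chart_map_inv: "c \<in> \<A> \<Longrightarrow> x \<in> chart_img c \<Longrightarrow> chart_map c (chart_inv c x) = x"
  using is_chart homeomorphism_apply1 homeomorphism_apply2 unfolding is_chart_def by blast+

lemma chart_inv_in_dom: "c \<in> \<A> \<Longrightarrow> x \<in> chart_img c \<Longrightarrow> chart_inv c x \<in> chart_dom c"
  using chart_inv_map by (metis imageE)

lemma chart_img_restrict:
  assumes "c \<in> \<A>" "E \<subseteq> chart_dom c"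
  shows "chart_map c ` E = {x \<in> chart_img c. chart_inv c x \<in> E}"
proof (intro set_eqI iffI)
  fix x assume "x \<in> {x \<in> chart_img c. chart_inv c x \<in> E}"
  then show "x \<in> chart_map c ` E"
    using chart_map_inv[OF assms(1)] by (metis (mono_tags, lifting) imageI mem_Collect_eq)
qed (use assms chart_inv_map[OF assms(1)] in auto)

lemma open_chart_map_image:
  assumes "c \<in> \<A>" "open U" "U \<subseteq> chart_dom c"
  shows "open (chart_map c ` U)"
proof -
  have "open (chart_img c \<inter> chart_inv c -` U)"
    by (rule continuous_open_preimage[OF continuous_chart_inv open_chart_img]) fact+
  then show ?thesis
    by (simp add: chart_img_restrict[OF assms(1,3)] vimage_def Int_def)
qed

lemma local_immersion_on:
  assumes "c \<in> \<A>" "open U" "U \<subseteq> chart_dom c"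
  shows "local_immersion (param c) (chart_map c ` U)"
proof
  show "open (chart_map c ` U)" by (rule open_chart_map_image[OF assms])
  have "Ck_on (Suc (Suc 0)) (chart_img c) (param c)"
    using immersion assms(1) by (auto simp: smooth_immersion_def smooth_on_def simp del: Ck_on.simps)
  then show "Ck_on (Suc (Suc 0)) (chart_map c ` U) (param c)"
    by (rule Ck_on_subset) (use assms in auto)
  show "inj (frechet_derivative (param c) (at x))" if "x \<in> chart_map c ` U" for x
    using immersion assms that by (auto simp: smooth_immersion_def)
qed

lemma local_immersion: "c \<in> \<A> \<Longrightarrow> local_immersion (param c) (chart_img c)"
  by (rule local_immersion_on[OF _ open_chart_dom]) auto

lemma chart_change:
  assumes "c \<in> \<A>" "d \<in> \<A>"
  shows "chart_change (param c) (chart_map c ` (chart_dom c \<inter> chart_dom d)) (param d) (chart_img d)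
    (chart_map d \<circ> chart_inv c)"
proof (intro chart_change.intro chart_change_axioms.intro)
  show "local_immersion (param c) (chart_map c ` (chart_dom c \<inter> chart_dom d))"
    using open_chart_dom[OF assms(1)] open_chart_dom[OF assms(2)]
    by (intro local_immersion_on[OF assms(1)]) auto
  show "local_immersion (param d) (chart_img d)"
    by (rule local_immersion[OF assms(2)])
  show "Ck_on (Suc (Suc 0)) (chart_map c ` (chart_dom c \<inter> chart_dom d)) (chart_map d \<circ> chart_inv c)"
    using atlas assms by (auto simp: smooth_atlas_def smooth_on_def simp del: Ck_on.simps)
qed (use chart_inv_map[OF assms(1)] chart_inv_map[OF assms(2)] in auto)

lemma borel_chart_img: "c \<in> \<A> \<Longrightarrow> chart_img c \<in> sets borel"
  and borel_chart_dom: "c \<in> \<A> \<Longrightarrow> chart_dom c \<in> sets borel"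
  using open_chart_img open_chart_dom by auto

lemma measurable_chart_inv: "c \<in> \<A> \<Longrightarrow> chart_inv c \<in> restrict_space borel (chart_img c) \<rightarrow>\<^sub>M borel"
  by (rule borel_measurable_continuous_on_restrict[OF continuous_chart_inv])

lemma borel_chart_map_image:
  assumes "c \<in> \<A>" "E \<in> sets borel" "E \<subseteq> chart_dom c"
  shows "chart_map c ` E \<in> sets borel"
proof -
  have "chart_inv c -` E \<inter> chart_img c \<in> sets (restrict_space borel (chart_img c))"
    using measurable_sets[OF measurable_chart_inv[OF assms(1)] assms(2)] by (simp add: space_restrict_space)
  then have "chart_inv c -` E \<inter> chart_img c \<in> sets borel"
    using borel_chart_img[OF assms(1)] by (simp add: sets_restrict_space_iff)
  also have "chart_inv c -` E \<inter> chart_img c = chart_map c ` E"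
    by (auto simp: chart_img_restrict[OF assms(1,3)])
  finally show ?thesis .
qed

lemma continuous_vol_density: "c \<in> \<A> \<Longrightarrow> continuous_on (chart_img c) (vol_density (param c))"
  by (rule C1_on_continuous_on[OF local_immersion.C1_vol_density[OF local_immersion]])

lemma vol_density_pos: "c \<in> \<A> \<Longrightarrow> x \<in> chart_img c \<Longrightarrow> 0 < vol_density (param c) x"
  by (rule local_immersion.vol_density_pos[OF local_immersion])

definition chart_volume :: "('p, 'n) chart \<Rightarrow> 'p set \<Rightarrow> ennreal"
  where "chart_volume c E = (\<integral>\<^sup>+x. ennreal (vol_density (param c) x) * indicator (chart_map c ` E) x \<partial>lborel)"

definition chart_measure :: "('p, 'n) chart \<Rightarrow> 'p measure"
  where "chart_measure c = distr (density (restrict_space lborel (chart_img c)) (\<lambda>x. ennreal (vol_density (param c) x)))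
    borel (chart_inv c)"

lemma sets_chart_measure [simp]: "sets (chart_measure c) = sets borel"
  and space_chart_measure [simp]: "space (chart_measure c) = UNIV"
  by (simp_all add: chart_measure_def)

lemma sets_restrict_lborel: "sets (restrict_space lborel A) = sets (restrict_space borel A)"
  by (rule sets_restrict_space_cong) simp

lemma measurable_vol_density_restrict:
  "c \<in> \<A> \<Longrightarrow> vol_density (param c) \<in> borel_measurable (restrict_space lborel (chart_img c))"
  using borel_measurable_continuous_on_restrict[OF continuous_vol_density]
  by (simp add: measurable_cong_sets[OF sets_restrict_lborel refl])

lemma measurable_chart_inv_density:
  "c \<in> \<A> \<Longrightarrow> chart_inv c \<in> density (restrict_space lborel (chart_img c)) w \<rightarrow>\<^sub>M borel"
  "c \<in> \<A> \<Longrightarrow> chart_inv c \<in> restrict_space lborel (chart_img c) \<rightarrow>\<^sub>M borel"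
  using measurable_chart_inv by (simp_all add: measurable_cong_sets[OF sets_restrict_lborel refl])

lemma emeasure_chart_measure:
  assumes c: "c \<in> \<A>" and E: "E \<in> sets borel"
  shows "emeasure (chart_measure c) E = chart_volume c (E \<inter> chart_dom c)"
proof -
  let ?R = "restrict_space lborel (chart_img c)" and ?w = "\<lambda>x. ennreal (vol_density (param c) x)"
  have sp: "space ?R = chart_img c" by (simp add: space_restrict_space)
  have "emeasure (chart_measure c) E = emeasure (density ?R ?w) (chart_inv c -` E \<inter> chart_img c)"
    unfolding chart_measure_def using E
    by (subst emeasure_distr[OF measurable_chart_inv_density(1)[OF c]]) (simp_all add: sp)
  also have "\<dots> = (\<integral>\<^sup>+x. ?w x * indicator (chart_inv c -` E \<inter> chart_img c) x \<partial>?R)"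
    by (rule emeasure_density)
      (use measurable_vol_density_restrict[OF c] measurable_sets[OF measurable_chart_inv_density(2)[OF c] E]
        in \<open>auto simp: sp\<close>)
  also have "\<dots> = (\<integral>\<^sup>+x. ?w x * indicator (chart_inv c -` E \<inter> chart_img c) x * indicator (chart_img c) x \<partial>lborel)"
    by (rule nn_integral_restrict_space) (use borel_chart_img[OF c] in simp)
  also have "\<dots> = chart_volume c (E \<inter> chart_dom c)"
    unfolding chart_volume_def
    by (rule nn_integral_cong)
      (use chart_inv_in_dom[OF c] in \<open>auto simp: indicator_def chart_img_restrict[OF c, of "E \<inter> chart_dom c"]\<close>)
  finally show ?thesis .
qed

text \<open>The densities in two charts differ by the Jacobian determinant of the transition map.\<close>

lemma chart_volume_eq:
  assumes c: "c \<in> \<A>" and d: "d \<in> \<A>" and E: "E \<in> sets borel" "E \<subseteq> chart_dom c \<inter> chart_dom d"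
  shows "chart_volume c E = chart_volume d E"
proof -
  interpret chart_change "param c" "chart_map c ` (chart_dom c \<inter> chart_dom d)" "param d" "chart_img d"
    "chart_map d \<circ> chart_inv c"
    by (rule chart_change[OF c d])
  let ?\<tau> = "chart_map d \<circ> chart_inv c" and ?S = "chart_map c ` E"
  have S: "x \<in> chart_map c ` (chart_dom c \<inter> chart_dom d)" if "x \<in> ?S" for x
    using that E(2) by auto
  have img: "?\<tau> ` ?S = chart_map d ` E"
    using E(2) chart_inv_map[OF c] by (auto simp: image_iff subset_iff)
  have dens: "\<bar>det (matrix (D\<tau> x))\<bar> * vol_density (param d) (?\<tau> x) = vol_density (param c) x" if "x \<in> ?S" for x
    using vol_density_eq[OF S[OF that]] by simp
  have bS: "?S \<in> sets borel" and bS': "chart_map d ` E \<in> sets borel"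
    using borel_chart_map_image E c d by auto
  have m: "(\<lambda>x. indicator (chart_map e ` E) x * vol_density (param e) x) \<in> borel_measurable borel"
    if "e \<in> \<A>" "E \<subseteq> chart_dom e" for e
    using borel_measurable_continuous_on_indicator[OF borel_chart_map_image[OF that(1) E(1) that(2)]
        continuous_on_subset[OF continuous_vol_density[OF that(1)]]] that by auto
  have conv: "chart_volume e E = (\<integral>\<^sup>+x. ennreal (indicator (chart_map e ` E) x * vol_density (param e) x) \<partial>lborel)" for e
    unfolding chart_volume_def by (rule nn_integral_cong) (auto simp: indicator_def)
  have eqS: "indicator ?S x * (\<bar>det (matrix (D\<tau> x))\<bar> * vol_density (param d) (?\<tau> x)) = indicator ?S x * vol_density (param c) x" for x
    using dens[of x] by (cases "x \<in> ?S") auto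
  have "(\<integral>\<^sup>+y. ennreal (indicator (?\<tau> ` ?S) y * vol_density (param d) y) \<partial>lborel) =
    (\<integral>\<^sup>+x. ennreal (indicator ?S x * (\<bar>det (matrix (D\<tau> x))\<bar> * vol_density (param d) (?\<tau> x))) \<partial>lborel)"
  proof (rule nn_integral_change_of_variables[OF bS])
    show "(?\<tau> has_derivative D\<tau> x) (at x)" if "x \<in> ?S" for x
      by (rule D\<tau>[OF S[OF that]])
    show "inj_on ?\<tau> ?S"
    proof (rule inj_onI)
      fix x y assume xy: "x \<in> ?S" "y \<in> ?S" "?\<tau> x = ?\<tau> y"
      then obtain p q where pq: "p \<in> E" "x = chart_map c p" "q \<in> E" "y = chart_map c q" by blast
      then have "p \<in> chart_dom c" "p \<in> chart_dom d" "q \<in> chart_dom c" "q \<in> chart_dom d"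
        using E(2) by auto
      then have "chart_map d p = chart_map d q"
        using xy(3) by (simp add: pq chart_inv_map[OF c])
      then have "p = q"
        using chart_inv_map[OF d \<open>p \<in> chart_dom d\<close>] chart_inv_map[OF d \<open>q \<in> chart_dom d\<close>] by metis
      then show "x = y" by (simp add: pq)
    qed
    show "0 \<le> vol_density (param d) y" if "y \<in> ?\<tau> ` ?S" for y
      using that E(2) vol_density_pos[OF d, of y] unfolding img by (auto simp: less_imp_le)
    show "(\<lambda>y. indicator (?\<tau> ` ?S) y * vol_density (param d) y) \<in> borel_measurable borel"
      unfolding img by (rule m[OF d]) (use E in auto)
    show "(\<lambda>x. indicator ?S x * (\<bar>det (matrix (D\<tau> x))\<bar> * vol_density (param d) (?\<tau> x))) \<in> borel_measurable borel"
      unfolding eqS by (rule m[OF c]) (use E in auto)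
  qed
  then show ?thesis
    unfolding eqS img conv by simp
qed

lemma countable_charts:
  obtains e :: "nat \<Rightarrow> ('p, 'n) chart" where "range e \<subseteq> \<A>" "(\<Union>i. chart_dom (e i)) = UNIV"
proof -
  obtain \<U> where U: "\<U> \<subseteq> chart_dom ` \<A>" "countable \<U>" "\<Union>\<U> = \<Union>(chart_dom ` \<A>)"
    using Lindelof[of "chart_dom ` \<A>"] open_chart_dom by blast
  have cov: "\<Union>\<U> = UNIV" using U(3) atlas by (simp add: smooth_atlas_def)
  then have "\<U> \<noteq> {}" by auto
  have "\<forall>i. \<exists>c\<in>\<A>. chart_dom c = from_nat_into \<U> i"
    using U(1) from_nat_into[OF \<open>\<U> \<noteq> {}\<close>] by (metis image_iff subset_iff)
  then obtain e where e: "\<And>i. e i \<in> \<A>" "\<And>i. chart_dom (e i) = from_nat_into \<U> i"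
    by metis
  have "(\<Union>i. chart_dom (e i)) = UNIV"
    using cov range_from_nat_into[OF \<open>\<U> \<noteq> {}\<close> U(2)] by (simp add: e(2))
  then show ?thesis using that[of e] e(1) by auto
qed

text \<open>A second countable manifold is a countable disjoint union of Borel sets that lie in charts. This both
  determines the volume measure and allows to construct it.\<close>

lemma countable_partition:
  obtains e :: "nat \<Rightarrow> ('p, 'n) chart" and P
  where "range e \<subseteq> \<A>" "\<And>i. P i \<in> sets borel" "\<And>i. P i \<subseteq> chart_dom (e i)" "disjoint_family P" "(\<Union>i. P i) = UNIV"
proof -
  obtain e :: "nat \<Rightarrow> ('p, 'n) chart" where e: "range e \<subseteq> \<A>" "(\<Union>i. chart_dom (e i)) = UNIV"
    by (rule countable_charts)
  have eA: "e i \<in> \<A>" for i using e(1) by blast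
  let ?P = "disjointed (\<lambda>i. chart_dom (e i))"
  show ?thesis
  proof (rule that[OF e(1), of ?P])
    show "?P i \<in> sets borel" for i
      using borel_chart_dom[OF eA] unfolding disjointed_def by (intro sets.Diff sets.finite_UN) simp_all
    show "?P i \<subseteq> chart_dom (e i)" for i by (auto simp: disjointed_def)
    show "disjoint_family ?P" by (rule disjoint_family_disjointed)
    show "(\<Union>i. ?P i) = UNIV" using e(2) by (simp add: UN_disjointed_eq)
  qed
qed

lemma emeasure_eq_suminf_partition:
  assumes "sets M = sets borel" "\<And>i. P i \<in> sets borel" "disjoint_family P" "(\<Union>i::nat. P i) = UNIV" "E \<in> sets borel"
  shows "emeasure M E = (\<Sum>i. emeasure M (E \<inter> P i))"
proof -
  have "(\<Sum>i. emeasure M (E \<inter> P i)) = emeasure M (\<Union>i. E \<inter> P i)"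
    by (rule suminf_emeasure) (use assms(1,2,3,5) in \<open>auto simp: disjoint_family_on_def disjoint_iff\<close>)
  also have "(\<Union>i. E \<inter> P i) = E" using assms(4) by blast
  finally show ?thesis by simp
qed

definition is_volume :: "'p measure \<Rightarrow> bool"
  where "is_volume \<sigma> \<longleftrightarrow> sets \<sigma> = sets borel \<and>
    (\<forall>c\<in>\<A>. \<forall>E\<in>sets borel. E \<subseteq> chart_dom c \<longrightarrow> emeasure \<sigma> E = chart_volume c E)"

lemma volume_measure_eq: "volume_measure \<A> F = (THE \<sigma>. is_volume \<sigma>)"
  by (simp add: volume_measure_def is_volume_def chart_volume_def vol_density_def)

lemma is_volume_unique:
  assumes "is_volume \<sigma>" "is_volume \<sigma>'"
  shows "\<sigma> = \<sigma>'"
proof (rule measure_eqI)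
  show sets: "sets \<sigma> = sets \<sigma>'" using assms by (simp add: is_volume_def)
  fix E assume "E \<in> sets \<sigma>"
  then have E: "E \<in> sets borel" using assms by (simp add: is_volume_def)
  obtain e P where eP: "range e \<subseteq> \<A>" "\<And>i. P i \<in> sets borel" "\<And>i. P i \<subseteq> chart_dom (e i)"
    "disjoint_family P" "(\<Union>i::nat. P i) = UNIV"
    using countable_partition by metis
  have "emeasure \<sigma> (E \<inter> P i) = emeasure \<sigma>' (E \<inter> P i)" for i
  proof -
    have "e i \<in> \<A>" "E \<inter> P i \<in> sets borel" "E \<inter> P i \<subseteq> chart_dom (e i)"
      using eP(1) eP(2)[of i] eP(3)[of i] E by auto
    then show ?thesis using assms by (simp add: is_volume_def)
  qed
  then show "emeasure \<sigma> E = emeasure \<sigma>' E"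
    using emeasure_eq_suminf_partition[OF _ eP(2,4,5) E] assms by (simp add: is_volume_def)
qed

text \<open>Each piece of the partition is measured in its own chart. A set in the domain of another chart gets
  the right volume, since its pieces have the same volume in both charts.\<close>

lemma is_volume_exists: "\<exists>\<sigma>. is_volume \<sigma>"
proof -
  obtain e P where e: "range e \<subseteq> \<A>" and P: "\<And>i. P i \<in> sets borel" "\<And>i. P i \<subseteq> chart_dom (e i)"
    "disjoint_family P" "(\<Union>i::nat. P i) = UNIV"
    using countable_partition by metis
  define m where "m E = (\<integral>\<^sup>+i. emeasure (chart_measure (e i)) (E \<inter> P i) \<partial>count_space UNIV)" for E
  define \<sigma> where "\<sigma> = measure_of UNIV (sets borel) m"
  have eA: "e i \<in> \<A>" for i using e by auto
  have "countably_additive (sets borel) m"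
    unfolding countably_additive_def
  proof (intro allI impI)
    fix A :: "nat \<Rightarrow> 'p set" assume A: "range A \<subseteq> sets borel" "disjoint_family A" "(\<Union>i. A i) \<in> sets borel"
    have "(\<Sum>n. m (A n)) = (\<integral>\<^sup>+i. (\<Sum>n. emeasure (chart_measure (e i)) (A n \<inter> P i)) \<partial>count_space UNIV)"
      unfolding m_def by (rule nn_integral_suminf[symmetric]) simp
    also have "\<dots> = (\<integral>\<^sup>+i. emeasure (chart_measure (e i)) ((\<Union>n. A n) \<inter> P i) \<partial>count_space UNIV)"
    proof (rule nn_integral_cong)
      fix i
      have "(\<Sum>n. emeasure (chart_measure (e i)) (A n \<inter> P i)) = emeasure (chart_measure (e i)) (\<Union>n. A n \<inter> P i)"
        by (rule suminf_emeasure) (use A P in \<open>auto simp: disjoint_family_on_def disjoint_iff\<close>)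
      then show "(\<Sum>n. emeasure (chart_measure (e i)) (A n \<inter> P i)) = emeasure (chart_measure (e i)) ((\<Union>n. A n) \<inter> P i)"
        by simp
    qed
    finally show "(\<Sum>n. m (A n)) = m (\<Union>n. A n)" by (simp add: m_def)
  qed
  moreover have "positive (sets borel) m"
    by (simp add: positive_def m_def)
  ultimately have em: "emeasure \<sigma> E = m E" if "E \<in> sets borel" for E
    unfolding \<sigma>_def using that sets.sigma_algebra_axioms[of borel]
    by (intro emeasure_measure_of_sigma) (simp_all add: space_borel)
  have sets\<sigma>: "sets \<sigma> = sets borel"
    unfolding \<sigma>_def using sets.sigma_sets_eq[of borel] sets.space_closed[of borel] by simp
  have "emeasure \<sigma> E = chart_volume c E" if c: "c \<in> \<A>" and E: "E \<in> sets borel" "E \<subseteq> chart_dom c" for c E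
  proof -
    have "emeasure (chart_measure (e i)) (E \<inter> P i) = emeasure (chart_measure c) (E \<inter> P i)" for i
    proof -
      have b: "E \<inter> P i \<in> sets borel" using E P by auto
      have s: "E \<inter> P i \<inter> chart_dom (e i) = E \<inter> P i" "E \<inter> P i \<inter> chart_dom c = E \<inter> P i"
        using E(2) P(2)[of i] by auto
      have "E \<inter> P i \<subseteq> chart_dom (e i) \<inter> chart_dom c" using E(2) P(2)[of i] by auto
      from chart_volume_eq[OF eA c b this] show ?thesis
        by (simp add: emeasure_chart_measure[OF _ b] eA c s)
    qed
    then have "emeasure \<sigma> E = (\<Sum>i. emeasure (chart_measure c) (E \<inter> P i))"
      by (simp add: em E m_def nn_integral_count_space_nat)
    also have "\<dots> = emeasure (chart_measure c) E"
      by (rule emeasure_eq_suminf_partition[symmetric]) (use P E in auto)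
    also have "\<dots> = chart_volume c E"
      using E by (simp add: emeasure_chart_measure[OF c] Int_absorb2)
    finally show ?thesis .
  qed
  then have "is_volume \<sigma>" using sets\<sigma> by (simp add: is_volume_def)
  then show ?thesis ..
qed

abbreviation vol :: "'p measure" where "vol \<equiv> volume_measure \<A> F"

lemma is_volume_volume_measure: "is_volume vol"
  unfolding volume_measure_eq
  using is_volume_exists is_volume_unique by (metis theI)

lemma sets_vol [simp]: "sets vol = sets borel"
  and emeasure_vol: "c \<in> \<A> \<Longrightarrow> E \<in> sets borel \<Longrightarrow> E \<subseteq> chart_dom c \<Longrightarrow> emeasure vol E = chart_volume c E"
  using is_volume_volume_measure by (simp_all add: is_volume_def)

lemma space_vol [simp]: "space vol = UNIV"
  using sets_eq_imp_space_eq[OF sets_vol] by simp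

lemma density_vol_chart:
  assumes c: "c \<in> \<A>"
  shows "density vol (indicator (chart_dom c)) = chart_measure c"
proof (rule measure_eqI)
  fix E assume "E \<in> sets (density vol (indicator (chart_dom c)))"
  then have E: "E \<in> sets borel" by simp
  have "emeasure (density vol (indicator (chart_dom c))) E = (\<integral>\<^sup>+p. indicator (chart_dom c) p * indicator E p \<partial>vol)"
    by (rule emeasure_density) (use E borel_chart_dom[OF c] in \<open>auto intro!: borel_measurable_indicator\<close>)
  also have "\<dots> = (\<integral>\<^sup>+p. indicator (E \<inter> chart_dom c) p \<partial>vol)"
    by (intro nn_integral_cong) (auto simp: indicator_def)
  also have "\<dots> = emeasure vol (E \<inter> chart_dom c)"
    by (rule nn_integral_indicator) (use E borel_chart_dom[OF c] in auto)
  also have "\<dots> = chart_volume c (E \<inter> chart_dom c)"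
    by (rule emeasure_vol[OF c]) (use E borel_chart_dom[OF c] in auto)
  also have "\<dots> = emeasure (chart_measure c) E"
    by (rule emeasure_chart_measure[OF c E, symmetric])
  finally show "emeasure (density vol (indicator (chart_dom c))) E = emeasure (chart_measure c) E" .
qed simp

lemma integral_in_chart:
  fixes h :: "'p \<Rightarrow> real"
  assumes c: "c \<in> \<A>" and h: "h \<in> borel_measurable borel" and h0: "\<And>p. p \<notin> chart_dom c \<Longrightarrow> h p = 0"
  shows "integrable vol h \<longleftrightarrow>
      integrable lborel (\<lambda>x. indicator (chart_img c) x * (vol_density (param c) x * h (chart_inv c x)))" (is ?int)
    and "(\<integral>p. h p \<partial>vol) = (\<integral>x. indicator (chart_img c) x * (vol_density (param c) x * h (chart_inv c x)) \<partial>lborel)" (is ?eq)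
proof -
  let ?R = "restrict_space lborel (chart_img c)" and ?w = "vol_density (param c)"
  have hind: "(\<lambda>p. indicator (chart_dom c) p *\<^sub>R h p) = h"
    using h0 by (auto simp: fun_eq_iff indicator_def)
  have den: "density vol (\<lambda>p. ennreal (indicator (chart_dom c) p)) = chart_measure c"
  proof -
    have "(\<lambda>p. ennreal (indicator (chart_dom c) p)) = indicator (chart_dom c)"
      by (auto simp: fun_eq_iff indicator_def)
    then show ?thesis using density_vol_chart[OF c] by simp
  qed
  have hv: "h \<in> borel_measurable vol" and iv: "(indicator (chart_dom c) :: 'p \<Rightarrow> real) \<in> borel_measurable vol"
    using h borel_chart_dom[OF c] by (simp_all add: measurable_cong_sets[OF sets_vol refl])
  have sp: "chart_img c \<inter> space lborel \<in> sets lborel" using borel_chart_img[OF c] by simp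
  have hc: "(\<lambda>x. h (chart_inv c x)) \<in> borel_measurable ?R"
    using measurable_compose[OF measurable_chart_inv_density(2)[OF c] h] .
  have hd: "h \<in> borel_measurable (chart_measure c)"
    using h by (simp add: measurable_cong_sets[OF sets_chart_measure refl])
  have wR: "AE x in ?R. 0 \<le> ?w x"
    using vol_density_pos[OF c] by (intro AE_I2) (auto simp: space_restrict_space intro: less_imp_le)
  have "integrable vol h \<longleftrightarrow> integrable (chart_measure c) h"
    using integrable_density[OF hv iv] by (simp add: den hind[simplified] del: real_scaleR_def) (simp add: hind[simplified])
  also have "\<dots> \<longleftrightarrow> integrable (density ?R (\<lambda>x. ennreal (?w x))) (\<lambda>x. h (chart_inv c x))"
    unfolding chart_measure_def by (rule integrable_distr_eq[OF measurable_chart_inv_density(1)[OF c] h])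
  also have "\<dots> \<longleftrightarrow> integrable ?R (\<lambda>x. ?w x *\<^sub>R h (chart_inv c x))"
    by (rule integrable_density[OF hc measurable_vol_density_restrict[OF c] wR])
  also have "\<dots> \<longleftrightarrow> integrable lborel (\<lambda>x. indicator (chart_img c) x *\<^sub>R (?w x *\<^sub>R h (chart_inv c x)))"
    by (rule integrable_restrict_space[OF sp])
  finally show ?int by simp
  have "(\<integral>p. h p \<partial>vol) = (\<integral>p. h p \<partial>chart_measure c)"
    using integral_density[OF hv iv] unfolding den hind by simp
  also have "\<dots> = (\<integral>x. h (chart_inv c x) \<partial>density ?R (\<lambda>x. ennreal (?w x)))"
    unfolding chart_measure_def by (rule integral_distr[OF measurable_chart_inv_density(1)[OF c] h])
  also have "\<dots> = (\<integral>x. ?w x *\<^sub>R h (chart_inv c x) \<partial>?R)"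
    by (rule integral_density[OF hc measurable_vol_density_restrict[OF c] wR])
  also have "\<dots> = (\<integral>x. indicator (chart_img c) x *\<^sub>R (?w x *\<^sub>R h (chart_inv c x)) \<partial>lborel)"
    by (rule integral_restrict_space[OF sp])
  finally show ?eq by simp
qed

end


section \<open>The divergence theorem for the tangential position field\<close>

lemma C1_bump:
  fixes x0 :: "'a::euclidean_space"
  assumes "0 < r"
  obtains b :: "'a \<Rightarrow> real" where "Ck_on 1 UNIV b" "\<And>x. dist x x0 < r / 2 \<Longrightarrow> b x = 1" "\<And>x. r < dist x x0 \<Longrightarrow> b x = 0"
proof -
  \<comment> \<open>\<open>?k\<close> is at least 1 near \<open>x0\<close> and vanishes far away; the outer square flattens it to the constant 1\<close>
  let ?q = "\<lambda>t::real. (max 0 t)\<^sup>2"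
  let ?k = "\<lambda>x. ?q (2 + (- 2 / r\<^sup>2) * ((x + - x0) \<bullet> (x + - x0)))"
  let ?b = "\<lambda>x. 1 + (-1) * ?q (1 + (-1) * ?k x)"
  have q: "Ck_on 1 UNIV (\<lambda>x. ?q (f x))" if "Ck_on 1 UNIV f" for f :: "'a \<Rightarrow> real"
    by (rule C1_on_compose[OF C1_on_pos_part_square that]) simp
  have "Ck_on 1 UNIV ?b"
    by (intro C1_on_add C1_on_const C1_on_mult C1_on_inner C1_on_ident q)
  moreover have "?b x = 1" if "dist x x0 < r / 2" for x
  proof -
    have "(dist x x0)\<^sup>2 \<le> (r / 2)\<^sup>2" using that by (intro power_mono) auto
    then have "4 * ((x - x0) \<bullet> (x - x0)) \<le> r\<^sup>2"
      by (simp add: dist_norm power2_norm_eq_inner power_divide)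
    then have "2 * ((x - x0) \<bullet> (x - x0)) \<le> r\<^sup>2"
      using inner_ge_zero[of "x - x0"] by linarith
    then have "1 \<le> 2 + (- 2 / r\<^sup>2) * ((x + - x0) \<bullet> (x + - x0))"
      using \<open>0 < r\<close> by (simp add: field_simps)
    then have "1 \<le> ?k x" by (simp add: max_def)
    then show ?thesis by (simp add: max_def)
  qed
  moreover have "?b x = 0" if "r < dist x x0" for x
  proof -
    have "r\<^sup>2 \<le> (dist x x0)\<^sup>2" using that \<open>0 < r\<close> by (intro power_mono) auto
    then have "2 + (- 2 / r\<^sup>2) * ((x + - x0) \<bullet> (x + - x0)) \<le> 0"
      using \<open>0 < r\<close> by (simp add: dist_norm power2_norm_eq_inner field_simps)
    then have "?k x = 0" by (simp add: max_def)
    then show ?thesis by simp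
  qed
  ultimately show ?thesis by (rule that)
qed

context immersed_manifold
begin

lemma chart_at: "chart_at \<A> p \<in> \<A>" "p \<in> chart_dom (chart_at \<A> p)"
proof -
  have "\<exists>c. c \<in> \<A> \<and> p \<in> chart_dom c"
    using atlas unfolding smooth_atlas_def by blast
  then have "chart_at \<A> p \<in> \<A> \<and> p \<in> chart_dom (chart_at \<A> p)"
    unfolding chart_at_def by (rule someI_ex)
  then show "chart_at \<A> p \<in> \<A>" "p \<in> chart_dom (chart_at \<A> p)" by auto
qed

definition C1_fun :: "('p \<Rightarrow> real) \<Rightarrow> bool"
  where "C1_fun \<eta> \<longleftrightarrow> (\<forall>c\<in>\<A>. Ck_on 1 (chart_img c) (\<eta> \<circ> chart_inv c))"

text \<open>The derivative in the direction of the tangential part of the position vector. It does not depend on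
  the chart, see \<open>tangential_derivative_chart\<close>.\<close>

definition tangential_derivative :: "('p \<Rightarrow> real) \<Rightarrow> 'p \<Rightarrow> real"
  where "tangential_derivative \<eta> p = (let c = chart_at \<A> p; x = chart_map c p in
    frechet_derivative (\<eta> \<circ> chart_inv c) (at x) (tangent_coords (param c) x))"

text \<open>The divergence of the vector field \<open>\<eta> x\<^sup>T\<close>, by the product rule and \<open>div x\<^sup>T = n + \<langle>H, x\<rangle>\<close>.\<close>

definition divergence :: "('p \<Rightarrow> real) \<Rightarrow> 'p \<Rightarrow> real"
  where "divergence \<eta> p = \<eta> p * (real CARD('n) + mean_curvature \<A> F p \<bullet> F p) + tangential_derivative \<eta> p"

lemma C1_fun_D: "C1_fun \<eta> \<Longrightarrow> c \<in> \<A> \<Longrightarrow> Ck_on 1 (chart_img c) (\<eta> \<circ> chart_inv c)"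
  by (simp add: C1_fun_def del: Ck_on.simps)

lemma tangential_derivative_chart:
  assumes \<eta>: "C1_fun \<eta>" and d: "d \<in> \<A>" "p \<in> chart_dom d"
  shows "tangential_derivative \<eta> p =
    frechet_derivative (\<eta> \<circ> chart_inv d) (at (chart_map d p)) (tangent_coords (param d) (chart_map d p))"
proof -
  let ?c = "chart_at \<A> p"
  let ?S = "chart_map ?c ` (chart_dom ?c \<inter> chart_dom d)" and ?x = "chart_map ?c p" and ?\<tau> = "chart_map d \<circ> chart_inv ?c"
  interpret chart_change "param ?c" ?S "param d" "chart_img d" ?\<tau>
    by (rule chart_change[OF chart_at(1) d(1)])
  have x: "?x \<in> ?S" using chart_at(2) d(2) by blast
  have \<tau>x: "?\<tau> ?x = chart_map d p" using chart_inv_map[OF chart_at(1) chart_at(2)] by simp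
  have "frechet_derivative (\<eta> \<circ> chart_inv ?c) (at ?x) = frechet_derivative (\<lambda>y. (\<eta> \<circ> chart_inv d) (?\<tau> y)) (at ?x)"
  proof (rule frechet_derivative_transform_within_open[OF _ X.open_domain x])
    show "\<eta> \<circ> chart_inv ?c differentiable at ?x"
      using C1_on_has_derivative[OF C1_fun_D[OF \<eta> chart_at(1)], of ?x p] chart_at(2)
      by (auto simp: differentiable_def)
    show "(\<eta> \<circ> chart_inv ?c) y = (\<eta> \<circ> chart_inv d) (?\<tau> y)" if "y \<in> ?S" for y
      using that chart_inv_map[OF d(1)] chart_inv_map[OF chart_at(1)] by auto
  qed
  then have "tangential_derivative \<eta> p = frechet_derivative (\<lambda>y. (\<eta> \<circ> chart_inv d) (?\<tau> y)) (at ?x) (tangent_coords (param ?c) ?x)"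
    by (simp add: tangential_derivative_def Let_def)
  also have "\<dots> = frechet_derivative (\<eta> \<circ> chart_inv d) (at (?\<tau> ?x)) (tangent_coords (param d) (?\<tau> ?x))"
    by (rule derivative_along_tangent_coords[OF x C1_on_has_derivative[OF C1_fun_D[OF \<eta> d(1)]]])
      (use \<tau>x d(2) in auto)
  finally show ?thesis by (simp only: \<tau>x)
qed

lemma mean_curvature_chart:
  assumes d: "d \<in> \<A>" "p \<in> chart_dom d"
  shows "mean_curvature \<A> F p = param_mean_curvature (param d) (chart_map d p)"
proof -
  let ?c = "chart_at \<A> p"
  interpret chart_change "param ?c" "chart_map ?c ` (chart_dom ?c \<inter> chart_dom d)" "param d" "chart_img d"
    "chart_map d \<circ> chart_inv ?c"
    by (rule chart_change[OF chart_at(1) d(1)])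
  have "chart_map ?c p \<in> chart_map ?c ` (chart_dom ?c \<inter> chart_dom d)" using chart_at(2) d(2) by blast
  from mean_curvature_eq[OF this] show ?thesis
    using chart_inv_map[OF chart_at(1) chart_at(2)] by (simp add: mean_curvature_def)
qed

lemma divergence_chart:
  assumes \<eta>: "C1_fun \<eta>" and c: "c \<in> \<A>" and x: "x \<in> chart_img c"
  shows "vol_density (param c) x * divergence \<eta> (chart_inv c x) =
    (\<Sum>k\<in>UNIV. frechet_derivative (\<lambda>y. vol_density (param c) y * ((\<eta> \<circ> chart_inv c) y * tangent_coords (param c) y $ k))
      (at x) (axis k 1))"
  unfolding local_immersion.divergence_tangential_position[OF local_immersion[OF c] x C1_fun_D[OF \<eta> c]]
  using tangential_derivative_chart[OF \<eta> c chart_inv_in_dom[OF c x]] mean_curvature_chart[OF c chart_inv_in_dom[OF c x]]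
  by (simp add: divergence_def chart_map_inv[OF c x])

lemma divergence_eq_0_outside:
  assumes \<eta>: "C1_fun \<eta>" and K: "compact K" "\<And>q. q \<notin> K \<Longrightarrow> \<eta> q = 0" and p: "p \<notin> K"
  shows "divergence \<eta> p = 0"
proof -
  let ?c = "chart_at \<A> p" and ?x = "chart_map (chart_at \<A> p) p"
  have "open (- K)" using compact_imp_closed[OF K(1)] by auto
  then have o: "open (chart_map ?c ` (chart_dom ?c - K))"
    using open_chart_dom[OF chart_at(1)] by (intro open_chart_map_image[OF chart_at(1)]) (auto simp: Diff_eq)
  have "((\<eta> \<circ> chart_inv ?c) has_derivative (\<lambda>_. 0)) (at ?x)"
    by (rule has_derivative_transform_within_open[OF has_derivative_const[of 0] o])
      (use K(2) p chart_at(2) chart_inv_map[OF chart_at(1)] in auto)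
  then have "tangential_derivative \<eta> p = 0"
    by (simp add: tangential_derivative_def Let_def frechet_derivative_at[symmetric])
  then show ?thesis using K(2) p by (simp add: divergence_def)
qed

text \<open>In the chart the integrand becomes the Euclidean divergence of a vector field of compact support, which
  extends by zero to the whole space.\<close>

lemma integral_divergence_chart:
  assumes \<eta>: "C1_fun \<eta>" and c: "c \<in> \<A>" and K: "compact K" "K \<subseteq> chart_dom c" "\<And>q. q \<notin> K \<Longrightarrow> \<eta> q = 0"
  shows "integrable vol (divergence \<eta>)" "(\<integral>p. divergence \<eta> p \<partial>vol) = 0"
proof -
  interpret local_immersion "param c" "chart_img c" by (rule local_immersion[OF c])
  let ?D = "vol_density (param c)"
  let ?w = "\<lambda>k y. ?D y * ((\<eta> \<circ> chart_inv c) y * tangent_coords (param c) y $ k)"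
  define w where "w k y = (if y \<in> chart_img c then ?w k y else 0)" for k y
  define K' where "K' = chart_map c ` K"
  have K': "compact K'"
    unfolding K'_def by (rule compact_continuous_image[OF continuous_on_subset[OF continuous_chart_map[OF c] K(2)] K(1)])
  have w0: "w k y = 0" if "y \<notin> K'" for k y
  proof (cases "y \<in> chart_img c")
    case True
    then have "chart_inv c y \<notin> K"
      using that chart_map_inv[OF c True] by (metis K'_def imageI)
    then show ?thesis using K(3) by (simp add: w_def)
  qed (simp add: w_def)
  have C1w: "Ck_on 1 UNIV (w k)" for k
  proof -
    have "Ck_on 1 (chart_img c) (w k)"
    proof (rule C1_on_cong[OF open_domain])
      show "Ck_on 1 (chart_img c) (?w k)"
        by (intro C1_on_mult C1_vol_density C1_tangent_coords C1_fun_D[OF \<eta> c])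
    qed (simp add: w_def)
    moreover have oK: "open (- K')" using compact_imp_closed[OF K'] by auto
    have "Ck_on 1 (- K') (w k)"
      by (rule C1_on_cong[OF oK _ C1_on_const[of _ 0]]) (use w0 in auto)
    ultimately have "Ck_on 1 (chart_img c \<union> - K') (w k)"
      using oK by (intro C1_on_Un open_domain)
    moreover have "chart_img c \<union> - K' = UNIV" using K(2) by (auto simp: K'_def)
    ultimately show ?thesis by (simp only:)
  qed
  let ?G = "\<lambda>x. \<Sum>k\<in>UNIV. frechet_derivative (w k) (at x) (axis k 1)"
  have int: "integrable lborel ?G" "(\<integral>x. ?G x \<partial>lborel) = 0"
    using integral_frechet_derivative_eq_0[OF C1w K' w0] by simp_all
  have G_in: "?G x = ?D x * divergence \<eta> (chart_inv c x)" if x: "x \<in> chart_img c" for x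
  proof -
    have "frechet_derivative (w k) (at x) = frechet_derivative (?w k) (at x)" for k
      by (rule frechet_derivative_transform_within_open[OF _ open_domain x])
        (use C1_on_has_derivative[OF C1w] in \<open>auto simp: differentiable_def w_def\<close>)
    then show ?thesis by (simp only: divergence_chart[OF \<eta> c x])
  qed
  have G_out: "?G x = 0" if "x \<notin> chart_img c" for x
  proof -
    have "x \<notin> K'" using that K(2) by (auto simp: K'_def)
    then show ?thesis
      using frechet_derivative_eq_0_outside[OF compact_imp_closed[OF K'] w0] by simp
  qed
  have G: "indicator (chart_img c) x * (?D x * divergence \<eta> (chart_inv c x)) = ?G x" for x
    using G_in[of x] G_out[of x] by (cases "x \<in> chart_img c") simp_all
  have zero: "divergence \<eta> p = 0" if "p \<notin> chart_dom c" for p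
    using divergence_eq_0_outside[OF \<eta> K(1,3)] that K(2) by blast
  have "continuous_on (chart_dom c) (\<lambda>p. ?G (chart_map c p) / ?D (chart_map c p))"
  proof (intro continuous_on_divide)
    show "continuous_on (chart_dom c) (\<lambda>p. ?G (chart_map c p))"
      by (rule continuous_on_compose2[OF _ continuous_chart_map[OF c], of UNIV])
        (auto intro!: continuous_on_sum C1_on_continuous_derivative[OF C1w])
    show "continuous_on (chart_dom c) (\<lambda>p. ?D (chart_map c p))"
      by (rule continuous_on_compose2[OF continuous_vol_density[OF c] continuous_chart_map[OF c]]) simp
    show "\<forall>p\<in>chart_dom c. ?D (chart_map c p) \<noteq> 0"
      using vol_density_pos by (metis imageI less_irrefl)
  qed
  moreover have "?G (chart_map c p) / ?D (chart_map c p) = divergence \<eta> p" if "p \<in> chart_dom c" for p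
  proof -
    have "?D (chart_map c p) > 0" using vol_density_pos that by blast
    then show ?thesis using G_in[of "chart_map c p"] that by (simp add: chart_inv_map[OF c that])
  qed
  ultimately have "continuous_on (chart_dom c) (divergence \<eta>)"
    by (simp cong: continuous_on_cong)
  from borel_measurable_continuous_on_indicator[OF borel_chart_dom[OF c] this]
  have "(\<lambda>p. indicator (chart_dom c) p *\<^sub>R divergence \<eta> p) \<in> borel_measurable borel" .
  also have "(\<lambda>p. indicator (chart_dom c) p *\<^sub>R divergence \<eta> p) = divergence \<eta>"
    using zero by (auto simp: fun_eq_iff indicator_def)
  finally have m: "divergence \<eta> \<in> borel_measurable borel" .
  show "integrable vol (divergence \<eta>)" "(\<integral>p. divergence \<eta> p \<partial>vol) = 0"
    using integral_in_chart[OF c m zero] int by (simp_all add: G)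
qed

lemma C1_fun_mult:
  assumes "C1_fun f" "C1_fun g"
  shows "C1_fun (\<lambda>p. f p * g p)"
  using C1_on_mult[OF C1_fun_D[OF assms(1)] C1_fun_D[OF assms(2)]]
  by (simp add: C1_fun_def comp_def del: Ck_on.simps)

lemma C1_fun_const: "C1_fun (\<lambda>_. a)"
  by (simp add: C1_fun_def comp_def C1_on_const del: Ck_on.simps One_nat_def)

lemma C1_fun_add:
  assumes "C1_fun f" "C1_fun g"
  shows "C1_fun (\<lambda>p. f p + g p)"
  using C1_on_add[OF C1_fun_D[OF assms(1)] C1_fun_D[OF assms(2)]]
  by (simp add: C1_fun_def comp_def del: Ck_on.simps)

lemma divergence_add:
  assumes "C1_fun f" "C1_fun g"
  shows "divergence (\<lambda>p. f p + g p) p = divergence f p + divergence g p"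
proof -
  let ?c = "chart_at \<A> p"
  have "chart_map ?c p \<in> chart_img ?c" using chart_at(2) by blast
  from has_derivative_add[OF C1_on_has_derivative[OF C1_fun_D[OF assms(1) chart_at(1)] this]
      C1_on_has_derivative[OF C1_fun_D[OF assms(2) chart_at(1)] this]]
  have "tangential_derivative (\<lambda>p. f p + g p) p = tangential_derivative f p + tangential_derivative g p"
    by (simp add: tangential_derivative_def Let_def comp_def frechet_derivative_at[symmetric])
  then show ?thesis by (simp add: divergence_def algebra_simps)
qed

text \<open>On a localizable set a function can be replaced by its product with a cut-off that is supported in a
  single chart.\<close>

definition localizable :: "'p set \<Rightarrow> bool"
  where "localizable V \<longleftrightarrow> (\<exists>c\<in>\<A>. \<exists>K \<beta>. compact K \<and> K \<subseteq> chart_dom c \<and> C1_fun \<beta> \<and>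
    (\<forall>p\<in>V. \<beta> p = 1) \<and> (\<forall>p. p \<notin> K \<longrightarrow> \<beta> p = 0))"

text \<open>A bump function in a chart around \<open>p\<close>, extended by zero. The extension is continuously differentiable
  because the support is compact, hence closed in the Hausdorff space.\<close>

lemma localizable_neighbourhood: "\<exists>V. open V \<and> p \<in> V \<and> localizable V"
proof -
  let ?c = "chart_at \<A> p" and ?x0 = "chart_map (chart_at \<A> p) p"
  have c: "?c \<in> \<A>" by (rule chart_at)
  have "?x0 \<in> chart_img ?c" using chart_at(2) by blast
  then obtain r where r: "0 < r" "cball ?x0 r \<subseteq> chart_img ?c"
    using open_chart_img[OF c] open_contains_cball by metis
  obtain b :: "real^'n \<Rightarrow> real" where b: "Ck_on 1 UNIV b" "\<And>x. dist x ?x0 < r / 2 \<Longrightarrow> b x = 1" "\<And>x. r < dist x ?x0 \<Longrightarrow> b x = 0"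
    by (rule C1_bump[OF r(1)]) blast
  define \<beta> where "\<beta> q = (if q \<in> chart_dom ?c then b (chart_map ?c q) else 0)" for q
  define K where "K = chart_inv ?c ` cball ?x0 r"
  define V where "V = chart_dom ?c \<inter> chart_map ?c -` ball ?x0 (r / 2)"
  have K: "compact K"
    unfolding K_def by (rule compact_continuous_image[OF continuous_on_subset[OF continuous_chart_inv[OF c] r(2)]]) simp
  have KU: "K \<subseteq> chart_dom ?c"
    using r(2) chart_inv_in_dom[OF c] unfolding K_def by blast
  have out: "\<beta> q = 0" if "q \<notin> K" for q
  proof (cases "q \<in> chart_dom ?c")
    case True
    then have "chart_map ?c q \<notin> cball ?x0 r"
      using that chart_inv_map[OF c True] unfolding K_def by (metis imageI)
    then show ?thesis using b(3) by (simp add: \<beta>_def dist_commute)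
  qed (simp add: \<beta>_def)
  have "Ck_on 1 (chart_img d) (\<beta> \<circ> chart_inv d)" if d: "d \<in> \<A>" for d
  proof -
    let ?S = "chart_map d ` (chart_dom d \<inter> chart_dom ?c)" and ?T = "chart_map d ` (chart_dom d - K)"
    interpret chart_change "param d" ?S "param ?c" "chart_img ?c" "chart_map ?c \<circ> chart_inv d"
      by (rule chart_change[OF d c])
    have "Ck_on 1 ?S (\<lambda>x. b ((chart_map ?c \<circ> chart_inv d) x))"
      by (rule C1_on_compose[OF b(1) Ck_on_Suc_Suc_0_imp_C1[OF C2_\<tau>]]) simp
    then have S: "Ck_on 1 ?S (\<beta> \<circ> chart_inv d)"
      by (rule C1_on_cong[OF X.open_domain, rotated]) (auto simp: \<beta>_def chart_inv_map[OF d])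
    have "open (chart_dom d - K)"
      by (intro open_Diff open_chart_dom[OF d] compact_imp_closed[OF K])
    then have oT: "open ?T" by (rule open_chart_map_image[OF d]) simp
    have T: "Ck_on 1 ?T (\<beta> \<circ> chart_inv d)"
      by (rule C1_on_cong[OF oT _ C1_on_const[of _ 0]]) (auto simp: out chart_inv_map[OF d])
    have "chart_img d = ?S \<union> ?T" using KU by auto
    then show ?thesis using C1_on_Un[OF X.open_domain oT S T] by (simp only:)
  qed
  then have "C1_fun \<beta>" by (simp add: C1_fun_def del: Ck_on.simps)
  moreover have "\<forall>q\<in>V. \<beta> q = 1" using b(2) by (auto simp: V_def \<beta>_def dist_commute)
  ultimately have "localizable V"
    unfolding localizable_def using c K KU out by blast
  moreover have "open V"
    unfolding V_def by (intro continuous_open_preimage continuous_chart_map[OF c] open_chart_dom[OF c]) simp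
  moreover have "p \<in> V" using chart_at(2) r(1) by (simp add: V_def)
  ultimately show ?thesis by blast
qed

lemma compact_finite_localizable_cover:
  assumes "compact L"
  obtains \<V> where "finite \<V>" "\<And>V. V \<in> \<V> \<Longrightarrow> localizable V" "L \<subseteq> \<Union>\<V>"
proof -
  have "L \<subseteq> \<Union>{V. open V \<and> localizable V}"
    using localizable_neighbourhood by blast
  then obtain \<V> where "\<V> \<subseteq> {V. open V \<and> localizable V}" "finite \<V>" "L \<subseteq> \<Union>\<V>"
    using compactE[OF assms, of "{V. open V \<and> localizable V}"] by blast
  then show ?thesis by (intro that) auto
qed

text \<open>An induction in place of a partition of unity: the first summand of \<open>\<eta> = \<eta> \<beta> + \<eta> (1 - \<beta>)\<close> lives in one
  chart, and the second one vanishes on the set where \<open>\<beta>\<close> is 1.\<close>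

lemma integral_divergence_localizable_cover:
  assumes "finite \<V>" "\<And>V. V \<in> \<V> \<Longrightarrow> localizable V" "C1_fun \<eta>" "\<And>p. p \<notin> \<Union>\<V> \<Longrightarrow> \<eta> p = 0"
  shows "integrable vol (divergence \<eta>) \<and> (\<integral>p. divergence \<eta> p \<partial>vol) = 0"
  using assms
proof (induction \<V> arbitrary: \<eta> rule: finite_induct)
  case empty
  have "divergence \<eta> p = 0" for p
    by (rule divergence_eq_0_outside[OF empty(2), of "{}"]) (use empty(3) in auto)
  then have "divergence \<eta> = (\<lambda>_. 0)" by auto
  then show ?case by simp
next
  case (insert V \<V>)
  obtain c K \<beta> where c: "c \<in> \<A>" and K: "compact K" "K \<subseteq> chart_dom c" and \<beta>: "C1_fun \<beta>" "\<forall>p\<in>V. \<beta> p = 1" "\<forall>p. p \<notin> K \<longrightarrow> \<beta> p = 0"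
    using insert.prems(1)[of V] unfolding localizable_def by auto
  let ?\<eta>1 = "\<lambda>p. \<eta> p * \<beta> p" and ?\<eta>2 = "\<lambda>p. \<eta> p * (1 + (-1) * \<beta> p)"
  have C1: "C1_fun ?\<eta>1" "C1_fun ?\<eta>2"
    by (intro C1_fun_mult C1_fun_add C1_fun_const insert.prems(2) \<beta>(1))+
  have 1: "integrable vol (divergence ?\<eta>1)" "(\<integral>p. divergence ?\<eta>1 p \<partial>vol) = 0"
    by (rule integral_divergence_chart[OF C1(1) c K]; use \<beta>(3) in simp)+
  have 2: "integrable vol (divergence ?\<eta>2) \<and> (\<integral>p. divergence ?\<eta>2 p \<partial>vol) = 0"
  proof (rule insert.IH)
    show "localizable W" if "W \<in> \<V>" for W using insert.prems(1) that by simp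
    show "C1_fun ?\<eta>2" by (rule C1(2))
    show "?\<eta>2 p = 0" if "p \<notin> \<Union>\<V>" for p
      using that insert.prems(3)[of p] \<beta>(2) by (cases "p \<in> V") auto
  qed
  have "(\<lambda>p. ?\<eta>1 p + ?\<eta>2 p) = \<eta>" by (simp add: fun_eq_iff algebra_simps)
  then have "divergence \<eta> p = divergence ?\<eta>1 p + divergence ?\<eta>2 p" for p
    using divergence_add[OF C1, of p] by (simp only:)
  then have "divergence \<eta> = (\<lambda>p. divergence ?\<eta>1 p + divergence ?\<eta>2 p)"
    by (rule ext)
  then show ?case using 1 2 by simp
qed

theorem integral_divergence_eq_0:
  assumes "C1_fun \<eta>" "compact L" "\<And>p. p \<notin> L \<Longrightarrow> \<eta> p = 0"
  shows "integrable vol (divergence \<eta>)" "(\<integral>p. divergence \<eta> p \<partial>vol) = 0"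
proof -
  obtain \<V> where \<V>: "finite \<V>" "\<And>V. V \<in> \<V> \<Longrightarrow> localizable V" "L \<subseteq> \<Union>\<V>"
    using compact_finite_localizable_cover[OF assms(2)] by metis
  have "integrable vol (divergence \<eta>) \<and> (\<integral>p. divergence \<eta> p \<partial>vol) = 0"
    by (rule integral_divergence_localizable_cover[OF \<V>(1,2) assms(1)]) (use assms(3) \<V>(3) in auto)
  then show "integrable vol (divergence \<eta>)" "(\<integral>p. divergence \<eta> p \<partial>vol) = 0" by auto
qed

lemma emeasure_compact_chart_finite:
  assumes c: "c \<in> \<A>" and K: "compact K" "K \<subseteq> chart_dom c"
  shows "emeasure vol K < \<infinity>"
proof -
  let ?K = "chart_map c ` K"
  have cK: "compact ?K"
    by (rule compact_continuous_image[OF continuous_on_subset[OF continuous_chart_map[OF c] K(2)] K(1)])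
  have i: "integrable lborel (\<lambda>x. indicator ?K x *\<^sub>R vol_density (param c) x)"
    by (rule borel_integrable_compact[OF cK continuous_on_subset[OF continuous_vol_density[OF c]]]) (use K(2) in auto)
  have "emeasure vol K = chart_volume c K"
    by (rule emeasure_vol[OF c _ K(2)]) (use compact_imp_closed[OF K(1)] in auto)
  also have "\<dots> = (\<integral>\<^sup>+x. ennreal (norm (indicator ?K x *\<^sub>R vol_density (param c) x)) \<partial>lborel)"
    unfolding chart_volume_def
    by (rule nn_integral_cong) (use vol_density_pos[OF c] K(2) in \<open>auto simp: indicator_def less_imp_le\<close>)
  also have "\<dots> < \<infinity>" using i by (simp only: integrable_iff_bounded)
  finally show ?thesis .
qed

lemma emeasure_compact_vol_finite:
  assumes "compact L"
  shows "emeasure vol L < \<infinity>"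
proof -
  obtain \<V> where \<V>: "finite \<V>" "\<And>V. V \<in> \<V> \<Longrightarrow> localizable V" "L \<subseteq> \<Union>\<V>"
    using compact_finite_localizable_cover[OF assms] by metis
  have "\<exists>K. compact K \<and> V \<subseteq> K \<and> emeasure vol K < \<infinity>" if V: "V \<in> \<V>" for V
  proof -
    obtain c K \<beta> where K: "c \<in> \<A>" "compact K" "K \<subseteq> chart_dom c" and \<beta>: "\<forall>p\<in>V. \<beta> p = (1::real)" "\<forall>p. p \<notin> K \<longrightarrow> \<beta> p = 0"
      using \<V>(2)[OF V] unfolding localizable_def by auto
    moreover have "V \<subseteq> K" using \<beta> by (metis subsetI zero_neq_one)
    ultimately show ?thesis using emeasure_compact_chart_finite[OF K] K(2) by (intro exI[of _ K]) simp
  qed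
  then obtain K where K: "\<And>V. V \<in> \<V> \<Longrightarrow> compact (K V) \<and> V \<subseteq> K V \<and> emeasure vol (K V) < \<infinity>" by metis
  have Ks: "K V \<in> sets vol" if "V \<in> \<V>" for V
    using K[OF that] by (simp add: borel_closed compact_imp_closed)
  have "L \<subseteq> (\<Union>V\<in>\<V>. K V)"
  proof
    fix p assume "p \<in> L"
    then obtain V where "V \<in> \<V>" "p \<in> V" using \<V>(3) by blast
    moreover have "V \<subseteq> K V" using K[OF \<open>V \<in> \<V>\<close>] by simp
    ultimately show "p \<in> (\<Union>V\<in>\<V>. K V)" by (intro UN_I[of V]) auto
  qed
  then have "emeasure vol L \<le> emeasure vol (\<Union>V\<in>\<V>. K V)"
    by (rule emeasure_mono) (intro sets.finite_UN \<V>(1) Ks)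
  also have "\<dots> \<le> (\<Sum>V\<in>\<V>. emeasure vol (K V))"
    by (rule emeasure_subadditive_finite[OF \<V>(1)]) (use Ks in auto)
  also have "\<dots> < \<infinity>" using K \<V>(1) by (simp add: less_top[symmetric])
  finally show ?thesis .
qed

lemma continuous_immersion: "continuous_on UNIV F"
proof -
  have "continuous_on (chart_dom c) F" if c: "c \<in> \<A>" for c
  proof -
    have "continuous_on (chart_dom c) (\<lambda>p. (param c) (chart_map c p))"
      by (rule continuous_on_compose2[OF C1_on_continuous_on[OF local_immersion.C1[OF local_immersion[OF c]]]
            continuous_chart_map[OF c]]) simp
    then show ?thesis by (simp add: chart_inv_map[OF c] cong: continuous_on_cong)
  qed
  then have "continuous_on (\<Union>c\<in>\<A>. chart_dom c) F"
    by (intro continuous_on_open_UN open_chart_dom)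
  then show ?thesis using atlas by (simp add: smooth_atlas_def)
qed

lemma C1_fun_radial:
  assumes "\<And>s. (f has_real_derivative f' s) (at s)" "continuous_on UNIV f'"
  shows "C1_fun (\<lambda>p. f ((norm (F p))\<^sup>2))"
  unfolding C1_fun_def
proof
  fix c assume c: "c \<in> \<A>"
  note C1 = local_immersion.C1[OF local_immersion[OF c]]
  have "Ck_on 1 (chart_img c) (\<lambda>x. f (param c x \<bullet> param c x))"
    by (rule C1_on_compose[OF C1_on_real[of UNIV f f'] C1_on_inner[OF C1 C1]]) (use assms in auto)
  then show "Ck_on 1 (chart_img c) ((\<lambda>p. f ((norm (F p))\<^sup>2)) \<circ> chart_inv c)"
    by (simp add: comp_def power2_norm_eq_inner del: Ck_on.simps)
qed

text \<open>The normal part of the position vector of a self-expander is \<open>2 H\<close>, so that the tangential part \<open>t\<close> has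
  squared length \<open>|x|\<^sup>2 - 4 |H|\<^sup>2\<close>, and the gradient of \<open>|x|\<^sup>2\<close> is \<open>2 t\<close>.\<close>

lemma divergence_radial:
  assumes exp: "self_expander \<A> F" and f: "\<And>s. (f has_real_derivative f' s) (at s)"
  defines "H \<equiv> \<lambda>p. norm (mean_curvature \<A> F p)"
  shows "4 * (H p)\<^sup>2 \<le> (norm (F p))\<^sup>2"
    and "divergence (\<lambda>p. f ((norm (F p))\<^sup>2)) p = f ((norm (F p))\<^sup>2) * (real CARD('n) + 2 * (H p)\<^sup>2) +
      2 * f' ((norm (F p))\<^sup>2) * ((norm (F p))\<^sup>2 - 4 * (H p)\<^sup>2)"
proof -
  let ?c = "chart_at \<A> p"
  define X x where "X = param ?c" and "x = chart_map ?c p"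
  interpret local_immersion X "chart_img ?c" unfolding X_def by (rule local_immersion[OF chart_at(1)])
  have x: "x \<in> chart_img ?c" unfolding x_def using chart_at(2) by blast
  have Xx: "X x = F p" by (simp add: X_def x_def chart_inv_map[OF chart_at])
  define t where "t = frechet_derivative X (at x) (tangent_coords X x)"
  define z where "z = F p - t"
  have "mean_curvature \<A> F p = (1/2) *\<^sub>R normal_part (param_tangent X x) (X x)"
    using exp by (simp add: self_expander_def tangent_space_def X_def[symmetric] x_def[symmetric] Xx)
  then have H: "mean_curvature \<A> F p = (1/2) *\<^sub>R z"
    using normal_part_position[OF x] by (simp add: Xx z_def t_def)
  have zt: "z \<bullet> t = 0"
    using inner_residual[OF x, of "tangent_coords X x"] by (simp add: Xx z_def t_def)
  have F: "F p = z + t" by (simp add: z_def)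
  have H2: "4 * (H p)\<^sup>2 = z \<bullet> z"
    by (simp add: H_def H power_divide power2_norm_eq_inner)
  have norm2: "(norm (F p))\<^sup>2 = z \<bullet> z + t \<bullet> t"
    using zt by (simp add: F power2_norm_eq_inner inner_add_left inner_add_right inner_commute)
  show "4 * (H p)\<^sup>2 \<le> (norm (F p))\<^sup>2" by (simp add: H2 norm2)
  have HF: "mean_curvature \<A> F p \<bullet> F p = 2 * (H p)\<^sup>2"
    using H2 zt by (simp add: H F inner_add_right)
  have "((\<lambda>y. X y \<bullet> X y) has_derivative (\<lambda>v. X x \<bullet> frechet_derivative X (at x) v + frechet_derivative X (at x) v \<bullet> X x)) (at x)"
    by (intro has_derivative_inner C1_on_has_derivative[OF C1 x])
  moreover have "(f has_derivative (\<lambda>s. f' (X x \<bullet> X x) * s)) (at (X x \<bullet> X x))"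
    using f by (simp add: has_field_derivative_def)
  ultimately have "((\<lambda>y. f (X y \<bullet> X y)) has_derivative
      (\<lambda>v. f' (X x \<bullet> X x) * (X x \<bullet> frechet_derivative X (at x) v + frechet_derivative X (at x) v \<bullet> X x))) (at x)"
    by (rule has_derivative_compose)
  then have "frechet_derivative (\<lambda>y. f (X y \<bullet> X y)) (at x) (tangent_coords X x) = f' (X x \<bullet> X x) * (F p \<bullet> t + t \<bullet> F p)"
    by (simp add: frechet_derivative_at[symmetric] Xx t_def)
  moreover have "tangential_derivative (\<lambda>p. f ((norm (F p))\<^sup>2)) p = frechet_derivative (\<lambda>y. f (X y \<bullet> X y)) (at x) (tangent_coords X x)"
    by (simp add: tangential_derivative_def Let_def comp_def power2_norm_eq_inner X_def x_def)
  ultimately have "tangential_derivative (\<lambda>p. f ((norm (F p))\<^sup>2)) p = f' ((norm (F p))\<^sup>2) * (2 * (t \<bullet> t))"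
    using zt by (simp add: Xx power2_norm_eq_inner) (simp add: F inner_add_left inner_add_right inner_commute)
  moreover have "t \<bullet> t = (norm (F p))\<^sup>2 - 4 * (H p)\<^sup>2" by (simp add: H2 norm2)
  ultimately show "divergence (\<lambda>p. f ((norm (F p))\<^sup>2)) p = f ((norm (F p))\<^sup>2) * (real CARD('n) + 2 * (H p)\<^sup>2) +
      2 * f' ((norm (F p))\<^sup>2) * ((norm (F p))\<^sup>2 - 4 * (H p)\<^sup>2)"
    by (simp add: divergence_def HF)
qed

end


section \<open>Exponentially weighted volume of self-expanders\<close>

text \<open>The condition on \<open>\<alpha>\<close> says precisely that the quadratic in \<open>t\<close> has a negative leading coefficient.\<close>

lemma quadratic_drift_bound:
  fixes a b \<alpha> n :: real
  assumes a: "0 \<le> a" "a < 1/2" and b: "0 \<le> b" and n: "0 \<le> n" and \<alpha>: "4 * a\<^sup>2 / (1 - 4 * a\<^sup>2) < \<alpha>"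
  obtains K R where "0 \<le> K" "\<And>t h. 0 \<le> t \<Longrightarrow> 0 \<le> h \<Longrightarrow> h \<le> a * t + b \<Longrightarrow>
    n + 2 * (1 + \<alpha>) * h\<^sup>2 - \<alpha> / 2 * t\<^sup>2 \<le> (if t \<le> R then K else 0) - 1"
proof -
  have "a\<^sup>2 < (1/2)\<^sup>2" using a by (intro power_strict_mono) auto
  then have a4: "0 < 1 - 4 * a\<^sup>2" by (simp add: power2_eq_square)
  have "0 \<le> 4 * a\<^sup>2 / (1 - 4 * a\<^sup>2)" using a4 by simp
  then have "0 < \<alpha>" using \<alpha> by linarith
  have "4 * a\<^sup>2 < \<alpha> * (1 - 4 * a\<^sup>2)" using \<alpha> a4 by (simp add: divide_less_eq)
  define \<epsilon> where "\<epsilon> = \<alpha> / 2 - 2 * (1 + \<alpha>) * a\<^sup>2"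
  define B where "B = 4 * (1 + \<alpha>) * a * b"
  define C where "C = n + 2 * (1 + \<alpha>) * b\<^sup>2"
  \<comment> \<open>if \<open>t \<ge> R\<close> then \<open>\<epsilon> t \<ge> B + C + 1\<close> and \<open>t \<ge> 1\<close>\<close>
  define R where "R = 1 + (B + C + 1) / \<epsilon>"
  have \<epsilon>: "0 < \<epsilon>" using \<open>4 * a\<^sup>2 < \<alpha> * (1 - 4 * a\<^sup>2)\<close> by (simp add: \<epsilon>_def algebra_simps)
  have B: "0 \<le> B" and C: "0 \<le> C" using a b n \<open>0 < \<alpha>\<close> by (simp_all add: B_def C_def)
  have q: "n + 2 * (1 + \<alpha>) * (a * t + b)\<^sup>2 - \<alpha> / 2 * t\<^sup>2 = C + B * t - \<epsilon> * t\<^sup>2" for t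
    by (simp add: \<epsilon>_def B_def C_def power2_eq_square algebra_simps)
  show ?thesis
  proof (rule that[of "C + B * R + 1" R])
    have "1 \<le> R" using \<epsilon> B C by (simp add: R_def)
    then show "0 \<le> C + B * R + 1" using B C by simp
    fix t h :: real assume t: "0 \<le> t" and h: "0 \<le> h" "h \<le> a * t + b"
    have "h\<^sup>2 \<le> (a * t + b)\<^sup>2" using h by (intro power_mono) auto
    then have "2 * (1 + \<alpha>) * h\<^sup>2 \<le> 2 * (1 + \<alpha>) * (a * t + b)\<^sup>2"
      using \<open>0 < \<alpha>\<close> by (intro mult_left_mono) auto
    then have "n + 2 * (1 + \<alpha>) * h\<^sup>2 - \<alpha> / 2 * t\<^sup>2 \<le> C + B * t - \<epsilon> * t\<^sup>2"
      using q[of t] by linarith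
    also have "\<dots> \<le> (if t \<le> R then C + B * R + 1 else 0) - 1"
    proof (cases "t \<le> R")
      case True
      then have "B * t \<le> B * R" using B by (rule mult_left_mono)
      moreover have "0 \<le> \<epsilon> * t\<^sup>2" using \<epsilon> by simp
      ultimately show ?thesis using True by simp
    next
      case False
      then have "1 \<le> t" using \<open>1 \<le> R\<close> by simp
      have "B + C + 1 \<le> \<epsilon> * t"
        using False \<epsilon> by (simp add: R_def field_simps)
      then have "(B + C + 1) * t \<le> \<epsilon> * t * t" using t by (rule mult_right_mono)
      moreover have "(C + 1) * 1 \<le> (C + 1) * t" using C \<open>1 \<le> t\<close> by (intro mult_left_mono) auto
      ultimately show ?thesis using False by (simp add: power2_eq_square algebra_simps)
    qed
    finally show "n + 2 * (1 + \<alpha>) * h\<^sup>2 - \<alpha> / 2 * t\<^sup>2 \<le> (if t \<le> R then C + B * R + 1 else 0) - 1" .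
  qed
qed

text \<open>The cut-off factor decreases in \<open>s\<close>, hence its derivative only improves the upper bound for the
  divergence; it increases to 1 as \<open>R\<close> tends to infinity.\<close>

definition cutoff_weight :: "real \<Rightarrow> real \<Rightarrow> real \<Rightarrow> real"
  where "cutoff_weight \<alpha> R s = exp (- (\<alpha> / 4) * s) * (max 0 (1 - s / R))\<^sup>2"

definition cutoff_weight' :: "real \<Rightarrow> real \<Rightarrow> real \<Rightarrow> real"
  where "cutoff_weight' \<alpha> R s = - (\<alpha> / 4) * cutoff_weight \<alpha> R s - exp (- (\<alpha> / 4) * s) * (2 * max 0 (1 - s / R) / R)"

lemma cutoff_weight_derivative:
  "(cutoff_weight \<alpha> R has_real_derivative cutoff_weight' \<alpha> R s) (at s)"
proof -
  have "((\<lambda>s. 1 - s / R) has_real_derivative - (1 / R)) (at s)"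
    unfolding divide_inverse by (auto intro!: derivative_eq_intros)
  from DERIV_chain2[OF pos_part_square_derivative this]
  have pos: "((\<lambda>s. (max 0 (1 - s / R))\<^sup>2) has_real_derivative 2 * max 0 (1 - s / R) * - (1 / R)) (at s)" .
  have "((\<lambda>s. exp (- (\<alpha> / 4) * s)) has_real_derivative exp (- (\<alpha> / 4) * s) * - (\<alpha> / 4)) (at s)"
    by (auto intro!: derivative_eq_intros)
  from DERIV_mult[OF this pos] show ?thesis
    unfolding cutoff_weight_def[abs_def] cutoff_weight'_def
    by (rule DERIV_cong) (simp add: algebra_simps)
qed

lemma continuous_cutoff_weight': "continuous_on UNIV (cutoff_weight' \<alpha> R)"
  unfolding cutoff_weight'_def[abs_def] cutoff_weight_def divide_inverse
  by (intro continuous_intros)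

lemma cutoff_weight'_le: "0 < R \<Longrightarrow> cutoff_weight' \<alpha> R s \<le> - (\<alpha> / 4) * cutoff_weight \<alpha> R s"
  by (simp add: cutoff_weight'_def)

lemma cutoff_weight_nonneg: "0 \<le> cutoff_weight \<alpha> R s"
  by (simp add: cutoff_weight_def)

lemma cutoff_weight_le_1:
  assumes "0 \<le> \<alpha>" "0 < R" "0 \<le> s"
  shows "cutoff_weight \<alpha> R s \<le> 1"
proof -
  have "exp (- (\<alpha> / 4) * s) \<le> 1" using assms by simp
  moreover have "(max 0 (1 - s / R))\<^sup>2 \<le> 1\<^sup>2" using assms by (intro power_mono) auto
  ultimately show ?thesis
    unfolding cutoff_weight_def by (intro mult_le_one) auto
qed

lemma cutoff_weight_eq_0: "0 < R \<Longrightarrow> R \<le> s \<Longrightarrow> cutoff_weight \<alpha> R s = 0"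
  by (simp add: cutoff_weight_def max_def)

lemma cutoff_weight_limit: "(\<lambda>N. cutoff_weight \<alpha> (real (Suc N)) s) \<longlonglongrightarrow> exp (- (\<alpha> / 4) * s)"
proof -
  have "(\<lambda>N. s / real (Suc N)) \<longlonglongrightarrow> 0"
    using tendsto_mult_right_zero[OF LIMSEQ_inverse_real_of_nat, of s] by (simp add: divide_inverse)
  then have "(\<lambda>N. exp (- (\<alpha> / 4) * s) * (max 0 (1 - s / real (Suc N)))\<^sup>2) \<longlonglongrightarrow> exp (- (\<alpha> / 4) * s) * (max 0 (1 - 0))\<^sup>2"
    by (intro tendsto_intros)
  then show ?thesis by (simp add: cutoff_weight_def)
qed

context immersed_manifold
begin

lemma measurable_immersion: "F \<in> vol \<rightarrow>\<^sub>M borel"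
  using borel_measurable_continuous_onI[OF continuous_immersion] by (simp add: measurable_cong_sets[OF sets_vol refl])

text \<open>The divergence of the cut-off field integrates to zero, and it is at most \<open>K\<close> times the indicator of a
  ball minus the weight. This bounds the integral of the weight uniformly in the cut-off radius, and
  Fatou's lemma removes the cut-off.\<close>

lemma weighted_volume_finite:
  assumes proper: "proper_immersion F" and exp: "self_expander \<A> F"
    and a: "0 \<le> a" "a < 1/2" and b: "0 < b" and H: "\<And>p. norm (mean_curvature \<A> F p) \<le> a * norm (F p) + b"
    and \<alpha>: "4 * a\<^sup>2 / (1 - 4 * a\<^sup>2) < \<alpha>"
  shows "(\<integral>\<^sup>+p. ennreal (exp (- (\<alpha> / 4) * (norm (F p))\<^sup>2)) \<partial>vol) < \<infinity>"
proof -
  have "a\<^sup>2 < (1/2)\<^sup>2" using a by (intro power_strict_mono) auto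
  then have "0 \<le> 4 * a\<^sup>2 / (1 - 4 * a\<^sup>2)" by (simp add: power2_eq_square)
  then have "0 < \<alpha>" using \<alpha> by linarith
  obtain K R0 where K: "0 \<le> K" and drift: "\<And>t h. 0 \<le> t \<Longrightarrow> 0 \<le> h \<Longrightarrow> h \<le> a * t + b \<Longrightarrow>
      real CARD('n) + 2 * (1 + \<alpha>) * h\<^sup>2 - \<alpha> / 2 * t\<^sup>2 \<le> (if t \<le> R0 then K else 0) - 1"
    using quadratic_drift_bound[OF a less_imp_le[OF b] _ \<alpha>, of "real CARD('n)"] by (metis of_nat_0_le_iff)
  have compact_preimage: "compact (F -` cball 0 r)" for r
    using proper by (simp add: proper_immersion_def)
  have fin: "emeasure vol (F -` cball 0 r) < \<infinity>" for r
    by (rule emeasure_compact_vol_finite[OF compact_preimage])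
  have meas: "F -` cball 0 r \<in> sets vol" for r
    using measurable_sets[OF measurable_immersion, of "cball 0 r"] by simp
  let ?w = "\<lambda>N p. cutoff_weight \<alpha> (real (Suc N)) ((norm (F p))\<^sup>2)"
  let ?B = "F -` cball 0 R0"
  have w01: "0 \<le> ?w N p" "?w N p \<le> 1" for N p
    using cutoff_weight_nonneg cutoff_weight_le_1[of \<alpha>] \<open>0 < \<alpha>\<close> by auto
  have supp: "?w N p = 0" if "p \<notin> F -` cball 0 (sqrt (real (Suc N)))" for N p
  proof -
    have "sqrt (real (Suc N)) \<le> norm (F p)" using that by simp
    then have "real (Suc N) \<le> (norm (F p))\<^sup>2" using sqrt_le_D by blast
    then show ?thesis by (intro cutoff_weight_eq_0) auto
  qed
  have C1: "C1_fun (?w N)" for N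
    by (rule C1_fun_radial[OF cutoff_weight_derivative continuous_cutoff_weight'])
  have wm: "?w N \<in> borel_measurable vol" for N
    unfolding cutoff_weight_def using measurable_immersion by measurable
  have wint: "integrable vol (?w N)" for N
  proof (rule Bochner_Integration.integrable_bound[OF _ wm])
    show "integrable vol (indicator (F -` cball 0 (sqrt (real (Suc N)))) :: 'p \<Rightarrow> real)"
      using fin meas by (simp add: integrable_indicator_iff)
    show "AE p in vol. norm (?w N p) \<le> norm (indicator (F -` cball 0 (sqrt (real (Suc N)))) p :: real)"
      using supp w01 by (intro AE_I2) (auto simp: indicator_def)
  qed
  have bound: "divergence (?w N) p \<le> K * indicator ?B p - ?w N p" for N p
  proof -
    let ?s = "(norm (F p))\<^sup>2" and ?h = "norm (mean_curvature \<A> F p)" and ?R = "real (Suc N)"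
    have h: "0 \<le> ?s - 4 * ?h\<^sup>2" using divergence_radial(1)[OF exp cutoff_weight_derivative] by simp
    have "divergence (?w N) p = ?w N p * (real CARD('n) + 2 * ?h\<^sup>2) + 2 * cutoff_weight' \<alpha> ?R ?s * (?s - 4 * ?h\<^sup>2)"
      by (rule divergence_radial(2)[OF exp cutoff_weight_derivative])
    also have "\<dots> \<le> ?w N p * (real CARD('n) + 2 * ?h\<^sup>2) + 2 * (- (\<alpha> / 4) * ?w N p) * (?s - 4 * ?h\<^sup>2)"
      using cutoff_weight'_le[of ?R \<alpha> ?s] h by (intro add_left_mono mult_right_mono) auto
    also have "\<dots> = ?w N p * (real CARD('n) + 2 * (1 + \<alpha>) * ?h\<^sup>2 - \<alpha> / 2 * ?s)"
      by (simp add: algebra_simps)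
    also have "\<dots> \<le> ?w N p * ((if norm (F p) \<le> R0 then K else 0) - 1)"
      using drift[OF _ _ H[of p]] w01(1) by (intro mult_left_mono) auto
    also have "\<dots> = (?w N p * K) * indicator ?B p - ?w N p"
      by (simp add: indicator_def algebra_simps)
    also have "\<dots> \<le> K * indicator ?B p - ?w N p"
      using w01[of N p] K by (intro diff_right_mono mult_right_mono mult_left_le_one_le) auto
    finally show ?thesis .
  qed
  have int_le: "(\<integral>p. ?w N p \<partial>vol) \<le> K * measure vol ?B" for N
  proof -
    note div = integral_divergence_eq_0[OF C1[of N] compact_preimage supp]
    have iB: "integrable vol (\<lambda>p. K * indicator ?B p :: real)"
      using fin meas by (intro integrable_mult_right) (simp add: integrable_indicator_iff)
    have "0 = (\<integral>p. divergence (?w N) p \<partial>vol)" by (rule div(2)[symmetric])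
    also have "\<dots> \<le> (\<integral>p. K * indicator ?B p - ?w N p \<partial>vol)"
      by (rule integral_mono[OF div(1) Bochner_Integration.integrable_diff[OF iB wint] bound])
    also have "\<dots> = K * measure vol ?B - (\<integral>p. ?w N p \<partial>vol)"
      using iB wint meas by simp
    finally show ?thesis by simp
  qed
  have nn_le: "(\<integral>\<^sup>+p. ennreal (?w N p) \<partial>vol) \<le> ennreal (K * measure vol ?B)" for N
    using nn_integral_eq_integral[OF wint] w01(1) int_le by (simp add: ennreal_leI)
  have "(\<integral>\<^sup>+p. ennreal (exp (- (\<alpha> / 4) * (norm (F p))\<^sup>2)) \<partial>vol) = (\<integral>\<^sup>+p. liminf (\<lambda>N. ennreal (?w N p)) \<partial>vol)"
  proof (rule nn_integral_cong)
    fix p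
    have "(\<lambda>N. ennreal (?w N p)) \<longlonglongrightarrow> ennreal (exp (- (\<alpha> / 4) * (norm (F p))\<^sup>2))"
      by (rule tendsto_ennrealI[OF cutoff_weight_limit])
    then show "ennreal (exp (- (\<alpha> / 4) * (norm (F p))\<^sup>2)) = liminf (\<lambda>N. ennreal (?w N p))"
      by (rule lim_imp_Liminf[OF sequentially_bot, symmetric])
  qed
  also have "\<dots> \<le> liminf (\<lambda>N. \<integral>\<^sup>+p. ennreal (?w N p) \<partial>vol)"
    by (rule nn_integral_liminf) (use wm in measurable)
  also have "\<dots> \<le> ennreal (K * measure vol ?B)"
    by (rule Liminf_le[OF sequentially_bot]) (use nn_le in simp)
  also have "\<dots> < \<infinity>" by simp
  finally show ?thesis .
qed

text \<open>On the ball of radius \<open>r\<close> the weight is at least its value on the boundary.\<close>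

lemma volume_ball_le_weighted_volume:
  assumes "0 \<le> \<alpha>" "0 < r"
  shows "emeasure vol (F -` ball 0 r) \<le>
    ennreal (exp (\<alpha> / 4 * r\<^sup>2)) * (\<integral>\<^sup>+p. ennreal (exp (- (\<alpha> / 4) * (norm (F p))\<^sup>2)) \<partial>vol)"
proof -
  have "F -` ball 0 r \<in> sets vol"
    using measurable_sets[OF measurable_immersion, of "ball 0 r"] by simp
  then have "emeasure vol (F -` ball 0 r) = (\<integral>\<^sup>+p. indicator (F -` ball 0 r) p \<partial>vol)"
    by simp
  also have "\<dots> \<le> (\<integral>\<^sup>+p. ennreal (exp (\<alpha> / 4 * r\<^sup>2)) * ennreal (exp (- (\<alpha> / 4) * (norm (F p))\<^sup>2)) \<partial>vol)"
  proof (rule nn_integral_mono)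
    fix p
    show "indicator (F -` ball 0 r) p \<le> ennreal (exp (\<alpha> / 4 * r\<^sup>2)) * ennreal (exp (- (\<alpha> / 4) * (norm (F p))\<^sup>2))"
    proof (cases "p \<in> F -` ball 0 r")
      case True
      then have "(norm (F p))\<^sup>2 \<le> r\<^sup>2" by (intro power_mono) auto
      then have "0 \<le> \<alpha> / 4 * r\<^sup>2 + - (\<alpha> / 4) * (norm (F p))\<^sup>2"
        using assms(1) mult_left_mono[of "(norm (F p))\<^sup>2" "r\<^sup>2" "\<alpha> / 4"] by simp
      then have "1 \<le> exp (\<alpha> / 4 * r\<^sup>2) * exp (- (\<alpha> / 4) * (norm (F p))\<^sup>2)"
        by (simp only: exp_add[symmetric] one_le_exp_iff)
      then show ?thesis
        using True by (simp add: ennreal_mult[symmetric] del: ennreal_1 flip: ennreal_1)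
    qed simp
  qed
  also have "\<dots> = ennreal (exp (\<alpha> / 4 * r\<^sup>2)) * (\<integral>\<^sup>+p. ennreal (exp (- (\<alpha> / 4) * (norm (F p))\<^sup>2)) \<partial>vol)"
    by (rule nn_integral_cmult) (use measurable_immersion in measurable)
  finally show ?thesis .
qed

end

theorem theorem1p1:
  fixes \<A> :: "('p::{t2_space, second_countable_topology}, 'n::finite) chart set"
    and F :: "'p \<Rightarrow> real ^ 'm::finite"
    and a b :: real
  assumes "CARD('n) < CARD('m)"
    and "smooth_atlas \<A>"
    and "smooth_immersion \<A> F"
    and "complete_immersed F"
    and "proper_immersion F"
    and "self_expander \<A> F"
    and "0 \<le> a" and "a < 1/2" and "b > 0"
    and "\<And>p. norm (mean_curvature \<A> F p) \<le> a * norm (F p) + b"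
  shows "(\<forall>\<alpha> > 4 * a\<^sup>2 / (1 - 4 * a\<^sup>2).
            (\<integral>\<^sup>+p. ennreal (exp (- (\<alpha> / 4) * (norm (F p))\<^sup>2)) \<partial>volume_measure \<A> F) < \<infinity> \<and>
            (\<exists>C::real. \<forall>r>0.
               emeasure (volume_measure \<A> F) (F -` ball 0 r) \<le> ennreal (C * exp (\<alpha> / 4 * r\<^sup>2)))) \<and>
         (a < 1 / (2 * sqrt 2) \<longrightarrow>
            (\<integral>\<^sup>+p. ennreal (exp (- (norm (F p))\<^sup>2 / 4)) \<partial>volume_measure \<A> F) < \<infinity>)"
proof -
  interpret immersed_manifold \<A> F
    by (rule immersed_manifold.intro) fact+
  let ?I = "\<lambda>\<alpha>. \<integral>\<^sup>+p. ennreal (exp (- (\<alpha> / 4) * (norm (F p))\<^sup>2)) \<partial>vol"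
  have "a\<^sup>2 < (1/2)\<^sup>2" using assms(7,8) by (intro power_strict_mono) auto
  then have a4: "0 < 1 - 4 * a\<^sup>2" by (simp add: power2_eq_square)
  have I: "?I \<alpha> < \<infinity>" if "4 * a\<^sup>2 / (1 - 4 * a\<^sup>2) < \<alpha>" for \<alpha>
    by (rule weighted_volume_finite[OF assms(5-10) that])
  have "\<exists>C::real. \<forall>r>0. emeasure vol (F -` ball 0 r) \<le> ennreal (C * exp (\<alpha> / 4 * r\<^sup>2))"
    if \<alpha>: "4 * a\<^sup>2 / (1 - 4 * a\<^sup>2) < \<alpha>" for \<alpha>
  proof (intro exI allI impI)
    fix r :: real assume "0 < r"
    have "0 \<le> \<alpha>" using \<alpha> a4 by (smt (verit) divide_nonneg_pos zero_le_power2)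
    have "?I \<alpha> = ennreal (enn2real (?I \<alpha>))" using I[OF \<alpha>] by simp
    then show "emeasure vol (F -` ball 0 r) \<le> ennreal (enn2real (?I \<alpha>) * exp (\<alpha> / 4 * r\<^sup>2))"
      using volume_ball_le_weighted_volume[OF \<open>0 \<le> \<alpha>\<close> \<open>0 < r\<close>]
      by (simp add: ennreal_mult mult.commute)
  qed
  moreover have "(\<integral>\<^sup>+p. ennreal (exp (- (norm (F p))\<^sup>2 / 4)) \<partial>vol) < \<infinity>" if "a < 1 / (2 * sqrt 2)"
  proof -
    have "a\<^sup>2 < (1 / (2 * sqrt 2))\<^sup>2" using that assms(7) by (intro power_strict_mono) auto
    then have "8 * a\<^sup>2 < 1" by (simp add: power_divide power_mult_distrib)
    then have "4 * a\<^sup>2 / (1 - 4 * a\<^sup>2) < 1" using a4 by (simp add: divide_less_eq)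
    from I[OF this] show ?thesis by simp
  qed
  ultimately show ?thesis using I by blast
qed

end
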